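(* The link module sequence is a strictly stronger link invariant than the reduced link module sequence. That is: 1. If $L$ and $L'$ are links (with the same number of components) whose link module sequences are equivalent, then the reduced link module sequences of $L$ and $L'$ are equivalent. 2. There exist links $L$ and $L'$ with the same number of components whose reduced link module sequences are equivalent but whose link module sequences are not equivalent.
   Context: A link $L=K_1\cup\dots\cup K_\mu$ is a union of finitely many pairwise disjoint, tame (piecewise smooth), oriented embedded circles in $\mathbb{S}^3$, with indexed components. A diagram $D$ of $L$ is obtained from a regular projection to the plane (finitely many singularities, all transverse double points called crossings) by removing short segments of the underpassing arc at each crossing. $C(D)$ is the set of crossings; $A(D)$ is the set of connected components of $D$, called arcs; $\kappa:A(D)\to\{1,\dots,\mu\}$ is such that the arc $a$ is part of the image of $K_{\kappa(a)}$. At a crossing $c$, let $a_1$ be the overpassing arc, $a_2$ the underpassing arc on the right side of $a_1$ and $a_3$ the underpassing arc on the left side of $a_1$ (with respect to the orientation of $a_1$); so $\kappa(a_2)=\kappa(a_3)$. Let $\Lambda_\mu=\mathbb{Z}[t_1^{\pm1},\dots,t_\mu^{\pm1}]$. Let $\rho_D:\Lambda_\mu^{C(D)}\to\Lambda_\mu^{A(D)}$ be the $\Lambda_\mu$-linear map between free modules with $\rho_D(c)=(1-t_{\kappa(a_2)})a_1+t_{\kappa(a_1)}a_2-a_3$ at each crossing $c$. The Alexander module $M_A(L)$ is the cokernel of $\rho_D$, with quotient map $\gamma_D:\Lambda_\mu^{A(D)}\to M_A(L)$; up to isomorphism it does not depend on $D$. Let $I_\mu$ be the ideal of $\Lambda_\mu$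 generated by $t_1-1,\dots,t_\mu-1$, and let $\phi_L:M_A(L)\to I_\mu$ be the $\Lambda_\mu$-linear epimorphism with $\phi_L(\gamma_D(a))=t_{\kappa(a)}-1$ for all $a\in A(D)$. The link module sequence of $L$ is $0\to\ker\phi_L\to M_A(L)\xrightarrow{\phi_L}I_\mu\to0$. For links $L,L'$ with the same number $\mu$ of components, their link module sequences are equivalent if there is a $\Lambda_\mu$-linear isomorphism $f:M_A(L)\to M_A(L')$ with $\phi_L=\phi_{L'}f$. Let $\Lambda=\mathbb{Z}[t^{\pm1}]$ and let $I$ be the ideal of $\Lambda$ generated by $t-1$. The reduced Alexander module $M_A^{red}(L)$ is the $\Lambda$-module obtained by setting all $t_i=t$ in the definition of $M_A(L)$, with quotient map $\gamma_D^{red}:\Lambda^{A(D)}\to M_A^{red}(L)$. The $\Lambda$-linear epimorphism $\phi_L^{red}:M_A^{red}(L)\to I$ has $\phi_L^{red}(\gamma_D^{red}(a))=t-1$ for all $a\in A(D)$. The reduced link module sequence is $0\to\ker\phi_L^{red}\to M_A^{red}(L)\xrightarrow{\phi_L^{red}}I\to0$. The reduced link module sequences of $L$ and $L'$ are equivalent if there is a $\Lambda$-linear isomorphism $f:M_A^{red}(L)\to M_A^{red}(L')$ with $\phi_L^{red}=\phi_{L'}^{red}f$. *)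

theory Defs
  imports
    "HOL-Analysis.Analysis"
    "HOL-Algebra.Module"
    "HOL-Algebra.AbelCoset"
    "HOL-Library.Poly_Mapping"
begin

section \<open>Links in the 3-sphere\<close>

text \<open>All derivatives on a piece are one-sided at its end points; \<open>D n\<close> is the \<open>n\<close>-th derivative.\<close>

definition smooth_regular_on :: "(real \<Rightarrow> 'a::real_normed_vector) \<Rightarrow> real set \<Rightarrow> bool" where
  "smooth_regular_on f S \<longleftrightarrow>
     (\<exists>D. D 0 = f \<and>
        (\<forall>n. \<forall>t\<in>S. (D n has_vector_derivative D (Suc n) t) (at t within S)) \<and>
        (\<forall>t\<in>S. D 1 t \<noteq> 0))"

text \<open>
  A closed curve is a function on the reals of period 1.  Derivatives are required not to vanish
  because a piecewise smooth parametrization that is allowed to stop can trace a wild knot.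
\<close>

definition piecewise_smooth_loop :: "(real \<Rightarrow> 'a::real_normed_vector) \<Rightarrow> bool" where
  "piecewise_smooth_loop f \<longleftrightarrow>
     (\<forall>t. f (t + 1) = f t) \<and>
     (\<exists>m p. p 0 = 0 \<and> p m = 1 \<and>
        (\<forall>k<m. p k < p (Suc k) \<and> smooth_regular_on f {p k..p (Suc k)}))"

text \<open>The components are indexed by \<open>1, \<dots>, num_comps\<close>; \<^term>\<open>knot L i\<close> is irrelevant for other \<open>i\<close>.\<close>

record link =
  num_comps :: nat
  knot :: "nat \<Rightarrow> real \<Rightarrow> real^4"

definition is_link :: "link \<Rightarrow> bool" where
  "is_link L \<longleftrightarrow>
     1 \<le> num_comps L \<and>
     (\<forall>i\<in>{1..num_comps L}.
        piecewise_smooth_loop (knot L i) \<and>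
        inj_on (knot L i) {0..<1} \<and>
        range (knot L i) \<subseteq> sphere 0 1) \<and>
     (\<forall>i\<in>{1..num_comps L}. \<forall>j\<in>{1..num_comps L}. i \<noteq> j \<longrightarrow>
        range (knot L i) \<inter> range (knot L j) = {})"


section \<open>Link diagrams\<close>

text \<open>
  A diagram is a family of plane curves with heights; the viewer looks down from above, the first
  coordinate of the plane pointing right and the second one up.  The segments removed at the
  crossings are the images of the open parameter intervals of radius \<^term>\<open>gap\<close> around the
  parameters of the underpasses.
\<close>

record diagram =
  num_strands :: nat
  plane :: "nat \<Rightarrow> real \<Rightarrow> real \<times> real"
  height :: "nat \<Rightarrow> real \<Rightarrow> real"
  gap :: real

definition passes_under :: "diagram \<Rightarrow> nat \<Rightarrow> real \<Rightarrow> nat \<Rightarrow> real \<Rightarrow> bool" where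
  "passes_under D i s j u \<longleftrightarrow>
     i \<in> {1..num_strands D} \<and> j \<in> {1..num_strands D} \<and>
     plane D i s = plane D j u \<and> height D i s < height D j u"

definition underpass :: "diagram \<Rightarrow> nat \<Rightarrow> real \<Rightarrow> bool" where
  "underpass D i s \<longleftrightarrow> (\<exists>j u. passes_under D i s j u)"

definition crossings :: "diagram \<Rightarrow> (real \<times> real) set" where
  "crossings D = {plane D i s | i s. underpass D i s}"

definition drawing :: "diagram \<Rightarrow> (real \<times> real) set" where
  "drawing D = {plane D i u | i u. i \<in> {1..num_strands D} \<and>
                  \<not> (\<exists>s. underpass D i s \<and> \<bar>u - s\<bar> < gap D)}"

definition arcs :: "diagram \<Rightarrow> (real \<times> real) set set" where
  "arcs D = components (drawing D)"

definition cross2 :: "real \<times> real \<Rightarrow> real \<times> real \<Rightarrow> real" where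
  "cross2 v w = fst v * snd w - snd v * fst w"

abbreviation velocity :: "diagram \<Rightarrow> nat \<Rightarrow> real \<Rightarrow> real \<times> real" where
  "velocity D i s \<equiv> vector_derivative (plane D i) (at s)"

definition regular_diagram :: "diagram \<Rightarrow> bool" where
  "regular_diagram D \<longleftrightarrow>
     (\<forall>i\<in>{1..num_strands D}. piecewise_smooth_loop (plane D i)) \<and>
     finite (crossings D) \<and>
     (\<forall>q\<in>crossings D.
        card {(i, s). i \<in> {1..num_strands D} \<and> s \<in> {0..<1} \<and> plane D i s = q} = 2) \<and>
     (\<forall>i s j u. passes_under D i s j u \<longrightarrow>
        plane D i differentiable (at s) \<and> plane D j differentiable (at u) \<and>
        cross2 (velocity D j u) (velocity D i s) \<noteq> 0)"

text \<open>
  The removed segments are short: even after doubling, each one meets no crossing but its own.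
  In particular the closures of distinct removed segments are disjoint.
\<close>

definition short_gap :: "diagram \<Rightarrow> bool" where
  "short_gap D \<longleftrightarrow>
     0 < gap D \<and>
     (\<forall>i s u. underpass D i s \<and> 0 < \<bar>u - s\<bar> \<and> \<bar>u - s\<bar> \<le> 2 * gap D \<longrightarrow>
        plane D i u \<notin> crossings D)"

text \<open>
  Stereographic projection from the point \<open>(0, 0, 0, 1)\<close>, split into the orthogonal projection to
  the plane and the height above it.  Composing with a rotation of the 3-sphere gives all
  stereographic projections followed by all orthogonal projections of 3-space to a plane, with a
  consistent orientation.
\<close>

definition stereo_plane :: "real^4 \<Rightarrow> real \<times> real" where
  "stereo_plane x = (x$1 / (1 - x$4), x$2 / (1 - x$4))"

definition stereo_height :: "real^4 \<Rightarrow> real" where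
  "stereo_height x = x$3 / (1 - x$4)"

definition diagram_of :: "diagram \<Rightarrow> link \<Rightarrow> bool" where
  "diagram_of D L \<longleftrightarrow>
     num_strands D = num_comps L \<and>
     (\<exists>Q :: real^4^4. rotation_matrix Q \<and>
        (\<forall>i\<in>{1..num_comps L}. \<forall>s.
           (Q *v knot L i s) $ 4 \<noteq> 1 \<and>
           plane D i s = stereo_plane (Q *v knot L i s) \<and>
           height D i s = stereo_height (Q *v knot L i s))) \<and>
     regular_diagram D \<and> short_gap D"

definition strand_of :: "diagram \<Rightarrow> (real \<times> real) set \<Rightarrow> nat" where
  "strand_of D a = (THE i. i \<in> {1..num_strands D} \<and> a \<subseteq> range (plane D i))"

definition crossing_data :: "diagram \<Rightarrow> real \<times> real \<Rightarrow> (nat \<times> real) \<times> (nat \<times> real)" where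
  "crossing_data D c =
     (THE ((i, s), (j, u)). s \<in> {0..<1} \<and> u \<in> {0..<1} \<and> passes_under D i s j u \<and> plane D i s = c)"

definition over_arc :: "diagram \<Rightarrow> real \<times> real \<Rightarrow> (real \<times> real) set" where
  "over_arc D c = connected_component_set (drawing D) c"

text \<open>
  The underpassing strand runs from right to left of the overpassing one iff \<^const>\<open>cross2\<close> of the
  velocities (over, under) is positive; then the arc entering the crossing is the one on the right.
\<close>

definition right_arc :: "diagram \<Rightarrow> real \<times> real \<Rightarrow> (real \<times> real) set" where
  "right_arc D c =
     (case crossing_data D c of ((i, s), (j, u)) \<Rightarrow>
        connected_component_set (drawing D)
          (plane D i (if cross2 (velocity D j u) (velocity D i s) > 0 then s - gap D else s + gap D)))"

definition left_arc :: "diagram \<Rightarrow> real \<times> real \<Rightarrow> (real \<times> real) set" where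
  "left_arc D c =
     (case crossing_data D c of ((i, s), (j, u)) \<Rightarrow>
        connected_component_set (drawing D)
          (plane D i (if cross2 (velocity D j u) (velocity D i s) > 0 then s + gap D else s - gap D)))"


section \<open>Laurent polynomials\<close>

text \<open>
  Exponent vectors are finitely supported functions \<open>nat \<Rightarrow>\<^sub>0 int\<close>; the ring in the
  variables \<open>t\<^sub>1, \<dots>, t\<^sub>n\<close> consists of the polynomials in which no other variable occurs.
\<close>

type_synonym laurent = "(nat \<Rightarrow>\<^sub>0 int) \<Rightarrow>\<^sub>0 int"

definition laurent_ring :: "nat \<Rightarrow> laurent ring" where
  "laurent_ring n =
     \<lparr>carrier = {p. \<forall>m\<in>Poly_Mapping.keys p. Poly_Mapping.keys m \<subseteq> {1..n}}, mult = (*), one = 1, zero = 0, add = (+)\<rparr>"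

definition tvar :: "nat \<Rightarrow> laurent" where
  "tvar i = Poly_Mapping.single (Poly_Mapping.single i 1) 1"


section \<open>Modules\<close>

text \<open>The fields \<^const>\<open>mult\<close> and \<^const>\<open>one\<close> of a module record carry no information.\<close>

definition free_module :: "('r, 'm) ring_scheme \<Rightarrow> 'a set \<Rightarrow> ('r, 'a \<Rightarrow> 'r) module" where
  "free_module R A =
     \<lparr>carrier = A \<rightarrow>\<^sub>E carrier R, mult = undefined, one = undefined,
      zero = (\<lambda>a\<in>A. \<zero>\<^bsub>R\<^esub>),
      add = (\<lambda>x y. \<lambda>a\<in>A. x a \<oplus>\<^bsub>R\<^esub> y a),
      smult = (\<lambda>r x. \<lambda>a\<in>A. r \<otimes>\<^bsub>R\<^esub> x a)\<rparr>"

definition basis_vec :: "('r, 'm) ring_scheme \<Rightarrow> 'a set \<Rightarrow> 'a \<Rightarrow> 'a \<Rightarrow> 'r" where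
  "basis_vec R A a = (\<lambda>b\<in>A. if b = a then \<one>\<^bsub>R\<^esub> else \<zero>\<^bsub>R\<^esub>)"

definition quotient_module :: "('r, 'm, 'n) module_scheme \<Rightarrow> 'm set \<Rightarrow> ('r, 'm set) module" where
  "quotient_module M N =
     \<lparr>carrier = a_rcosets\<^bsub>M\<^esub> N, mult = undefined, one = undefined,
      zero = N,
      add = (<+>\<^bsub>M\<^esub>),
      smult = (\<lambda>r X. \<Union>x\<in>X. N +>\<^bsub>M\<^esub> (r \<odot>\<^bsub>M\<^esub> x))\<rparr>"

definition module_iso ::
  "('r, 'k) ring_scheme \<Rightarrow> ('r, 'a, 'm) module_scheme \<Rightarrow> ('r, 'b, 'n) module_scheme \<Rightarrow> ('a \<Rightarrow> 'b) set" where
  "module_iso R M N =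
     {f. bij_betw f (carrier M) (carrier N) \<and>
         (\<forall>x\<in>carrier M. \<forall>y\<in>carrier M. f (x \<oplus>\<^bsub>M\<^esub> y) = f x \<oplus>\<^bsub>N\<^esub> f y) \<and>
         (\<forall>r\<in>carrier R. \<forall>x\<in>carrier M. f (r \<odot>\<^bsub>M\<^esub> x) = r \<odot>\<^bsub>N\<^esub> f x)}"


section \<open>Alexander modules and link module sequences\<close>

text \<open>
  The multivariate and the reduced theory differ only in the ring \<open>R\<close> and in the element
  \<open>t i\<close> of \<open>R\<close> that is assigned to the \<open>i\<close>-th component.
\<close>

definition crossing_relator ::
  "('r, 'm) ring_scheme \<Rightarrow> (nat \<Rightarrow> 'r) \<Rightarrow> diagram \<Rightarrow> real \<times> real \<Rightarrow> (real \<times> real) set \<Rightarrow> 'r" where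
  "crossing_relator R t D c =
     (let F = free_module R (arcs D); e = basis_vec R (arcs D);
          a1 = over_arc D c; a2 = right_arc D c; a3 = left_arc D c
      in ((\<one>\<^bsub>R\<^esub> \<ominus>\<^bsub>R\<^esub> t (strand_of D a2)) \<odot>\<^bsub>F\<^esub> e a1
           \<oplus>\<^bsub>F\<^esub> t (strand_of D a1) \<odot>\<^bsub>F\<^esub> e a2) \<ominus>\<^bsub>F\<^esub> e a3)"

definition rho ::
  "('r, 'm) ring_scheme \<Rightarrow> (nat \<Rightarrow> 'r) \<Rightarrow> diagram \<Rightarrow> (real \<times> real \<Rightarrow> 'r) \<Rightarrow> (real \<times> real) set \<Rightarrow> 'r" where
  "rho R t D x =
     finsum (free_module R (arcs D))
       (\<lambda>c. x c \<odot>\<^bsub>free_module R (arcs D)\<^esub> crossing_relator R t D c) (crossings D)"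

definition alexander_module ::
  "('r, 'm) ring_scheme \<Rightarrow> (nat \<Rightarrow> 'r) \<Rightarrow> diagram \<Rightarrow> ('r, ((real \<times> real) set \<Rightarrow> 'r) set) module" where
  "alexander_module R t D =
     quotient_module (free_module R (arcs D)) (rho R t D ` carrier (free_module R (crossings D)))"

text \<open>
  The linear map on the free module that sends each arc \<open>a\<close> to \<open>t (strand_of D a) - 1\<close> vanishes on
  the image of \<^const>\<open>rho\<close>, hence takes a single value on each coset \<open>X\<close>.
\<close>

definition phi ::
  "('r, 'm) ring_scheme \<Rightarrow> (nat \<Rightarrow> 'r) \<Rightarrow> diagram \<Rightarrow> ((real \<times> real) set \<Rightarrow> 'r) set \<Rightarrow> 'r" where
  "phi R t D X =
     the_elem ((\<lambda>x. \<Oplus>\<^bsub>R\<^esub>a\<in>arcs D. x a \<otimes>\<^bsub>R\<^esub> (t (strand_of D a) \<ominus>\<^bsub>R\<^esub> \<one>\<^bsub>R\<^esub>)) ` X)"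

text \<open>
  A sequence \<open>0 \<rightarrow> ker \<phi> \<rightarrow> M \<rightarrow> I \<rightarrow> 0\<close> is given by the module \<open>M\<close> and the map \<open>\<phi>\<close>; the ideal \<open>I\<close> is the
  range of \<open>\<phi>\<close>.  The sequence of a link is formed from a diagram of it; by the invariance of Alexander
  modules, different diagrams of the same link yield equivalent sequences.
\<close>

definition link_module_sequence where
  "link_module_sequence D =
     (alexander_module (laurent_ring (num_strands D)) tvar D,
      phi (laurent_ring (num_strands D)) tvar D)"

definition reduced_link_module_sequence where
  "reduced_link_module_sequence D =
     (alexander_module (laurent_ring 1) (\<lambda>i. tvar 1) D,
      phi (laurent_ring 1) (\<lambda>i. tvar 1) D)"

definition equivalent_sequences ::
  "('r, 'k) ring_scheme \<Rightarrow> ('r, 'a, 'm) module_scheme \<times> ('a \<Rightarrow> 'r) \<Rightarrow>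
     ('r, 'b, 'n) module_scheme \<times> ('b \<Rightarrow> 'r) \<Rightarrow> bool" where
  "equivalent_sequences R S S' \<longleftrightarrow>
     (\<exists>f\<in>module_iso R (fst S) (fst S'). \<forall>x\<in>carrier (fst S). snd S x = snd S' (f x))"

end

theory Submission
  imports Defs "HOL-Complex_Analysis.Cauchy_Integral_Formula"
begin

text \<open>
  The substitution of \<open>t\<close> for all variables is a surjective ring homomorphism \<open>\<epsilon>\<close>, and the reduced
  Alexander module is the quotient of the Alexander module by \<open>ker \<epsilon>\<close> times it.  Every isomorphism of
  Alexander modules preserves these submodules, hence descends to the reduced modules, compatibly
  with \<open>\<phi>\<close>.  This needs diagrams to have finitely many arcs, and the two underpassing arcs of
  a crossing to belong to the same strand.

  For the second part let \<open>L\<close> be a split union of a Hopf link with components 1, 2 and an unknot, and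
  let \<open>L'\<close> be the same link numbered such that the components 1, 3 form the Hopf link.  The reduced
  sequences do not see the numbering.  The ring homomorphism with \<open>t\<^sub>1, t\<^sub>2 \<mapsto> 1\<close> and \<open>t\<^sub>3 \<mapsto> -1\<close>,
  however, turns the relation \<open>(1 - t\<^sub>j) a\<^sub>i = (1 - t\<^sub>i) a\<^sub>j\<close> of the Hopf link into \<open>0 = 0\<close> for \<open>L\<close>
  and into \<open>2 a\<^sub>1 = 0\<close> for \<open>L'\<close>: the first module becomes free, the second one acquires torsion.
\<close>

section \<open>Free modules and quotient modules\<close>

text \<open>Both halves use the same fact: extension of scalars along a surjective ring homomorphism
  carries isomorphisms to isomorphisms. It is applied to the substitution of a single variable and
  again to the evaluation at signs. The latter lands in a copy of the integers, where
  \<open>L\<close> gives the free abelian group on its three arcs and \<open>L'\<close> the quotient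
  of that group by twice one arc. The value -1 serves because 1 - (-1) = 2 is neither zero nor a
  unit. The split unknot breaks a symmetry: the relation of a Hopf link alone does not change when
  its two components are renumbered. The topological work is caused by unique descriptions:
  \<open>strand_of\<close> and \<open>crossing_data\<close> must be well defined for every regular
  diagram of every link. This requires ruling out arcs that degenerate to a point and showing that
  heights differ wherever two strands meet.\<close>

lemma free_module_simps [simp]:
  "carrier (free_module R A) = A \<rightarrow>\<^sub>E carrier R"
  "\<zero>\<^bsub>free_module R A\<^esub> = (\<lambda>a\<in>A. \<zero>\<^bsub>R\<^esub>)"
  "x \<oplus>\<^bsub>free_module R A\<^esub> y = (\<lambda>a\<in>A. x a \<oplus>\<^bsub>R\<^esub> y a)"
  "r \<odot>\<^bsub>free_module R A\<^esub> x = (\<lambda>a\<in>A. r \<otimes>\<^bsub>R\<^esub> x a)"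
  by (simp_all add: free_module_def)

lemma free_module_eqI:
  assumes "x \<in> A \<rightarrow>\<^sub>E B" "y \<in> A \<rightarrow>\<^sub>E B" "\<And>a. a \<in> A \<Longrightarrow> x a = y a"
  shows "x = y"
  using assms by (rule PiE_ext)

lemma (in cring) free_module_abelian_group: "abelian_group (free_module R A)"
proof (rule abelian_groupI)
  fix x assume x: "x \<in> carrier (free_module R A)"
  show "\<exists>y\<in>carrier (free_module R A). y \<oplus>\<^bsub>free_module R A\<^esub> x = \<zero>\<^bsub>free_module R A\<^esub>"
    using x by (intro bexI[of _ "\<lambda>a\<in>A. \<ominus> x a"]) (auto simp: l_neg PiE_iff intro!: restrict_ext)
  show "\<zero>\<^bsub>free_module R A\<^esub> \<oplus>\<^bsub>free_module R A\<^esub> x = x"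
    using x by (intro free_module_eqI[of _ A "carrier R"]) (auto simp: PiE_iff)
qed (auto simp: PiE_iff a_assoc intro!: restrict_ext a_comm)

lemma (in cring) free_module_module: "module R (free_module R A)"
proof (rule moduleI)
  fix x assume x: "x \<in> carrier (free_module R A)"
  show "\<one> \<odot>\<^bsub>free_module R A\<^esub> x = x"
    using x by (intro free_module_eqI[of _ A "carrier R"]) (auto simp: PiE_iff)
qed (auto simp: PiE_iff is_cring free_module_abelian_group l_distr r_distr m_assoc
    intro!: restrict_ext)

text \<open>The additive inverse of a record is a definite description, so its coordinates are
  obtained from the uniqueness of inverses in \<open>R\<close>.\<close>

lemma (in cring) free_module_uminus:
  assumes "x \<in> carrier (free_module R A)" "a \<in> A"
  shows "(\<ominus>\<^bsub>free_module R A\<^esub> x) a = \<ominus> x a"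
proof -
  interpret F: module R "free_module R A" by (rule free_module_module)
  have "(\<ominus>\<^bsub>free_module R A\<^esub> x) \<oplus>\<^bsub>free_module R A\<^esub> x = \<zero>\<^bsub>free_module R A\<^esub>"
    using assms(1) by (rule F.M.l_neg)
  then have "((\<ominus>\<^bsub>free_module R A\<^esub> x) \<oplus>\<^bsub>free_module R A\<^esub> x) a = \<zero>\<^bsub>free_module R A\<^esub> a"
    by (rule arg_cong)
  moreover have "\<ominus>\<^bsub>free_module R A\<^esub> x \<in> A \<rightarrow>\<^sub>E carrier R"
    using F.M.a_inv_closed[OF assms(1)] by simp
  ultimately show ?thesis
    using assms by (intro minus_equality[symmetric]) (auto simp: PiE_iff)
qed

lemma (in cring) free_module_minus:
  assumes "x \<in> carrier (free_module R A)" "y \<in> carrier (free_module R A)" "a \<in> A"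
  shows "(x \<ominus>\<^bsub>free_module R A\<^esub> y) a = x a \<ominus> y a"
  using assms by (simp add: a_minus_def free_module_uminus del: free_module_simps(1))

lemma (in cring) basis_vec_closed [simp]: "basis_vec R A a \<in> A \<rightarrow>\<^sub>E carrier R"
  by (auto simp: basis_vec_def)

text \<open>The span of the family \<open>r\<close>, written as the image of a linear map so that
  the image of \<open>rho\<close> becomes an instance by mere unfolding.\<close>

definition relations where
  "relations R A C r =
     (\<lambda>x. finsum (free_module R A) (\<lambda>c. x c \<odot>\<^bsub>free_module R A\<^esub> r c) C) ` carrier (free_module R C)"

lemma (in cring) relations_cong:
  assumes "r \<in> C \<rightarrow> carrier (free_module R A)" "\<And>c. c \<in> C \<Longrightarrow> r c = r' c"
  shows "relations R A C r = relations R A C r'"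
proof -
  let ?F = "free_module R A"
  interpret F: module R ?F by (rule free_module_module)
  show ?thesis
    unfolding relations_def
  proof (rule image_cong)
    fix x assume "x \<in> carrier (free_module R C)"
    then have "x c \<in> carrier R" if "c \<in> C" for c using that by (auto simp: PiE_iff)
    moreover have "r' c \<in> carrier ?F" if "c \<in> C" for c
      using assms that by (metis funcset_mem)
    ultimately have "x c \<odot>\<^bsub>?F\<^esub> r' c \<in> carrier ?F" if "c \<in> C" for c
      using that by (intro F.smult_closed)
    then show "finsum ?F (\<lambda>c. x c \<odot>\<^bsub>?F\<^esub> r c) C = finsum ?F (\<lambda>c. x c \<odot>\<^bsub>?F\<^esub> r' c) C"
      using assms(2) by (intro F.M.finsum_cong') (auto simp del: free_module_simps)
  qed simp
qed

text \<open>Additive properties of all relations can be checked on multiples of single relators. An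
  infinite \<open>C\<close> falls under the case of zero, the default value of
  \<open>finsum\<close>.\<close>

lemma (in cring) relations_induct [consumes 2, case_names zero add smult]:
  assumes r: "r \<in> C \<rightarrow> carrier (free_module R A)" and x: "x \<in> relations R A C r"
    and zero: "P \<zero>\<^bsub>free_module R A\<^esub>"
    and add: "\<And>x y. x \<in> carrier (free_module R A) \<Longrightarrow> y \<in> carrier (free_module R A) \<Longrightarrow>
      P x \<Longrightarrow> P y \<Longrightarrow> P (x \<oplus>\<^bsub>free_module R A\<^esub> y)"
    and smult: "\<And>s c. s \<in> carrier R \<Longrightarrow> c \<in> C \<Longrightarrow> P (s \<odot>\<^bsub>free_module R A\<^esub> r c)"
  shows "P x"
proof -
  let ?F = "free_module R A"
  interpret F: module R ?F by (rule free_module_module)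
  obtain y where y: "y \<in> C \<rightarrow> carrier R" "x = finsum ?F (\<lambda>c. y c \<odot>\<^bsub>?F\<^esub> r c) C"
    using x by (auto simp: relations_def PiE_iff Pi_iff)
  have "P (finsum ?F (\<lambda>c. y c \<odot>\<^bsub>?F\<^esub> r c) B)" if "B \<subseteq> C" for B
    using that
  proof (induction B rule: infinite_finite_induct)
    case (insert b B)
    then have g: "(\<lambda>c. y c \<odot>\<^bsub>?F\<^esub> r c) \<in> B \<rightarrow> carrier ?F" "y b \<odot>\<^bsub>?F\<^esub> r b \<in> carrier ?F"
      using r y(1) by (auto intro!: F.smult_closed simp del: free_module_simps)
    have "P (y b \<odot>\<^bsub>?F\<^esub> r b \<oplus>\<^bsub>?F\<^esub> finsum ?F (\<lambda>c. y c \<odot>\<^bsub>?F\<^esub> r c) B)"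
      using insert y(1) g
      by (intro add smult F.M.finsum_closed) (auto simp del: free_module_simps)
    then show ?case
      by (simp only: F.M.finsum_insert[OF insert(1,2) g])
  qed (use zero in \<open>simp_all add: F.M.finsum_infinite del: free_module_simps\<close>)
  then show ?thesis unfolding y(2) by blast
qed

text \<open>The coefficient vector is the basis vector of \<open>c\<close>. Finiteness of
  \<open>C\<close> guards against the default value zero of \<open>finsum\<close>.\<close>

lemma (in cring) relations_generator:
  assumes r: "r \<in> C \<rightarrow> carrier (free_module R A)" and "finite C" and c: "c \<in> C"
  shows "r c \<in> relations R A C r"
proof -
  let ?F = "free_module R A" and ?e = "basis_vec R C c"
  interpret F: module R ?F by (rule free_module_module)
  have "finsum ?F (\<lambda>b. ?e b \<odot>\<^bsub>?F\<^esub> r b) C = finsum ?F (\<lambda>b. if c = b then r b else \<zero>\<^bsub>?F\<^esub>) C"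
  proof (rule F.M.finsum_cong')
    fix b assume b: "b \<in> C"
    then have "r b \<in> carrier ?F" using r by blast
    then show "?e b \<odot>\<^bsub>?F\<^esub> r b = (if c = b then r b else \<zero>\<^bsub>?F\<^esub>)"
      using b by (cases "c = b") (simp_all add: basis_vec_def del: free_module_simps)
  qed (use r in \<open>auto simp del: free_module_simps\<close>)
  also have "\<dots> = r c"
    using c \<open>finite C\<close> r by (rule F.M.finsum_singleton)
  finally have "r c = finsum ?F (\<lambda>b. ?e b \<odot>\<^bsub>?F\<^esub> r b) C" ..
  moreover have "?e \<in> carrier (free_module R C)" by simp
  ultimately show ?thesis unfolding relations_def by (rule image_eqI)
qed

section \<open>Submodules and their quotients\<close>

locale module_quotient = module R M + abelian_subgroup N M
  for R (structure) and M (structure) and N +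
  assumes smult_mem: "r \<in> carrier R \<Longrightarrow> x \<in> N \<Longrightarrow> r \<odot>\<^bsub>M\<^esub> x \<in> N"

lemma (in cring) relations_module_quotient:
  assumes r: "r \<in> C \<rightarrow> carrier (free_module R A)"
  shows "module_quotient R (free_module R A) (relations R A C r)"
proof -
  let ?F = "free_module R A" and ?G = "free_module R C"
  let ?N = "relations R A C r"
  interpret F: module R ?F by (rule free_module_module)
  interpret G: module R ?G by (rule free_module_module)
  have xr: "x c \<odot>\<^bsub>?F\<^esub> r c \<in> carrier ?F" if "x \<in> carrier ?G" "c \<in> C" for x c
    using that r by (intro F.smult_closed) (auto simp: Pi_iff PiE_iff)
  have sub: "?N \<subseteq> carrier ?F"
    unfolding relations_def using xr by (intro image_subsetI F.M.finsum_closed) auto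
  have smult: "s \<odot>\<^bsub>?F\<^esub> x \<in> ?N" if s: "s \<in> carrier R" and x: "x \<in> ?N" for s x
  proof -
    obtain y where y: "y \<in> carrier ?G"
      "x = finsum ?F (\<lambda>c. y c \<odot>\<^bsub>?F\<^esub> r c) C"
      using x by (auto simp: relations_def simp del: free_module_simps)
    have "s \<odot>\<^bsub>?F\<^esub> x = finsum ?F (\<lambda>c. s \<odot>\<^bsub>?F\<^esub> (y c \<odot>\<^bsub>?F\<^esub> r c)) C"
    proof (cases "finite C")
      case True
      then show ?thesis
        unfolding y(2) using xr[OF y(1)] s by (intro F.finsum_smult_ldistr) (auto simp: Pi_iff)
    next
      case False
      then show ?thesis
        using s unfolding y(2) by (simp add: F.M.finsum_infinite del: free_module_simps)
    qed
    also have "\<dots> = finsum ?F (\<lambda>c. (s \<odot>\<^bsub>?G\<^esub> y) c \<odot>\<^bsub>?F\<^esub> r c) C"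
      using s y(1) r by (intro F.M.finsum_cong')
        (auto simp: Pi_iff PiE_iff m_assoc intro!: restrict_ext)
    finally show ?thesis
      using G.smult_closed[OF s y(1)] by (auto simp: relations_def simp del: free_module_simps)
  qed
  have add: "x \<oplus>\<^bsub>?F\<^esub> x' \<in> ?N" if x: "x \<in> ?N" "x' \<in> ?N" for x x'
  proof -
    obtain y y' where y: "y \<in> carrier ?G" "y' \<in> carrier ?G"
      "x = finsum ?F (\<lambda>c. y c \<odot>\<^bsub>?F\<^esub> r c) C" "x' = finsum ?F (\<lambda>c. y' c \<odot>\<^bsub>?F\<^esub> r c) C"
      using x by (auto simp: relations_def simp del: free_module_simps)
    have "x \<oplus>\<^bsub>?F\<^esub> x' = finsum ?F (\<lambda>c. y c \<odot>\<^bsub>?F\<^esub> r c \<oplus>\<^bsub>?F\<^esub> y' c \<odot>\<^bsub>?F\<^esub> r c) C"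
      unfolding y using xr[OF y(1)] xr[OF y(2)]
      by (intro F.M.finsum_addf[symmetric]) (auto simp: Pi_iff)
    also have "\<dots> = finsum ?F (\<lambda>c. (y \<oplus>\<^bsub>?G\<^esub> y') c \<odot>\<^bsub>?F\<^esub> r c) C"
      using y(1,2) r by (intro F.M.finsum_cong')
        (auto simp: Pi_iff PiE_iff l_distr intro!: restrict_ext)
    finally show ?thesis
      using G.M.add.m_closed[OF y(1,2)] by (auto simp: relations_def simp del: free_module_simps)
  qed
  have "finsum ?F (\<lambda>c. \<zero>\<^bsub>?G\<^esub> c \<odot>\<^bsub>?F\<^esub> r c) C \<in> ?N"
    unfolding relations_def by (rule imageI) (rule G.M.zero_closed)
  then have ne: "?N \<noteq> {}" by blast
  \<comment> \<open>Negation is multiplication by the scalar -1, so closure under scalars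
    suffices.\<close>
  have neg: "\<ominus>\<^bsub>?F\<^esub> x \<in> ?N" if "x \<in> ?N" for x
    using smult[of "\<ominus> \<one>", OF _ that] that sub
    by (metis F.smult_l_minus F.smult_one a_inv_closed one_closed subsetD)
  have "subgroup ?N (add_monoid ?F)"
    by (rule group.subgroupI)
      (use sub ne neg add in \<open>auto simp: F.M.a_group a_inv_def simp del: free_module_simps\<close>)
  then have "abelian_subgroup ?N ?F"
    by (intro abelian_subgroupI3 additive_subgroupI F.M.abelian_group_axioms)
  then show ?thesis
    by (intro module_quotient.intro module_quotient_axioms.intro F.module_axioms smult)
qed

context module_quotient
begin

abbreviation Q where "Q \<equiv> quotient_module M N"

lemma quotient_simps:
  "carrier Q = a_rcosets\<^bsub>M\<^esub> N" "\<zero>\<^bsub>Q\<^esub> = N" "X \<oplus>\<^bsub>Q\<^esub> Y = X <+>\<^bsub>M\<^esub> Y"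
  "r \<odot>\<^bsub>Q\<^esub> X = (\<Union>x\<in>X. N +>\<^bsub>M\<^esub> (r \<odot>\<^bsub>M\<^esub> x))"
  by (simp_all add: quotient_module_def)

lemma quotient_carrier: "carrier Q = (\<lambda>x. N +>\<^bsub>M\<^esub> x) ` carrier M"
  by (auto simp: quotient_simps A_RCOSETS_def')

lemma coset_zero: "N +>\<^bsub>M\<^esub> \<zero>\<^bsub>M\<^esub> = N"
  using a_subset by (rule M.a_coset_add_zero)

lemma quotient_add:
  assumes "x \<in> carrier M" "y \<in> carrier M"
  shows "(N +>\<^bsub>M\<^esub> x) \<oplus>\<^bsub>Q\<^esub> (N +>\<^bsub>M\<^esub> y) = N +>\<^bsub>M\<^esub> (x \<oplus>\<^bsub>M\<^esub> y)"
  using assms by (simp add: quotient_simps a_rcos_sum)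

text \<open>The product is defined as a union over all representatives. It is a single coset because
  representatives differ by elements of \<open>N\<close>, which scalars keep inside
  \<open>N\<close>.\<close>

lemma quotient_smult:
  assumes r: "r \<in> carrier R" and x: "x \<in> carrier M"
  shows "r \<odot>\<^bsub>Q\<^esub> (N +>\<^bsub>M\<^esub> x) = N +>\<^bsub>M\<^esub> (r \<odot>\<^bsub>M\<^esub> x)"
proof -
  have "N +>\<^bsub>M\<^esub> (r \<odot>\<^bsub>M\<^esub> y) = N +>\<^bsub>M\<^esub> (r \<odot>\<^bsub>M\<^esub> x)" if y: "y \<in> N +>\<^bsub>M\<^esub> x" for y
  proof -
    obtain n where n: "n \<in> N" "y = n \<oplus>\<^bsub>M\<^esub> x" using y by (auto simp: a_r_coset_def')
    have "r \<odot>\<^bsub>M\<^esub> y = r \<odot>\<^bsub>M\<^esub> n \<oplus>\<^bsub>M\<^esub> r \<odot>\<^bsub>M\<^esub> x"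
      using n r x by (simp add: smult_r_distr)
    then have "r \<odot>\<^bsub>M\<^esub> y \<in> N +>\<^bsub>M\<^esub> (r \<odot>\<^bsub>M\<^esub> x)"
      using smult_mem[OF r n(1)] by (auto simp: a_r_coset_def')
    then show ?thesis using a_repr_independence' r x by (metis smult_closed)
  qed
  then show ?thesis unfolding quotient_simps(4) using a_rcos_self[OF x] by blast
qed

lemma quotient_abelian_group: "abelian_group Q"
proof (rule abelian_groupI)
  show "\<zero>\<^bsub>Q\<^esub> \<in> carrier Q"
    using coset_zero by (force simp: quotient_carrier quotient_simps(2))
  fix x assume "x \<in> carrier Q"
  then obtain a where a: "a \<in> carrier M" "x = N +>\<^bsub>M\<^esub> a" by (auto simp: quotient_carrier)
  show "\<zero>\<^bsub>Q\<^esub> \<oplus>\<^bsub>Q\<^esub> x = x"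
    using quotient_add[OF M.zero_closed a(1)] a by (simp add: coset_zero quotient_simps(2))
  show "\<exists>y\<in>carrier Q. y \<oplus>\<^bsub>Q\<^esub> x = \<zero>\<^bsub>Q\<^esub>"
    using a quotient_add[of "\<ominus>\<^bsub>M\<^esub> a" a]
    by (intro bexI[of _ "N +>\<^bsub>M\<^esub> (\<ominus>\<^bsub>M\<^esub> a)"])
      (auto simp: quotient_carrier quotient_simps(2) coset_zero M.l_neg)
  fix y assume "y \<in> carrier Q"
  then obtain b where b: "b \<in> carrier M" "y = N +>\<^bsub>M\<^esub> b" by (auto simp: quotient_carrier)
  show "x \<oplus>\<^bsub>Q\<^esub> y \<in> carrier Q" "x \<oplus>\<^bsub>Q\<^esub> y = y \<oplus>\<^bsub>Q\<^esub> x"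
    using a b by (auto simp: quotient_add quotient_carrier M.a_comm)
  fix z assume "z \<in> carrier Q"
  then obtain c where c: "c \<in> carrier M" "z = N +>\<^bsub>M\<^esub> c" by (auto simp: quotient_carrier)
  show "x \<oplus>\<^bsub>Q\<^esub> y \<oplus>\<^bsub>Q\<^esub> z = x \<oplus>\<^bsub>Q\<^esub> (y \<oplus>\<^bsub>Q\<^esub> z)"
    using a b c by (simp add: quotient_add M.a_assoc)
qed

lemma quotient_module_module: "module R Q"
  by (rule moduleI)
    (auto simp: quotient_abelian_group R.is_cring quotient_carrier quotient_smult quotient_add
      smult_l_distr smult_r_distr smult_assoc1)

end


section \<open>Change of rings\<close>

lemma module_iso_inv_into:
  assumes f: "f \<in> module_iso R M N" and "module R M"
  shows "inv_into (carrier M) f \<in> module_iso R N M"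
proof -
  interpret M: module R M by fact
  let ?g = "inv_into (carrier M) f"
  have bij: "bij_betw f (carrier M) (carrier N)"
    and add: "\<And>x y. x \<in> carrier M \<Longrightarrow> y \<in> carrier M \<Longrightarrow> f (x \<oplus>\<^bsub>M\<^esub> y) = f x \<oplus>\<^bsub>N\<^esub> f y"
    and smult: "\<And>r x. r \<in> carrier R \<Longrightarrow> x \<in> carrier M \<Longrightarrow> f (r \<odot>\<^bsub>M\<^esub> x) = r \<odot>\<^bsub>N\<^esub> f x"
    using f by (auto simp: module_iso_def)
  have g: "?g y \<in> carrier M" "f (?g y) = y" if "y \<in> carrier N" for y
    using bij that by (auto simp: bij_betw_def inv_into_into f_inv_into_f)
  have gf: "?g (f x) = x" if "x \<in> carrier M" for x
    using bij that by (auto simp: bij_betw_def)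
  have "?g (x \<oplus>\<^bsub>N\<^esub> y) = ?g x \<oplus>\<^bsub>M\<^esub> ?g y" if "x \<in> carrier N" "y \<in> carrier N" for x y
    using gf[of "?g x \<oplus>\<^bsub>M\<^esub> ?g y"] add[of "?g x" "?g y"] g that by simp
  moreover have "?g (r \<odot>\<^bsub>N\<^esub> x) = r \<odot>\<^bsub>M\<^esub> ?g x" if "r \<in> carrier R" "x \<in> carrier N" for r x
    using gf[of "r \<odot>\<^bsub>M\<^esub> ?g x"] smult[of r "?g x"] g that by simp
  ultimately show ?thesis
    using bij_betw_inv_into[OF bij] by (simp add: module_iso_def)
qed

text \<open>This is the submodule \<open>J M\<close>. Its elements are finite sums of products,
  built by one product at a time in order to have an induction rule.\<close>

inductive_set ideal_multiples for J M where
  zero: "\<zero>\<^bsub>M\<^esub> \<in> ideal_multiples J M"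
| add_smult: "x \<in> ideal_multiples J M \<Longrightarrow> j \<in> J \<Longrightarrow> y \<in> carrier M \<Longrightarrow>
    x \<oplus>\<^bsub>M\<^esub> (j \<odot>\<^bsub>M\<^esub> y) \<in> ideal_multiples J M"

text \<open>The assumptions characterise \<open>Mr\<close> as the quotient of \<open>M\<close> by
  \<open>ker \<epsilon>\<close> times \<open>M\<close>, that is, as the extension of scalars of
  \<open>M\<close> along \<epsilon>. The last one gives one inclusion for the kernel of \<pi>; the
  other follows from \<open>pi_smult\<close>.\<close>

locale base_change =
  ring_hom_cring R S \<epsilon> + M: module R M + Mr: module S Mr
  for R (structure) and S (structure) and \<epsilon> and M and Mr and \<pi> +
  assumes eps_surj: "\<epsilon> ` carrier R = carrier S"
    and pi_surj: "\<pi> ` carrier M = carrier Mr"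
    and pi_add: "x \<in> carrier M \<Longrightarrow> y \<in> carrier M \<Longrightarrow> \<pi> (x \<oplus>\<^bsub>M\<^esub> y) = \<pi> x \<oplus>\<^bsub>Mr\<^esub> \<pi> y"
    and pi_smult: "r \<in> carrier R \<Longrightarrow> x \<in> carrier M \<Longrightarrow> \<pi> (r \<odot>\<^bsub>M\<^esub> x) = \<epsilon> r \<odot>\<^bsub>Mr\<^esub> \<pi> x"
    and pi_kernel: "x \<in> carrier M \<Longrightarrow> \<pi> x = \<zero>\<^bsub>Mr\<^esub> \<Longrightarrow> x \<in> ideal_multiples (a_kernel R S \<epsilon>) M"
begin

lemma ideal_multiples_closed:
  "x \<in> ideal_multiples (a_kernel R S \<epsilon>) M \<Longrightarrow> x \<in> carrier M"
  by (induction rule: ideal_multiples.induct) (auto simp: a_kernel_def')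

text \<open>The universal property of extension of scalars: \<open>h\<close> kills every product of
  an element of \<open>ker \<epsilon>\<close> with an element of \<open>M\<close>, hence is constant
  on the fibres of \<pi>.\<close>

lemma semilinear_factors:
  assumes P: "module S P"
    and h: "\<And>x. x \<in> carrier M \<Longrightarrow> h x \<in> carrier P"
    and h_add: "\<And>x y. x \<in> carrier M \<Longrightarrow> y \<in> carrier M \<Longrightarrow> h (x \<oplus>\<^bsub>M\<^esub> y) = h x \<oplus>\<^bsub>P\<^esub> h y"
    and h_smult: "\<And>r x. r \<in> carrier R \<Longrightarrow> x \<in> carrier M \<Longrightarrow> h (r \<odot>\<^bsub>M\<^esub> x) = \<epsilon> r \<odot>\<^bsub>P\<^esub> h x"
  obtains g where "\<And>x. x \<in> carrier M \<Longrightarrow> g (\<pi> x) = h x"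
proof -
  interpret P: module S P by (rule P)
  have h0: "h x = \<zero>\<^bsub>P\<^esub>" if "x \<in> ideal_multiples (a_kernel R S \<epsilon>) M" for x
    using that
  proof (induction rule: ideal_multiples.induct)
    case zero
    have "h (\<zero>\<^bsub>R\<^esub> \<odot>\<^bsub>M\<^esub> \<zero>\<^bsub>M\<^esub>) = \<zero>\<^bsub>S\<^esub> \<odot>\<^bsub>P\<^esub> h \<zero>\<^bsub>M\<^esub>" by (subst h_smult) auto
    then show ?case using h by simp
  next
    case (add_smult x j y)
    then show ?case
      using ideal_multiples_closed[of x] h by (auto simp: h_add h_smult a_kernel_def')
  qed
  have eq: "h x = h y" if x: "x \<in> carrier M" and y: "y \<in> carrier M" and "\<pi> x = \<pi> y" for x y
  proof -
    have d: "x \<ominus>\<^bsub>M\<^esub> y \<in> carrier M" "x = (x \<ominus>\<^bsub>M\<^esub> y) \<oplus>\<^bsub>M\<^esub> y"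
      using x y by (simp_all add: a_minus_def M.M.a_assoc M.M.l_neg)
    have pc: "\<pi> z \<in> carrier Mr" if "z \<in> carrier M" for z using pi_surj that by auto
    have "\<pi> (x \<ominus>\<^bsub>M\<^esub> y) \<oplus>\<^bsub>Mr\<^esub> \<pi> y = \<pi> y"
      using pi_add[OF d(1) y] d(2) \<open>\<pi> x = \<pi> y\<close> by simp
    then have "\<pi> (x \<ominus>\<^bsub>M\<^esub> y) = \<zero>\<^bsub>Mr\<^esub>"
      using pc[OF d(1)] pc[OF y] by simp
    then have "h (x \<ominus>\<^bsub>M\<^esub> y) = \<zero>\<^bsub>P\<^esub>" using h0 pi_kernel d(1) by blast
    then show ?thesis using h_add[OF d(1) y] d(2) h[OF y] by simp
  qed
  \<comment> \<open>An arbitrary preimage may be chosen, since \<open>h\<close> takes the same value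
    on all of them.\<close>
  let ?g = "\<lambda>z. h (SOME x. x \<in> carrier M \<and> \<pi> x = z)"
  have "?g (\<pi> x) = h x" if x: "x \<in> carrier M" for x
    using someI[of "\<lambda>y. y \<in> carrier M \<and> \<pi> y = \<pi> x" x] x
    by (intro eq) auto
  then show ?thesis by (rule that)
qed

end

text \<open>The universal property is applied to \<open>f\<close> followed by \<pi>' and to the
  inverse of \<open>f\<close> followed by \<pi>. The two induced maps are inverse to each other, and
  linear, because every element has a lift along \<pi> or \<pi>'.\<close>

lemma base_change_module_iso:
  fixes R (structure) and S (structure)
  assumes 1: "base_change R S \<epsilon> M Mr \<pi>" and 2: "base_change R S \<epsilon> M' Mr' \<pi>'"
    and f: "f \<in> module_iso R M M'"
  obtains g where "g \<in> module_iso S Mr Mr'" "\<And>x. x \<in> carrier M \<Longrightarrow> g (\<pi> x) = \<pi>' (f x)"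
proof -
  interpret B: base_change R S \<epsilon> M Mr \<pi> by (rule 1)
  interpret B': base_change R S \<epsilon> M' Mr' \<pi>' by (rule 2)
  let ?f' = "inv_into (carrier M) f"
  have f': "?f' \<in> module_iso R M' M" by (rule module_iso_inv_into[OF f B.M.module_axioms])
  have fD: "f x \<in> carrier M'" "?f' (f x) = x" if "x \<in> carrier M" for x
    using f that by (auto simp: module_iso_def bij_betw_def)
  have f'D: "?f' y \<in> carrier M" "f (?f' y) = y" if "y \<in> carrier M'" for y
    using f that by (auto simp: module_iso_def bij_betw_def inv_into_into f_inv_into_f)
  have pc: "\<pi> x \<in> carrier Mr" if "x \<in> carrier M" for x using B.pi_surj that by auto
  have pc': "\<pi>' x \<in> carrier Mr'" if "x \<in> carrier M'" for x using B'.pi_surj that by auto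
  obtain g where g: "\<And>x. x \<in> carrier M \<Longrightarrow> g (\<pi> x) = \<pi>' (f x)"
    using B.semilinear_factors[OF B'.Mr.module_axioms, of "\<lambda>x. \<pi>' (f x)"] f fD pc'
    by (auto simp: module_iso_def B'.pi_add B'.pi_smult)
  obtain g' where g': "\<And>x. x \<in> carrier M' \<Longrightarrow> g' (\<pi>' x) = \<pi> (?f' x)"
    using B'.semilinear_factors[OF B.Mr.module_axioms, of "\<lambda>x. \<pi> (?f' x)"] f' f'D pc
    by (auto simp: module_iso_def B.pi_add B.pi_smult)
  have lift: "\<exists>x\<in>carrier M. z = \<pi> x" if "z \<in> carrier Mr" for z
    using B.pi_surj that by auto
  have lift': "\<exists>x\<in>carrier M'. z = \<pi>' x" if "z \<in> carrier Mr'" for z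
    using B'.pi_surj that by auto
  have "bij_betw g (carrier Mr) (carrier Mr')"
  proof (rule bij_betw_byWitness[of _ g'])
    show "\<forall>a\<in>carrier Mr. g' (g a) = a" using lift g g' fD by fastforce
    show "\<forall>a\<in>carrier Mr'. g (g' a) = a" using lift' g g' f'D by fastforce
    show "g ` carrier Mr \<subseteq> carrier Mr'" using lift g fD pc' by fastforce
    show "g' ` carrier Mr' \<subseteq> carrier Mr" using lift' g' f'D pc by fastforce
  qed
  moreover have "g (x \<oplus>\<^bsub>Mr\<^esub> y) = g x \<oplus>\<^bsub>Mr'\<^esub> g y"
    if x: "x \<in> carrier Mr" and y: "y \<in> carrier Mr" for x y
  proof -
    obtain a b where "a \<in> carrier M" "b \<in> carrier M" "x = \<pi> a" "y = \<pi> b"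
      using lift x y by blast
    then show ?thesis
      using f fD g by (simp add: module_iso_def B'.pi_add flip: B.pi_add)
  qed
  moreover have "g (s \<odot>\<^bsub>Mr\<^esub> x) = s \<odot>\<^bsub>Mr'\<^esub> g x"
    if s: "s \<in> carrier S" and x: "x \<in> carrier Mr" for s x
  proof -
    obtain r where r: "r \<in> carrier R" "s = \<epsilon> r" using B.eps_surj s by auto
    obtain a where "a \<in> carrier M" "x = \<pi> a" using lift x by blast
    then show ?thesis
      using r f fD g by (simp add: module_iso_def B'.pi_smult flip: B.pi_smult)
  qed
  ultimately have "g \<in> module_iso S Mr Mr'" by (simp add: module_iso_def)
  with g show ?thesis by (intro that)
qed


section \<open>Laurent polynomials\<close>

lemma laurent_ring_simps [simp]:
  "mult (laurent_ring n) = (*)" "one (laurent_ring n) = 1"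
  "zero (laurent_ring n) = 0" "add (laurent_ring n) = (+)"
  by (simp_all add: laurent_ring_def)

lemma laurent_ring_carrier:
  "p \<in> carrier (laurent_ring n) \<longleftrightarrow>
     (\<forall>m\<in>Poly_Mapping.keys p. Poly_Mapping.keys m \<subseteq> {1..n})"
  by (simp add: laurent_ring_def)

lemma laurent_ring_cring: "cring (laurent_ring n)"
proof (rule cringI)
  show "abelian_group (laurent_ring n)"
  proof (rule abelian_groupI)
    fix x assume "x \<in> carrier (laurent_ring n)"
    then show "\<exists>y\<in>carrier (laurent_ring n). y \<oplus>\<^bsub>laurent_ring n\<^esub> x = \<zero>\<^bsub>laurent_ring n\<^esub>"
      by (intro bexI[of _ "- x"]) (auto simp: laurent_ring_carrier)
  next
    fix x y assume "x \<in> carrier (laurent_ring n)" "y \<in> carrier (laurent_ring n)"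
    then show "x \<oplus>\<^bsub>laurent_ring n\<^esub> y \<in> carrier (laurent_ring n)"
      using Poly_Mapping.keys_add[of x y] unfolding laurent_ring_carrier laurent_ring_simps by blast
  qed (auto simp: laurent_ring_carrier)
  show "comm_monoid (laurent_ring n)"
  proof (rule comm_monoidI)
    fix x y assume xy: "x \<in> carrier (laurent_ring n)" "y \<in> carrier (laurent_ring n)"
    have "Poly_Mapping.keys m \<subseteq> {1..n}" if m: "m \<in> Poly_Mapping.keys (x * y)" for m
    proof -
      obtain a b where "m = a + b" "a \<in> Poly_Mapping.keys x" "b \<in> Poly_Mapping.keys y"
        using keys_mult[of x y] m by blast
      then show ?thesis
        using xy Poly_Mapping.keys_add[of a b] unfolding laurent_ring_carrier by blast
    qed
    then show "x \<otimes>\<^bsub>laurent_ring n\<^esub> y \<in> carrier (laurent_ring n)"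
      by (simp add: laurent_ring_carrier)
  qed (auto simp: laurent_ring_carrier mult.assoc mult.commute)
qed (simp add: distrib_right)

lemma laurent_ring_uminus [simp]:
  assumes "x \<in> carrier (laurent_ring n)"
  shows "\<ominus>\<^bsub>laurent_ring n\<^esub> x = - x"
proof -
  interpret cring "laurent_ring n" by (rule laurent_ring_cring)
  show ?thesis
    using assms by (intro minus_equality) (auto simp: laurent_ring_carrier)
qed

lemma laurent_ring_minus [simp]:
  assumes "y \<in> carrier (laurent_ring n)"
  shows "x \<ominus>\<^bsub>laurent_ring n\<^esub> y = x - y"
  using assms by (simp add: a_minus_def)

lemma tvar_closed: "i \<in> {1..n} \<Longrightarrow> tvar i \<in> carrier (laurent_ring n)"
  by (simp add: laurent_ring_carrier tvar_def)

text \<open>Laurent polynomials form the free abelian group on their monomials, and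
  \<open>frag_extend b\<close> is the additive extension of \<open>b\<close>. Its multiplicativity
  is checked on monomials, in one factor after the other.\<close>

lemma frag_extend_mult:
  fixes b :: "'a::comm_monoid_add \<Rightarrow> ('b::comm_monoid_add \<Rightarrow>\<^sub>0 int)"
  assumes b: "\<And>m n. b (m + n) = b m * b n"
  shows "frag_extend b (p * q) = frag_extend b p * frag_extend b q"
proof -
  have 1: "frag_extend b (frag_of m * q) = b m * frag_extend b q" for m
  proof -
    have "Poly_Mapping.keys q \<subseteq> UNIV" by simp
    then show ?thesis
      by (induction q rule: frag_induction)
        (simp_all add: mult_single b right_diff_distrib frag_extend_diff)
  qed
  have "Poly_Mapping.keys p \<subseteq> UNIV" by simp
  then show ?thesis
    by (induction p rule: frag_induction)
      (simp_all add: 1 left_diff_distrib frag_extend_diff)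
qed

lemma frag_extend_one:
  fixes b :: "'a::comm_monoid_add \<Rightarrow> ('b::comm_monoid_add \<Rightarrow>\<^sub>0 int)"
  assumes "b 0 = 1"
  shows "frag_extend b 1 = 1"
proof -
  have "(1 :: 'a \<Rightarrow>\<^sub>0 int) = frag_of 0" by simp
  then show ?thesis using assms by (metis frag_extend_of)
qed

section \<open>The substitution of one variable for all\<close>

definition total_degree :: "(nat \<Rightarrow>\<^sub>0 int) \<Rightarrow> int" where
  "total_degree m = Sum_any (Poly_Mapping.lookup m)"

lemma total_degree_add: "total_degree (m + n) = total_degree m + total_degree n"
  by (simp add: total_degree_def lookup_add Sum_any.distrib)

lemma total_degree_zero [simp]: "total_degree 0 = 0"
  by (simp add: total_degree_def)

lemma total_degree_single [simp]: "total_degree (Poly_Mapping.single i k) = k"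
  by (simp add: total_degree_def lookup_single)

lemma frag_extend_ring_hom:
  fixes b :: "(nat \<Rightarrow>\<^sub>0 int) \<Rightarrow> laurent"
  assumes "\<And>m n. b (m + n) = b m * b n" "b 0 = 1" "\<And>m. b m \<in> carrier (laurent_ring k)"
  shows "frag_extend b \<in> ring_hom (laurent_ring n) (laurent_ring k)"
proof (rule ring_hom_memI)
  show "frag_extend b p \<in> carrier (laurent_ring k)" for p
    using keys_frag_extend[of b p] assms(3) unfolding laurent_ring_carrier by blast
qed (simp_all add: frag_extend_mult frag_extend_add frag_extend_one assms)

text \<open>The ring in \<open>k\<close> variables is contained in the ring in \<open>n\<close>
  variables, and the map fixes it pointwise, so it is a retraction.\<close>

lemma frag_extend_laurent_surj:
  fixes b :: "(nat \<Rightarrow>\<^sub>0 int) \<Rightarrow> laurent"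
  assumes "\<And>m. b m \<in> carrier (laurent_ring k)" "k \<le> n"
    and b: "\<And>m. Poly_Mapping.keys m \<subseteq> {1..k} \<Longrightarrow> b m = frag_of m"
  shows "frag_extend b ` carrier (laurent_ring n) = carrier (laurent_ring k)"
proof
  show "frag_extend b ` carrier (laurent_ring n) \<subseteq> carrier (laurent_ring k)"
  proof (rule image_subsetI)
    show "frag_extend b p \<in> carrier (laurent_ring k)" for p
      using keys_frag_extend[of b p] assms(1) unfolding laurent_ring_carrier by blast
  qed
  show "carrier (laurent_ring k) \<subseteq> frag_extend b ` carrier (laurent_ring n)"
  proof
    fix p assume p: "p \<in> carrier (laurent_ring k)"
    have "frag_extend b p = frag_extend frag_of p"
      using p by (intro frag_extend_eq b) (auto simp: laurent_ring_carrier)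
    then have "frag_extend b p = p" by (simp flip: frag_expansion)
    moreover have "p \<in> carrier (laurent_ring n)"
      using p assms(2) unfolding laurent_ring_carrier by fastforce
    ultimately show "p \<in> frag_extend b ` carrier (laurent_ring n)" by (metis imageI)
  qed
qed

definition reduce :: "laurent \<Rightarrow> laurent" where
  "reduce = frag_extend (\<lambda>m. frag_of (Poly_Mapping.single 1 (total_degree m)))"

lemma reduce_tvar: "reduce (tvar i) = tvar 1"
  by (simp add: reduce_def tvar_def)

lemma reduce_ring_hom: "reduce \<in> ring_hom (laurent_ring n) (laurent_ring 1)"
  unfolding reduce_def
  by (rule frag_extend_ring_hom)
    (simp_all add: mult_single total_degree_add single_add laurent_ring_carrier)

lemma reduce_surj:
  assumes "1 \<le> n"
  shows "reduce ` carrier (laurent_ring n) = carrier (laurent_ring 1)"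
  unfolding reduce_def
proof (rule frag_extend_laurent_surj)
  fix m :: "nat \<Rightarrow>\<^sub>0 int" assume "Poly_Mapping.keys m \<subseteq> {1..1}"
  then have "m = Poly_Mapping.single 1 (Poly_Mapping.lookup m 1)"
    by (intro poly_mapping_eqI) (auto simp: lookup_single when_def in_keys_iff)
  then show "frag_of (Poly_Mapping.single 1 (total_degree m)) = frag_of m"
    by (metis total_degree_single)
qed (use assms in \<open>simp_all add: laurent_ring_carrier\<close>)


section \<open>Change of rings for Alexander modules\<close>

text \<open>The interface between topology and algebra: change of rings is developed from these
  combinatorial facts alone, and every diagram of a link is shown below to satisfy them.\<close>

locale arc_diagram =
  fixes D :: diagram
  assumes finite_arcs: "finite (arcs D)"
    and strand_of_mem: "a \<in> arcs D \<Longrightarrow> strand_of D a \<in> {1..num_strands D}"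
    and crossing_arcs: "c \<in> crossings D \<Longrightarrow>
      over_arc D c \<in> arcs D \<and> right_arc D c \<in> arcs D \<and> left_arc D c \<in> arcs D"
    and strand_of_right_arc: "c \<in> crossings D \<Longrightarrow> strand_of D (right_arc D c) = strand_of D (left_arc D c)"

text \<open>The ring and the values \<open>t\<close> stay arbitrary because three choices occur: the
  multivariate one, the reduced one and the evaluation at signs.\<close>

locale alexander = arc_diagram D + cring R for D and R (structure) +
  fixes t :: "nat \<Rightarrow> 'a"
  assumes t_closed: "i \<in> {1..num_strands D} \<Longrightarrow> t i \<in> carrier R"
begin

abbreviation F where "F \<equiv> free_module R (arcs D)"
abbreviation r where "r \<equiv> crossing_relator R t D"
abbreviation N where "N \<equiv> relations R (arcs D) (crossings D) r"

sublocale F: module R F by (rule free_module_module)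

lemma t_strand_closed: "a \<in> arcs D \<Longrightarrow> t (strand_of D a) \<in> carrier R"
  by (intro t_closed strand_of_mem)

lemma basis_vec_closed': "basis_vec R (arcs D) a \<in> carrier F"
  by simp

lemma relator_closed: "r \<in> crossings D \<rightarrow> carrier F"
proof
  fix c assume c: "c \<in> crossings D"
  show "r c \<in> carrier F"
    unfolding crossing_relator_def Let_def
    using crossing_arcs[OF c] t_strand_closed
    by (intro F.M.minus_closed F.M.add.m_closed F.smult_closed basis_vec_closed') auto
qed

lemma relator_apply:
  assumes c: "c \<in> crossings D" and a: "a \<in> arcs D"
  shows "r c a =
    (\<one> \<ominus> t (strand_of D (right_arc D c))) \<otimes> basis_vec R (arcs D) (over_arc D c) a \<oplus>
    t (strand_of D (over_arc D c)) \<otimes> basis_vec R (arcs D) (right_arc D c) a \<ominus>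
    basis_vec R (arcs D) (left_arc D c) a"
proof -
  have "(\<one> \<ominus> t (strand_of D (right_arc D c))) \<odot>\<^bsub>F\<^esub> basis_vec R (arcs D) (over_arc D c) \<oplus>\<^bsub>F\<^esub>
      t (strand_of D (over_arc D c)) \<odot>\<^bsub>F\<^esub> basis_vec R (arcs D) (right_arc D c) \<in> carrier F"
    using crossing_arcs[OF c] t_strand_closed
    by (intro F.M.add.m_closed F.smult_closed basis_vec_closed') auto
  then show ?thesis
    unfolding crossing_relator_def Let_def
    using a by (subst free_module_minus[OF _ basis_vec_closed' a]) auto
qed

sublocale NQ: module_quotient R F N
  by (rule relations_module_quotient[OF relator_closed])

lemma alexander_module_eq: "alexander_module R t D = quotient_module F N"
  unfolding alexander_module_def relations_def rho_def[abs_def] ..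

text \<open>The lift of \<open>phi\<close> to the free module, where it can be computed without
  choosing cosets.\<close>

definition \<Phi> where "\<Phi> x = (\<Oplus>a\<in>arcs D. x a \<otimes> (t (strand_of D a) \<ominus> \<one>))"

lemma summand_closed:
  assumes "x \<in> carrier F"
  shows "(\<lambda>a. x a \<otimes> (t (strand_of D a) \<ominus> \<one>)) \<in> arcs D \<rightarrow> carrier R"
  using assms t_strand_closed by (auto simp: PiE_iff)

lemma \<Phi>_closed: "x \<in> carrier F \<Longrightarrow> \<Phi> x \<in> carrier R"
  unfolding \<Phi>_def by (intro finsum_closed summand_closed)

lemma \<Phi>_add:
  assumes "x \<in> carrier F" "y \<in> carrier F"
  shows "\<Phi> (x \<oplus>\<^bsub>F\<^esub> y) = \<Phi> x \<oplus> \<Phi> y"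
proof -
  have "\<Phi> (x \<oplus>\<^bsub>F\<^esub> y) =
      (\<Oplus>a\<in>arcs D. x a \<otimes> (t (strand_of D a) \<ominus> \<one>) \<oplus> y a \<otimes> (t (strand_of D a) \<ominus> \<one>))"
    unfolding \<Phi>_def using assms t_strand_closed
    by (intro finsum_cong') (auto simp: PiE_iff l_distr)
  also have "\<dots> = \<Phi> x \<oplus> \<Phi> y"
    unfolding \<Phi>_def by (intro finsum_addf summand_closed assms)
  finally show ?thesis .
qed

lemma \<Phi>_smult:
  assumes "s \<in> carrier R" "x \<in> carrier F"
  shows "\<Phi> (s \<odot>\<^bsub>F\<^esub> x) = s \<otimes> \<Phi> x"
proof -
  have "\<Phi> (s \<odot>\<^bsub>F\<^esub> x) = (\<Oplus>a\<in>arcs D. s \<otimes> (x a \<otimes> (t (strand_of D a) \<ominus> \<one>)))"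
    unfolding \<Phi>_def using assms t_strand_closed
    by (intro finsum_cong') (auto simp: PiE_iff m_assoc)
  also have "\<dots> = s \<otimes> \<Phi> x"
    unfolding \<Phi>_def using finsum_rdistr[OF finite_arcs assms(1) summand_closed[OF assms(2)]] by simp
  finally show ?thesis .
qed

lemma \<Phi>_minus:
  assumes x: "x \<in> carrier F" and y: "y \<in> carrier F"
  shows "\<Phi> (x \<ominus>\<^bsub>F\<^esub> y) = \<Phi> x \<ominus> \<Phi> y"
proof -
  have "\<Phi> (x \<ominus>\<^bsub>F\<^esub> y) \<oplus> \<Phi> y = \<Phi> x"
    using \<Phi>_add[OF F.M.minus_closed[OF x y] y] x y
    by (simp add: a_minus_def F.M.a_assoc F.M.l_neg del: free_module_simps)
  then show ?thesis
    using \<Phi>_closed x y F.M.minus_closed[OF x y]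
    by (metis a_minus_def add.inv_solve_right)
qed

lemma \<Phi>_basis_vec:
  assumes a: "a \<in> arcs D"
  shows "\<Phi> (basis_vec R (arcs D) a) = t (strand_of D a) \<ominus> \<one>"
proof -
  have "\<Phi> (basis_vec R (arcs D) a) =
      (\<Oplus>b\<in>arcs D. if a = b then t (strand_of D b) \<ominus> \<one> else \<zero>)"
    unfolding \<Phi>_def basis_vec_def using t_strand_closed by (intro finsum_cong') auto
  also have "\<dots> = t (strand_of D a) \<ominus> \<one>"
    using a finite_arcs t_strand_closed by (intro finsum_singleton) auto
  finally show ?thesis .
qed

text \<open>Let u, v, v' be the values of \<open>t\<close> at the over, right and left arcs. The
  relator is sent to (1 - v)(u - 1) + u(v - 1) - (v' - 1) = v - v', which vanishes because both
  underpassing arcs lie on one strand.\<close>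

lemma \<Phi>_relator:
  assumes c: "c \<in> crossings D"
  shows "\<Phi> (r c) = \<zero>"
proof -
  let ?o = "over_arc D c" and ?x = "right_arc D c" and ?y = "left_arc D c"
  let ?e = "basis_vec R (arcs D)"
  define u v where "u = t (strand_of D ?o)" and "v = t (strand_of D ?x)"
  have cl: "?o \<in> arcs D" "?x \<in> arcs D" "?y \<in> arcs D" using crossing_arcs[OF c] by auto
  have uv: "u \<in> carrier R" "v \<in> carrier R" "t (strand_of D ?y) = v"
    using t_strand_closed cl strand_of_right_arc[OF c] by (auto simp: u_def v_def)
  have "\<Phi> (r c) = (\<one> \<ominus> v) \<otimes> (u \<ominus> \<one>) \<oplus> u \<otimes> (v \<ominus> \<one>) \<ominus> (v \<ominus> \<one>)"
    unfolding crossing_relator_def Let_def u_def[symmetric] v_def[symmetric]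
    using uv cl \<Phi>_basis_vec
    by (simp add: \<Phi>_minus \<Phi>_add \<Phi>_smult basis_vec_closed' F.smult_closed F.M.add.m_closed
        flip: u_def v_def del: free_module_simps)
  also have "\<dots> = \<zero>"
    using uv(1,2) by algebra
  finally show ?thesis .
qed

lemma \<Phi>_relations:
  assumes "x \<in> N"
  shows "\<Phi> x = \<zero>"
  using relator_closed assms
proof (induction rule: relations_induct)
  case zero
  show ?case
    using \<Phi>_smult[OF zero_closed F.M.zero_closed] \<Phi>_closed[OF F.M.zero_closed]
    by (simp del: free_module_simps)
next
  case (smult s c)
  then show ?case using relator_closed by (auto simp: \<Phi>_smult \<Phi>_relator Pi_iff simp del: free_module_simps)
qed (simp add: \<Phi>_add del: free_module_simps)

lemma phi_coset:
  assumes x: "x \<in> carrier F"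
  shows "phi R t D (N +>\<^bsub>F\<^esub> x) = \<Phi> x"
proof -
  have "\<Phi> y = \<Phi> x" if y: "y \<in> N +>\<^bsub>F\<^esub> x" for y
  proof -
    obtain n where "n \<in> N" "y = n \<oplus>\<^bsub>F\<^esub> x" using y by (auto simp: a_r_coset_def' simp del: free_module_simps)
    then show ?thesis
      using \<Phi>_add[of n x] \<Phi>_relations[of n] x NQ.a_subset \<Phi>_closed[OF x] by auto
  qed
  then have "\<Phi> ` (N +>\<^bsub>F\<^esub> x) = {\<Phi> x}"
    using NQ.a_rcos_self[OF x] by blast
  then show ?thesis
    unfolding phi_def \<Phi>_def[abs_def, symmetric] by simp
qed

end

section \<open>One diagram over two rings\<close>

locale alexander_base_change =
  A: alexander D R t + B: alexander D S t' + ring_hom_cring R S \<epsilon>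
  for D and R (structure) and S (structure) and t t' and \<epsilon> +
  assumes eps_surj: "\<epsilon> ` carrier R = carrier S"
    and eps_t: "i \<in> {1..num_strands D} \<Longrightarrow> \<epsilon> (t i) = t' i"
begin

definition E where "E x = (\<lambda>a\<in>arcs D. \<epsilon> (x a))"

lemma eps_minus: "x \<in> carrier R \<Longrightarrow> y \<in> carrier R \<Longrightarrow> \<epsilon> (x \<ominus> y) = \<epsilon> x \<ominus>\<^bsub>S\<^esub> \<epsilon> y"
  by (simp add: a_minus_def)

lemma E_closed: "x \<in> carrier A.F \<Longrightarrow> E x \<in> carrier B.F"
  by (auto simp: E_def PiE_iff)

lemma E_add: "x \<in> carrier A.F \<Longrightarrow> y \<in> carrier A.F \<Longrightarrow> E (x \<oplus>\<^bsub>A.F\<^esub> y) = E x \<oplus>\<^bsub>B.F\<^esub> E y"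
  by (auto simp: E_def PiE_iff intro!: restrict_ext)

lemma E_smult: "s \<in> carrier R \<Longrightarrow> x \<in> carrier A.F \<Longrightarrow> E (s \<odot>\<^bsub>A.F\<^esub> x) = \<epsilon> s \<odot>\<^bsub>B.F\<^esub> E x"
  by (auto simp: E_def PiE_iff intro!: restrict_ext)

lemma E_minus:
  assumes x: "x \<in> carrier A.F" and y: "y \<in> carrier A.F"
  shows "E (x \<ominus>\<^bsub>A.F\<^esub> y) = E x \<ominus>\<^bsub>B.F\<^esub> E y"
proof (rule free_module_eqI[of _ "arcs D" "carrier S"])
  show "E (x \<ominus>\<^bsub>A.F\<^esub> y) \<in> arcs D \<rightarrow>\<^sub>E carrier S"
    using E_closed[OF A.F.M.minus_closed[OF x y]] by simp
  show "E x \<ominus>\<^bsub>B.F\<^esub> E y \<in> arcs D \<rightarrow>\<^sub>E carrier S"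
    using B.F.M.minus_closed[OF E_closed[OF x] E_closed[OF y]] by simp
  fix a assume a: "a \<in> arcs D"
  have "x a \<in> carrier R" "y a \<in> carrier R" using x y a by (auto simp: PiE_iff)
  then show "E (x \<ominus>\<^bsub>A.F\<^esub> y) a = (E x \<ominus>\<^bsub>B.F\<^esub> E y) a"
    using a unfolding B.free_module_minus[OF E_closed[OF x] E_closed[OF y] a]
    by (simp add: E_def A.free_module_minus[OF x y a] eps_minus)
qed

lemma E_basis_vec: "E (basis_vec R (arcs D) a) = basis_vec S (arcs D) a"
  by (auto simp: E_def basis_vec_def)

lemma E_zero: "E \<zero>\<^bsub>A.F\<^esub> = \<zero>\<^bsub>B.F\<^esub>"
  by (auto simp: E_def)

lemma E_relator:
  assumes c: "c \<in> crossings D"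
  shows "E (A.r c) = B.r c"
proof -
  let ?e = "basis_vec R (arcs D)"
  have *: "t (strand_of D a) \<in> carrier R" "\<epsilon> (t (strand_of D a)) = t' (strand_of D a)"
    if "a \<in> arcs D" for a
    using that by (auto simp: A.t_strand_closed eps_t A.strand_of_mem[simplified])
  have **: "over_arc D c \<in> arcs D" "right_arc D c \<in> arcs D" "left_arc D c \<in> arcs D"
    using A.crossing_arcs[OF c] by auto
  show ?thesis
    unfolding crossing_relator_def Let_def
    using *[OF **(1)] *[OF **(2)] A.basis_vec_closed'
    by (simp add: E_minus E_add E_smult E_basis_vec eps_minus A.F.smult_closed A.F.M.add.m_closed
        del: free_module_simps)
qed

lemma E_finsum:
  assumes "\<And>c. c \<in> C \<Longrightarrow> g c \<in> carrier A.F"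
  shows "E (finsum A.F g C) = finsum B.F (\<lambda>c. E (g c)) C"
  using assms
proof (induction C rule: infinite_finite_induct)
  case (insert c C)
  then have "E (finsum A.F g (insert c C)) = E (g c \<oplus>\<^bsub>A.F\<^esub> finsum A.F g C)"
    by (subst A.F.M.finsum_insert) (auto simp del: free_module_simps)
  also have "\<dots> = E (g c) \<oplus>\<^bsub>B.F\<^esub> finsum B.F (\<lambda>c. E (g c)) C"
    using insert by (subst E_add) (auto intro!: A.F.M.finsum_closed simp del: free_module_simps)
  also have "\<dots> = finsum B.F (\<lambda>c. E (g c)) (insert c C)"
    using insert by (subst B.F.M.finsum_insert) (auto intro!: E_closed simp del: free_module_simps)
  finally show ?case .
qed (simp_all add: E_zero A.F.M.finsum_infinite B.F.M.finsum_infinite del: free_module_simps)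

lemma E_combination:
  assumes y: "y \<in> carrier (free_module R (crossings D))"
  shows "E (finsum A.F (\<lambda>c. y c \<odot>\<^bsub>A.F\<^esub> A.r c) (crossings D)) =
    finsum B.F (\<lambda>c. (\<lambda>c\<in>crossings D. \<epsilon> (y c)) c \<odot>\<^bsub>B.F\<^esub> B.r c) (crossings D)"
proof -
  have yc: "y c \<in> carrier R" if "c \<in> crossings D" for c using y that by (auto simp: PiE_iff)
  have "E (finsum A.F (\<lambda>c. y c \<odot>\<^bsub>A.F\<^esub> A.r c) (crossings D)) =
      finsum B.F (\<lambda>c. E (y c \<odot>\<^bsub>A.F\<^esub> A.r c)) (crossings D)"
    using A.relator_closed yc by (intro E_finsum A.F.smult_closed) auto
  also have "\<dots> = finsum B.F (\<lambda>c. (\<lambda>c\<in>crossings D. \<epsilon> (y c)) c \<odot>\<^bsub>B.F\<^esub> B.r c) (crossings D)"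
    using A.relator_closed B.relator_closed yc
    by (intro B.F.M.finsum_cong') (auto simp: E_smult E_relator Pi_iff simp del: free_module_simps)
  finally show ?thesis .
qed

text \<open>Equality matters: a vector over \<open>R\<close> whose image is a relation over
  \<open>S\<close> can then be corrected by a relation over \<open>R\<close>. For the harder
  inclusion the coefficients are lifted crossing by crossing along the surjection
  \<epsilon>.\<close>

lemma E_relations: "E ` A.N = B.N"
proof
  show "E ` A.N \<subseteq> B.N"
  proof
    fix z assume "z \<in> E ` A.N"
    then obtain y where y: "y \<in> carrier (free_module R (crossings D))"
      "z = E (finsum A.F (\<lambda>c. y c \<odot>\<^bsub>A.F\<^esub> A.r c) (crossings D))"
      by (auto simp: relations_def simp del: free_module_simps)
    have "(\<lambda>c\<in>crossings D. \<epsilon> (y c)) \<in> carrier (free_module S (crossings D))"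
      using y(1) by (auto simp: PiE_iff)
    then show "z \<in> B.N"
      unfolding y(2) E_combination[OF y(1)] relations_def by (rule imageI)
  qed
  show "B.N \<subseteq> E ` A.N"
  proof
    fix z assume "z \<in> B.N"
    then obtain y where y: "y \<in> carrier (free_module S (crossings D))"
      "z = finsum B.F (\<lambda>c. y c \<odot>\<^bsub>B.F\<^esub> B.r c) (crossings D)"
      by (auto simp: relations_def simp del: free_module_simps)
    let ?y = "\<lambda>c\<in>crossings D. inv_into (carrier R) \<epsilon> (y c)"
    have *: "y c \<in> \<epsilon> ` carrier R" if "c \<in> crossings D" for c
      using y(1) that eps_surj by (auto simp: PiE_iff)
    have 1: "?y \<in> carrier (free_module R (crossings D))"
      using * by (auto simp: inv_into_into)
    have 2: "(\<lambda>c\<in>crossings D. \<epsilon> (?y c)) = y"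
      by (rule free_module_eqI[of _ _ "carrier S"])
        (use y(1) * in \<open>auto simp: f_inv_into_f PiE_iff\<close>)
    have "z = E (finsum A.F (\<lambda>c. ?y c \<odot>\<^bsub>A.F\<^esub> A.r c) (crossings D))"
      unfolding E_combination[OF 1] 2 y(2) ..
    with 1 show "z \<in> E ` A.N"
      unfolding relations_def by blast
  qed
qed

lemma E_coset:
  assumes x: "x \<in> carrier A.F"
  shows "E ` (A.N +>\<^bsub>A.F\<^esub> x) = B.N +>\<^bsub>B.F\<^esub> E x"
proof -
  have "E ` (A.N +>\<^bsub>A.F\<^esub> x) = (\<lambda>n. E (n \<oplus>\<^bsub>A.F\<^esub> x)) ` A.N"
    by (auto simp: a_r_coset_def' simp del: free_module_simps)
  also have "\<dots> = (\<lambda>n. E n \<oplus>\<^bsub>B.F\<^esub> E x) ` A.N"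
    using E_add A.NQ.a_subset x by (intro image_cong) blast+
  also have "\<dots> = (\<lambda>n. n \<oplus>\<^bsub>B.F\<^esub> E x) ` (E ` A.N)"
    by (simp add: image_image)
  finally show ?thesis
    by (auto simp: a_r_coset_def' E_relations simp del: free_module_simps)
qed

lemma E_surj: "E ` carrier A.F = carrier B.F"
proof
  show "carrier B.F \<subseteq> E ` carrier A.F"
  proof
    fix z assume z: "z \<in> carrier B.F"
    let ?x = "\<lambda>a\<in>arcs D. inv_into (carrier R) \<epsilon> (z a)"
    have *: "z a \<in> \<epsilon> ` carrier R" if "a \<in> arcs D" for a
      using z that eps_surj by (auto simp: PiE_iff)
    have "z = E ?x"
      by (rule free_module_eqI[of _ "arcs D" "carrier S"])
        (use z * in \<open>auto simp: f_inv_into_f PiE_iff E_def\<close>)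
    moreover have "?x \<in> carrier A.F"
      using * by (auto simp: inv_into_into)
    ultimately show "z \<in> E ` carrier A.F" by blast
  qed
qed (use E_closed in blast)

text \<open>All coordinates of \<open>x\<close> lie in \<open>ker \<epsilon>\<close>, and
  \<open>x\<close> is the sum of its coordinates times basis vectors. The finitely many arcs are
  added one at a time, \<open>?p B\<close> being the part of \<open>x\<close> supported on
  \<open>B\<close>.\<close>

lemma E_kernel:
  assumes x: "x \<in> carrier A.F" and E: "E x = \<zero>\<^bsub>B.F\<^esub>"
  shows "A.N +>\<^bsub>A.F\<^esub> x \<in> ideal_multiples (a_kernel R S \<epsilon>) A.NQ.Q"
proof -
  let ?p = "\<lambda>B. \<lambda>a\<in>arcs D. if a \<in> B then x a else \<zero>"
  have xa: "x a \<in> a_kernel R S \<epsilon>" "x a \<in> carrier R" if "a \<in> arcs D" for a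
    using x that fun_cong[OF E, of a] by (auto simp: E_def a_kernel_def' PiE_iff)
  have pB: "?p B \<in> carrier A.F" for B using xa by auto
  have "A.N +>\<^bsub>A.F\<^esub> ?p B \<in> ideal_multiples (a_kernel R S \<epsilon>) A.NQ.Q" if "finite B" "B \<subseteq> arcs D" for B
    using that
  proof (induction B rule: finite_induct)
    case empty
    have "?p {} = \<zero>\<^bsub>A.F\<^esub>" by auto
    then have "A.N +>\<^bsub>A.F\<^esub> ?p {} = \<zero>\<^bsub>A.NQ.Q\<^esub>"
      by (simp only: A.NQ.coset_zero A.NQ.quotient_simps)
    then show ?case by (simp only: ideal_multiples.zero)
  next
    case (insert b B)
    have "?p (insert b B) = ?p B \<oplus>\<^bsub>A.F\<^esub> x b \<odot>\<^bsub>A.F\<^esub> basis_vec R (arcs D) b"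
      using insert xa by (auto simp: basis_vec_def intro!: restrict_ext)
    then have "A.N +>\<^bsub>A.F\<^esub> ?p (insert b B) = (A.N +>\<^bsub>A.F\<^esub> ?p B) \<oplus>\<^bsub>A.NQ.Q\<^esub>
        x b \<odot>\<^bsub>A.NQ.Q\<^esub> (A.N +>\<^bsub>A.F\<^esub> basis_vec R (arcs D) b)"
      using xa insert.prems pB
      by (simp add: A.NQ.quotient_add A.NQ.quotient_smult A.basis_vec_closed' A.F.smult_closed
          del: free_module_simps)
    moreover have "A.N +>\<^bsub>A.F\<^esub> basis_vec R (arcs D) b \<in> carrier A.NQ.Q"
      unfolding A.NQ.quotient_carrier using A.basis_vec_closed' by blast
    moreover have "A.N +>\<^bsub>A.F\<^esub> ?p B \<in> ideal_multiples (a_kernel R S \<epsilon>) A.NQ.Q"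
      using insert by blast
    ultimately show ?case
      using xa(1)[of b] insert.prems by (simp only:) (intro ideal_multiples.add_smult, blast+)
  qed
  from this[OF A.finite_arcs order_refl] have "A.N +>\<^bsub>A.F\<^esub> ?p (arcs D) \<in>
      ideal_multiples (a_kernel R S \<epsilon>) A.NQ.Q" .
  moreover have "?p (arcs D) = x"
    by (rule free_module_eqI[of _ "arcs D" "carrier R"]) (use x in \<open>auto simp: PiE_iff\<close>)
  ultimately show ?thesis by simp
qed

lemma base_change:
  "base_change R S \<epsilon> (alexander_module R t D) (alexander_module S t' D) ((`) E)"
  unfolding A.alexander_module_eq B.alexander_module_eq
proof (intro base_change.intro ring_hom_cring_axioms A.NQ.quotient_module_module
    B.NQ.quotient_module_module base_change_axioms.intro eps_surj)
  show "(`) E ` carrier A.NQ.Q = carrier B.NQ.Q"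
    unfolding A.NQ.quotient_carrier B.NQ.quotient_carrier E_surj[symmetric] image_image
    by (intro image_cong refl E_coset)
  fix X assume "X \<in> carrier A.NQ.Q"
  then obtain x where x: "x \<in> carrier A.F" "X = A.N +>\<^bsub>A.F\<^esub> x"
    unfolding A.NQ.quotient_carrier by blast
  show "E ` (X \<oplus>\<^bsub>A.NQ.Q\<^esub> Y) = E ` X \<oplus>\<^bsub>B.NQ.Q\<^esub> E ` Y" if Y: "Y \<in> carrier A.NQ.Q" for Y
  proof -
    obtain y where y: "y \<in> carrier A.F" "Y = A.N +>\<^bsub>A.F\<^esub> y"
      using Y unfolding A.NQ.quotient_carrier by blast
    show ?thesis
      using x(1) y(1) unfolding x(2) y(2)
      by (simp add: A.NQ.quotient_add B.NQ.quotient_add E_coset E_add E_closed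
          A.F.M.add.m_closed del: free_module_simps)
  qed
  show "E ` (s \<odot>\<^bsub>A.NQ.Q\<^esub> X) = \<epsilon> s \<odot>\<^bsub>B.NQ.Q\<^esub> E ` X" if "s \<in> carrier R" for s
    using x(1) that unfolding x(2)
    by (simp add: A.NQ.quotient_smult B.NQ.quotient_smult E_coset E_smult E_closed
        A.F.smult_closed del: free_module_simps)
  assume "E ` X = \<zero>\<^bsub>B.NQ.Q\<^esub>"
  then have "B.N +>\<^bsub>B.F\<^esub> E x = B.N"
    unfolding x(2) E_coset[OF x(1)] B.NQ.quotient_simps .
  then have "E x \<in> E ` A.N"
    using B.NQ.a_rcos_self[OF E_closed[OF x(1)]] unfolding E_relations by simp
  \<comment> \<open>Subtracting the relation \<open>n\<close> leaves the coset of \<open>x\<close>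
    unchanged and moves all coordinates into \<open>ker \<epsilon>\<close>, so that
    \<open>E_kernel\<close> applies.\<close>
  then obtain n where n: "n \<in> A.N" "E n = E x" by auto
  have nF: "n \<in> carrier A.F" using n(1) A.NQ.a_subset by blast
  have d: "x \<ominus>\<^bsub>A.F\<^esub> n \<in> carrier A.F" using x(1) nF by (rule A.F.M.minus_closed)
  have "E (x \<ominus>\<^bsub>A.F\<^esub> n) = \<zero>\<^bsub>B.F\<^esub>"
    using B.F.M.r_neg[OF E_closed[OF x(1)]] E_minus[OF x(1) nF] n(2) by (metis a_minus_def)
  then have "A.N +>\<^bsub>A.F\<^esub> (x \<ominus>\<^bsub>A.F\<^esub> n) \<in> ideal_multiples (a_kernel R S \<epsilon>) A.NQ.Q"
    by (rule E_kernel[OF d])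
  moreover have "A.N +>\<^bsub>A.F\<^esub> (x \<ominus>\<^bsub>A.F\<^esub> n) = X"
  proof -
    have "x = (x \<ominus>\<^bsub>A.F\<^esub> n) \<oplus>\<^bsub>A.F\<^esub> n"
      using x(1) nF by (simp add: a_minus_def A.F.M.a_assoc A.F.M.l_neg del: free_module_simps)
    then have "x \<in> A.N +>\<^bsub>A.F\<^esub> (x \<ominus>\<^bsub>A.F\<^esub> n)"
      unfolding a_r_coset_def' using n(1) A.F.M.a_comm[OF d nF] by blast
    then show ?thesis
      unfolding x(2) using d by (intro A.NQ.a_repr_independence')
  qed
  ultimately show "X \<in> ideal_multiples (a_kernel R S \<epsilon>) A.NQ.Q" by simp
qed

lemma phi_base_change:
  assumes "X \<in> carrier (alexander_module R t D)"
  shows "phi S t' D (E ` X) = \<epsilon> (phi R t D X)"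
proof -
  obtain x where x: "x \<in> carrier A.F" "X = A.N +>\<^bsub>A.F\<^esub> x"
    using assms unfolding A.alexander_module_eq A.NQ.quotient_carrier by blast
  have "\<epsilon> (A.\<Phi> x) = (\<Oplus>\<^bsub>S\<^esub>a\<in>arcs D. \<epsilon> (x a \<otimes> (t (strand_of D a) \<ominus> \<one>)))"
    unfolding A.\<Phi>_def by (simp add: A.summand_closed[OF x(1)] o_def)
  also have "\<dots> = B.\<Phi> (E x)"
    unfolding B.\<Phi>_def E_def using x(1) A.t_strand_closed eps_t A.strand_of_mem B.t_strand_closed
    by (intro B.finsum_cong') (auto simp: PiE_iff eps_minus)
  finally show ?thesis
    unfolding x(2) E_coset[OF x(1)] A.phi_coset[OF x(1)] B.phi_coset[OF E_closed[OF x(1)]] by simp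
qed

end

lemma arc_diagram_base_change:
  assumes "arc_diagram D" "1 \<le> num_strands D"
  shows "alexander_base_change D (laurent_ring (num_strands D)) (laurent_ring 1) tvar (\<lambda>i. tvar 1) reduce"
proof -
  interpret arc_diagram D by fact
  interpret R: cring "laurent_ring (num_strands D)" by (rule laurent_ring_cring)
  interpret S: cring "laurent_ring 1" by (rule laurent_ring_cring)
  show ?thesis
    by unfold_locales
      (use reduce_ring_hom reduce_surj[OF assms(2)] reduce_tvar tvar_closed in auto)
qed

lemma reduced_equivalent:
  assumes D: "arc_diagram D" "arc_diagram D'"
    and n: "1 \<le> num_strands D" "num_strands D' = num_strands D"
    and eq: "equivalent_sequences (laurent_ring (num_strands D))
      (link_module_sequence D) (link_module_sequence D')"
  shows "equivalent_sequences (laurent_ring 1)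
      (reduced_link_module_sequence D) (reduced_link_module_sequence D')"
proof -
  let ?R = "laurent_ring (num_strands D)" and ?S = "laurent_ring 1"
  let ?s = "\<lambda>i::nat. tvar 1"
  interpret B: alexander_base_change D ?R ?S tvar ?s reduce
    by (rule arc_diagram_base_change[OF D(1) n(1)])
  interpret B': alexander_base_change D' ?R ?S tvar ?s reduce
    using arc_diagram_base_change[OF D(2)] n by simp
  obtain f where f: "f \<in> module_iso ?R (alexander_module ?R tvar D) (alexander_module ?R tvar D')"
    "\<And>x. x \<in> carrier (alexander_module ?R tvar D) \<Longrightarrow> phi ?R tvar D x = phi ?R tvar D' (f x)"
    using eq n by (auto simp: equivalent_sequences_def link_module_sequence_def)
  obtain g where g: "g \<in> module_iso ?S (alexander_module ?S ?s D) (alexander_module ?S ?s D')"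
    "\<And>x. x \<in> carrier (alexander_module ?R tvar D) \<Longrightarrow> g (B.E ` x) = B'.E ` f x"
    using base_change_module_iso[OF B.base_change B'.base_change f(1)] by blast
  have "phi ?S ?s D y = phi ?S ?s D' (g y)" if y: "y \<in> carrier (alexander_module ?S ?s D)" for y
  proof -
    \<comment> \<open>It suffices to treat images of multivariate elements; there both values of
      \<open>phi\<close> are obtained by applying \<open>reduce\<close> to values which
      \<open>f\<close> matches.\<close>
    have "y \<in> (`) B.E ` carrier (alexander_module ?R tvar D)"
      using y unfolding base_change.pi_surj[OF B.base_change] .
    then obtain x where x: "x \<in> carrier (alexander_module ?R tvar D)" "y = B.E ` x" by blast
    have "f x \<in> carrier (alexander_module ?R tvar D')"
      using f(1) x(1) by (auto simp: module_iso_def bij_betw_def)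
    then show ?thesis
      using f(2)[OF x(1)] g(2)[OF x(1)] B.phi_base_change[OF x(1)]
        B'.phi_base_change[of "f x"] x(2) by metis
  qed
  with g(1) show ?thesis
    by (auto simp: equivalent_sequences_def reduced_link_module_sequence_def)
qed


section \<open>Diagrams of links\<close>

lemma periodic_of_int:
  fixes f :: "real \<Rightarrow> 'a"
  assumes "\<And>t. f (t + 1) = f t"
  shows "f (t + of_int k) = f t"
proof (induction k rule: int_induct[of _ 0])
  case (step1 i)
  then show ?case using assms[of "t + of_int i"] by (simp add: add.assoc)
next
  case (step2 i)
  then show ?case using assms[of "t + of_int (i - 1)"] by simp
qed simp

lemma periodic_frac:
  fixes f :: "real \<Rightarrow> 'a"
  assumes "\<And>t. f (t + 1) = f t"
  shows "f (frac t) = f t"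
  using periodic_of_int[of f "frac t" "\<lfloor>t\<rfloor>", OF assms] by (simp add: frac_def)

lemma smooth_regular_on_imp_continuous_on:
  assumes "smooth_regular_on f S"
  shows "continuous_on S f"
  using assms unfolding smooth_regular_on_def continuous_on_eq_continuous_within
  by (metis has_vector_derivative_continuous)

text \<open>The pieces are glued on the closed unit interval, and periodicity carries continuity to
  every interval between consecutive integers.\<close>

lemma piecewise_smooth_loop_continuous:
  assumes f: "piecewise_smooth_loop f"
  shows "continuous_on UNIV f"
proof -
  have per: "\<And>t. f (t + 1) = f t" using f by (simp add: piecewise_smooth_loop_def)
  obtain m p where p: "p 0 = (0::real)" "p m = 1"
    "\<And>k. k < m \<Longrightarrow> p k < p (Suc k) \<and> smooth_regular_on f {p k..p (Suc k)}"
    using f by (auto simp: piecewise_smooth_loop_def)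
  have "k \<le> m \<Longrightarrow> 0 \<le> p k \<and> continuous_on {0..p k} f" for k
  proof (induction k)
    case (Suc k)
    then have "0 \<le> p k" "p k < p (Suc k)" "continuous_on {0..p k} f"
      "continuous_on {p k..p (Suc k)} f"
      using p(3)[of k] smooth_regular_on_imp_continuous_on by auto
    moreover from this have "{0..p (Suc k)} = {0..p k} \<union> {p k..p (Suc k)}" by auto
    ultimately show ?case by (auto intro: continuous_on_closed_Un)
  qed (simp add: p(1))
  from this[of m] have c01: "continuous_on {0..1} f" using p(2) by simp
  have ck: "continuous_on {of_int k..of_int k + 1} f" for k
  proof -
    have "continuous_on {of_int k..of_int k + 1} (\<lambda>t. f (t + of_int (- k)))"
      by (rule continuous_on_compose2[OF c01]) (auto intro!: continuous_intros)
    then show ?thesis by (simp only: periodic_of_int[of f, OF per])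
  qed
  have "isCont f t" for t
  proof -
    define k where "k = \<lfloor>t\<rfloor>"
    \<comment> \<open>Two adjacent unit intervals are joined because \<open>t\<close> may be the
      integer \<open>k\<close>, which is interior to neither of them.\<close>
    have "{of_int k - 1..of_int k + 1} = {of_int (k - 1)..of_int (k - 1) + 1} \<union> {of_int k..of_int k + (1::real)}"
      by auto
    then have "continuous_on {of_int k - 1..of_int k + 1} f"
      using continuous_on_closed_Un[OF _ _ ck[of "k - 1"] ck[of k]] by simp
    moreover have "t \<in> interior {of_int k - 1..of_int k + 1}"
      unfolding k_def interior_atLeastAtMost_real by (simp; linarith)
    ultimately show ?thesis by (rule continuous_on_interior)
  qed
  then show ?thesis by (simp add: continuous_at_imp_continuous_on)
qed

lemma real4_sphere_iff: "x \<in> sphere 0 1 \<longleftrightarrow> (x$1)\<^sup>2 + (x$2)\<^sup>2 + (x$3)\<^sup>2 + (x$4)\<^sup>2 = 1" for x :: "real^4"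
  by (simp add: norm_eq_1 inner_vec_def sum_4 power2_eq_square)

text \<open>If (a, b, c) is the projection of a point of the sphere with last coordinate w, then (1
  - w)(a^2 + b^2 + c^2 + 1) = 2. This recovers w, and then the other coordinates.\<close>

lemma stereographic_inj:
  fixes x y :: "real^4"
  assumes x: "x \<in> sphere 0 1" "x $ 4 \<noteq> 1" and y: "y \<in> sphere 0 1" "y $ 4 \<noteq> 1"
    and p: "stereo_plane x = stereo_plane y" and h: "stereo_height x = stereo_height y"
  shows "x = y"
proof -
  have *: "z$1 = fst (stereo_plane z) * (1 - z$4) \<and> z$2 = snd (stereo_plane z) * (1 - z$4) \<and>
      z$3 = stereo_height z * (1 - z$4) \<and>
      (1 - z$4) * ((fst (stereo_plane z))\<^sup>2 + (snd (stereo_plane z))\<^sup>2 + (stereo_height z)\<^sup>2 + 1) = 2"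
    if z: "z \<in> sphere 0 1" "z $ 4 \<noteq> 1" for z :: "real^4"
  proof -
    define a b c w where "a = fst (stereo_plane z)" "b = snd (stereo_plane z)"
      "c = stereo_height z" "w = 1 - z$4"
    have w: "w \<noteq> 0" using z(2) by (simp add: a_b_c_w_def)
    have abc: "z$1 = a * w" "z$2 = b * w" "z$3 = c * w" "z$4 = 1 - w"
      using w by (simp_all add: a_b_c_w_def stereo_plane_def stereo_height_def)
    have "w * (w * (a\<^sup>2 + b\<^sup>2 + c\<^sup>2 + 1)) = w * 2"
      using z(1) unfolding real4_sphere_iff abc by (simp add: algebra_simps power2_eq_square)
    then show ?thesis using w abc unfolding a_b_c_w_def[symmetric] by simp
  qed
  let ?S = "(fst (stereo_plane x))\<^sup>2 + (snd (stereo_plane x))\<^sup>2 + (stereo_height x)\<^sup>2 + 1"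
  have "?S > 0" by (intro add_nonneg_pos) auto
  moreover have "(1 - x$4) * ?S = (1 - y$4) * ?S"
    using *[OF x] *[OF y] p h by simp
  ultimately have "x$4 = y$4" by auto
  then have "x $ i = y $ i" for i
    using *[OF x] *[OF y] p h exhaust_4[of i] by auto
  then show ?thesis by (simp add: vec_eq_iff)
qed

text \<open>Each removed ball cuts every interval into at most two, a left and a right part.\<close>

lemma interval_minus_balls:
  assumes "finite U"
  shows "\<exists>\<C>. finite \<C> \<and> (\<forall>I\<in>\<C>. connected I) \<and> {0..1::real} - (\<Union>s\<in>U. ball s g) = \<Union>\<C>"
  using assms
proof induction
  case empty
  show ?case by (intro exI[of _ "{{0..1}}"]) auto
next
  case (insert s U)
  then obtain \<C> where \<C>: "finite \<C>" "\<And>I. I \<in> \<C> \<Longrightarrow> connected I"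
    "{0..1} - (\<Union>s\<in>U. ball s g) = \<Union>\<C>" by blast
  let ?\<C> = "(\<lambda>I. I \<inter> {..s - g}) ` \<C> \<union> (\<lambda>I. I \<inter> {s + g..}) ` \<C>"
  have "connected (I \<inter> {..s - g})" "connected (I \<inter> {s + g..})" if "I \<in> \<C>" for I
    using \<C>(2)[OF that] unfolding is_interval_connected_1[symmetric]
    by (auto intro: is_interval_Int)
  moreover have "{0..1} - (\<Union>s\<in>insert s U. ball s g) = \<Union>?\<C>"
  proof -
    have "{0..1} - (\<Union>s\<in>insert s U. ball s g) = \<Union>\<C> \<inter> - ball s g"
      unfolding \<C>(3)[symmetric] by auto
    also have "- ball s g = {..s - g} \<union> {s + g..}"
      by (auto simp: dist_real_def)
    finally show ?thesis by (simp only: Int_Un_distrib Union_Un_distrib Int_Union2)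
  qed
  ultimately show ?case
    using \<C>(1) by (intro exI[of _ ?\<C>]) auto
qed

text \<open>A component contains any member of the family that it meets, so one point chosen from
  each member reaches every component.\<close>

lemma finite_components_Union:
  assumes "finite \<C>" "\<And>I. I \<in> \<C> \<Longrightarrow> connected I"
  shows "finite (components (\<Union>\<C>))"
proof -
  have "components (\<Union>\<C>) \<subseteq> (\<lambda>I. connected_component_set (\<Union>\<C>) (SOME x. x \<in> I)) ` \<C>"
  proof
    fix S assume "S \<in> components (\<Union>\<C>)"
    then obtain x I where x: "x \<in> I" "I \<in> \<C>" "S = connected_component_set (\<Union>\<C>) x"
      by (auto simp: components_iff)
    then have "(SOME x. x \<in> I) \<in> I" by (auto intro: someI)
    moreover have "I \<subseteq> connected_component_set (\<Union>\<C>) x"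
      using x assms(2) by (intro connected_component_maximal) auto
    ultimately have "connected_component_set (\<Union>\<C>) (SOME x. x \<in> I) = S"
      unfolding x(3) by (intro connected_component_eq) auto
    then show "S \<in> (\<lambda>I. connected_component_set (\<Union>\<C>) (SOME x. x \<in> I)) ` \<C>"
      using x(2) by blast
  qed
  then show ?thesis using assms(1) by (rule finite_subset[OF _ finite_imageI])
qed

text \<open>Two points in the same cell of the grid of mesh \<open>d\<close> are closer than
  \<open>d\<close>, so the points inject into the finitely many cells that meet the
  interval.\<close>

lemma finite_bounded_separated:
  fixes U :: "real set"
  assumes "d > 0" and sep: "\<And>s s'. s \<in> U \<Longrightarrow> s' \<in> U \<Longrightarrow> s \<noteq> s' \<Longrightarrow> d < \<bar>s - s'\<bar>"
    and U: "U \<subseteq> {a..b}"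
  shows "finite U"
proof (rule inj_on_finite)
  show "inj_on (\<lambda>s. \<lfloor>s / d\<rfloor>) U"
  proof (rule inj_onI, rule ccontr)
    fix s s' assume s: "s \<in> U" "s' \<in> U" "\<lfloor>s / d\<rfloor> = \<lfloor>s' / d\<rfloor>" "s \<noteq> s'"
    have "\<bar>s / d - s' / d\<bar> < 1"
      using s(3) floor_correct[of "s / d"] floor_correct[of "s' / d"] by linarith
    then have "\<bar>s - s'\<bar> < d"
      using assms(1) by (simp add: diff_divide_distrib[symmetric] field_simps)
    then show False using sep[OF s(1,2,4)] by simp
  qed
  show "(\<lambda>s. \<lfloor>s / d\<rfloor>) ` U \<subseteq> {\<lfloor>a / d\<rfloor>..\<lfloor>b / d\<rfloor>}"
  proof (rule image_subsetI)
    fix s assume "s \<in> U"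
    then have "a \<le> s" "s \<le> b" using U by auto
    then show "\<lfloor>s / d\<rfloor> \<in> {\<lfloor>a / d\<rfloor>..\<lfloor>b / d\<rfloor>}"
      using assms(1) by (auto intro!: floor_mono divide_right_mono)
  qed
qed simp

section \<open>The combinatorics of a diagram of a link\<close>

locale link_diagram =
  fixes D :: diagram and L :: link
  assumes link: "is_link L" and diagram: "diagram_of D L"
begin

abbreviation "strands \<equiv> {1..num_strands D}"

lemma num_strands: "num_strands D = num_comps L" "1 \<le> num_strands D"
  using link diagram by (auto simp: is_link_def diagram_of_def)

lemma regular: "regular_diagram D" and gap_pos: "gap D > 0"
  using diagram by (auto simp: diagram_of_def short_gap_def)

text \<open>\<open>regular_diagram\<close> speaks of crossings, which presuppose different heights.
  That a meeting point of two strands is a crossing comes from the disjointness of the components in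
  the sphere and the injectivity of stereographic projection.\<close>

lemma height_neq:
  assumes ij: "i \<in> strands" "j \<in> strands" "i \<noteq> j" and "plane D i s = plane D j u"
  shows "height D i s \<noteq> height D j u"
proof
  assume h: "height D i s = height D j u"
  obtain Q :: "real^4^4" where Q: "rotation_matrix Q"
    "\<And>i s. i \<in> strands \<Longrightarrow> (Q *v knot L i s) $ 4 \<noteq> 1 \<and>
      plane D i s = stereo_plane (Q *v knot L i s) \<and> height D i s = stereo_height (Q *v knot L i s)"
    using diagram by (auto simp: diagram_of_def)
  have orth: "orthogonal_transformation ((*v) Q)"
    using Q(1) by (simp add: rotation_matrix_def orthogonal_transformation_matrix)
  have sph: "Q *v knot L i s \<in> sphere 0 1" if "i \<in> strands" for i s
  proof -
    have "range (knot L i) \<subseteq> sphere 0 1"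
      using link that num_strands(1) unfolding is_link_def by simp
    then have "norm (knot L i s) = 1" by (auto simp: image_subset_iff)
    then show ?thesis using orthogonal_transformation_norm[OF orth] by simp
  qed
  have "Q *v knot L i s = Q *v knot L j u"
    using ij assms(4) h Q(2)[of i s] Q(2)[of j u] sph by (intro stereographic_inj) auto
  then have "knot L i s = knot L j u"
    using orthogonal_transformation_inj[OF orth] by (auto dest: injD)
  moreover have "range (knot L i) \<inter> range (knot L j) = {}"
    using link ij num_strands(1) unfolding is_link_def by simp
  ultimately show False by blast
qed

lemma plane_loop: "i \<in> strands \<Longrightarrow> piecewise_smooth_loop (plane D i)"
  using regular by (simp add: regular_diagram_def)

lemma plane_period: "i \<in> strands \<Longrightarrow> plane D i (t + 1) = plane D i t"
  using plane_loop[of i] by (simp add: piecewise_smooth_loop_def)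

lemma height_period:
  assumes "i \<in> strands"
  shows "height D i (t + 1) = height D i t"
proof -
  have "knot L i (t + 1) = knot L i t"
    using link assms num_strands(1) by (simp add: is_link_def piecewise_smooth_loop_def)
  then show ?thesis using diagram assms num_strands(1) by (auto simp: diagram_of_def)
qed

lemma plane_frac: "i \<in> strands \<Longrightarrow> plane D i (frac t) = plane D i t"
  by (rule periodic_frac) (rule plane_period)

lemma height_frac: "i \<in> strands \<Longrightarrow> height D i (frac t) = height D i t"
  by (rule periodic_frac) (rule height_period)

lemma plane_of_int: "i \<in> strands \<Longrightarrow> plane D i (t + of_int k) = plane D i t"
  by (rule periodic_of_int) (rule plane_period)

lemma height_of_int: "i \<in> strands \<Longrightarrow> height D i (t + of_int k) = height D i t"
  by (rule periodic_of_int) (rule height_period)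

lemma plane_continuous: "i \<in> strands \<Longrightarrow> continuous_on S (plane D i)"
  using piecewise_smooth_loop_continuous[OF plane_loop] continuous_on_subset by blast

definition preimage where
  "preimage q = {(i, s). i \<in> strands \<and> s \<in> {0..<1} \<and> plane D i s = q}"

lemma preimage_card: "q \<in> crossings D \<Longrightarrow> card (preimage q) = 2"
  using regular by (simp add: regular_diagram_def preimage_def)

lemma preimage_frac: "i \<in> strands \<Longrightarrow> (i, frac s) \<in> preimage (plane D i s)"
  by (simp add: preimage_def plane_frac frac_lt_1)

lemma passes_underD:
  assumes "passes_under D i s j u"
  shows "i \<in> strands" "j \<in> strands" "plane D i s = plane D j u" "height D i s < height D j u"
    "underpass D i s" "plane D i s \<in> crossings D"
proof -
  show "underpass D i s" using assms by (auto simp: underpass_def)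
  then show "plane D i s \<in> crossings D" by (auto simp: crossings_def)
qed (use assms in \<open>auto simp: passes_under_def\<close>)

lemma passes_under_frac:
  assumes "passes_under D i s j u"
  shows "passes_under D i (frac s) j (frac u)"
  using assms by (auto simp: passes_under_def plane_frac height_frac)

lemma underpass_of_int: "underpass D i s \<Longrightarrow> underpass D i (s + of_int k)"
  by (auto simp: underpass_def passes_under_def plane_of_int height_of_int)

lemma crossing_not_near_underpass:
  assumes "underpass D i s" "u \<noteq> s" "\<bar>u - s\<bar> \<le> 2 * gap D"
  shows "plane D i u \<notin> crossings D"
  using diagram assms by (auto simp: diagram_of_def short_gap_def)

lemma underpass_separated:
  assumes "underpass D i s" "underpass D i s'" "s \<noteq> s'"
  shows "2 * gap D < \<bar>s - s'\<bar>"
  using crossing_not_near_underpass[of i s' s] assms by (force simp: crossings_def)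

text \<open>Otherwise three points with strictly increasing heights would lie over one crossing,
  which has only two preimages in a period.\<close>

lemma over_not_underpass:
  assumes "passes_under D i s j u"
  shows "\<not> underpass D j u"
proof
  assume "underpass D j u"
  then obtain k v where k: "passes_under D j u k v" by (auto simp: underpass_def)
  let ?q = "plane D i s"
  let ?T = "{(i, frac s), (j, frac u), (k, frac v)}"
  have "height D i (frac s) < height D j (frac u)" "height D j (frac u) < height D k (frac v)"
    using passes_underD[OF assms] passes_underD[OF k] by (simp_all add: height_frac)
  then have "card ?T = 3" by (auto simp: card_insert_if)
  moreover have "?T \<subseteq> preimage ?q"
    using preimage_frac[of i s] preimage_frac[of j u] preimage_frac[of k v]
      passes_underD[OF assms] passes_underD[OF k] by auto
  moreover have "finite (preimage ?q)" "card (preimage ?q) = 2"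
    using preimage_card[OF passes_underD(6)[OF assms]] by (auto intro: card_ge_0_finite)
  ultimately show False using card_mono[of "preimage ?q" ?T] by simp
qed

text \<open>The parameters that survive the cutting. Distance exactly \<open>gap D\<close> is
  allowed, so this set is closed and contains the end points of the removed segments, from which the
  underpassing arcs are defined.\<close>

definition good :: "nat \<Rightarrow> real set" where
  "good i = {u. \<forall>s. underpass D i s \<longrightarrow> gap D \<le> \<bar>u - s\<bar>}"

lemma drawing_eq: "drawing D = (\<Union>i\<in>strands. plane D i ` good i)"
  unfolding drawing_def good_def by (fastforce simp: not_less)

lemma good_not_underpass: "u \<in> good i \<Longrightarrow> \<not> underpass D i u"
  using gap_pos by (force simp: good_def)

lemma good_of_int:
  assumes "u \<in> good i"
  shows "u + of_int k \<in> good i"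
proof -
  have "gap D \<le> \<bar>u + of_int k - s\<bar>" if "underpass D i s" for s
    using underpass_of_int[OF that, of "- k"] assms
    by (auto simp: good_def algebra_simps dest!: spec[of _ "s - of_int k"])
  then show ?thesis by (auto simp: good_def)
qed

text \<open>This puts the crossing point itself into the drawing, so that \<open>over_arc\<close> is
  the component of an actual point.\<close>

lemma over_good:
  assumes "passes_under D i s j u"
  shows "u \<in> good j"
proof (rule ccontr)
  assume "u \<notin> good j"
  then obtain s' where s': "underpass D j s'" "\<bar>u - s'\<bar> < gap D" by (auto simp: good_def)
  then have "u \<noteq> s'" using over_not_underpass[OF assms] by auto
  then have "plane D j u \<notin> crossings D"
    using crossing_not_near_underpass[OF s'(1)] s'(2) by simp
  then show False using passes_underD[OF assms] by simp
qed

text \<open>Any other underpass is more than twice the gap away from \<open>s\<close>, hence more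
  than the gap away from both end points.\<close>

lemma beside_underpass_good:
  assumes "underpass D i s"
  shows "s + gap D \<in> good i" "s - gap D \<in> good i"
proof -
  have "gap D \<le> \<bar>s + gap D - s'\<bar> \<and> gap D \<le> \<bar>s - gap D - s'\<bar>" if "underpass D i s'" for s'
    using underpass_separated[OF assms that] gap_pos by (cases "s = s'") auto
  then show "s + gap D \<in> good i" "s - gap D \<in> good i" by (auto simp: good_def)
qed

lemma meeting_strands_underpass:
  assumes ij: "i \<in> strands" "j \<in> strands" "i \<noteq> j" and eq: "plane D i u = plane D j v"
  shows "underpass D i u \<or> underpass D j v"
proof -
  have "height D i u < height D j v \<or> height D j v < height D i u"
    using height_neq[OF ij eq] by auto
  then show ?thesis
    using ij eq unfolding underpass_def passes_under_def by metis
qed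

lemma strands_disjoint:
  assumes "i \<in> strands" "j \<in> strands" "i \<noteq> j"
  shows "plane D i ` good i \<inter> plane D j ` good j = {}"
proof (rule ccontr)
  assume "plane D i ` good i \<inter> plane D j ` good j \<noteq> {}"
  then obtain u v where uv: "u \<in> good i" "v \<in> good j" "plane D i u = plane D j v"
    by (auto simp: set_eq_iff)
  have "underpass D i u \<or> underpass D j v"
    by (rule meeting_strands_underpass[OF assms uv(3)])
  then show False using uv good_not_underpass by auto
qed

lemma good_unit_interval:
  assumes i: "i \<in> strands"
  shows "plane D i ` good i = plane D i ` (good i \<inter> {0..1})"
proof
  show "plane D i ` good i \<subseteq> plane D i ` (good i \<inter> {0..1})"
  proof (rule image_subsetI)
    fix u assume u: "u \<in> good i"
    have "u + of_int (- \<lfloor>u\<rfloor>) = frac u" by (simp add: frac_def)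
    then have "frac u \<in> good i" using good_of_int[OF u] by metis
    then show "plane D i u \<in> plane D i ` (good i \<inter> {0..1})"
      using plane_frac[OF i, of u] frac_lt_1[of u] by (intro image_eqI[of _ _ "frac u"]) auto
  qed
qed auto

lemma strand_compact:
  assumes i: "i \<in> strands"
  shows "compact (plane D i ` good i)"
proof -
  have "good i = (\<Inter>s\<in>{s. underpass D i s}. {u. gap D \<le> \<bar>u - s\<bar>})"
    by (auto simp: good_def)
  moreover have "closed {u. gap D \<le> \<bar>u - s\<bar>}" for s
    by (intro closed_Collect_le continuous_intros)
  ultimately have "closed (good i)" by auto
  then have "compact (good i \<inter> {0..1})" by (intro closed_Int_compact) auto
  then have "compact (plane D i ` (good i \<inter> {0..1}))"
    by (intro compact_continuous_image plane_continuous i)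
  then show ?thesis using good_unit_interval[OF i] by simp
qed

section \<open>Arcs as connected components\<close>

abbreviation arc_at :: "nat \<Rightarrow> real \<Rightarrow> (real \<times> real) set" where
  "arc_at i u \<equiv> connected_component_set (drawing D) (plane D i u)"

lemma plane_in_drawing: "i \<in> strands \<Longrightarrow> u \<in> good i \<Longrightarrow> plane D i u \<in> drawing D"
  by (auto simp: drawing_eq)

lemma arc_at_in_arcs: "i \<in> strands \<Longrightarrow> u \<in> good i \<Longrightarrow> arc_at i u \<in> arcs D"
  unfolding arcs_def components_def by (rule imageI) (rule plane_in_drawing)

lemma arcsE:
  assumes "a \<in> arcs D"
  obtains i u where "i \<in> strands" "u \<in> good i" "a = arc_at i u"
  using assms by (auto simp: arcs_def components_iff drawing_eq)

text \<open>The cut strands are finitely many pairwise disjoint compact sets, so they separate the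
  drawing and a connected set stays in one of them.\<close>

lemma arc_at_subset:
  assumes i: "i \<in> strands" and u: "u \<in> good i"
  shows "arc_at i u \<subseteq> plane D i ` good i"
proof -
  let ?K = "plane D i ` good i" and ?K' = "\<Union>j\<in>strands - {i}. plane D j ` good j"
  have closed: "closed ?K" "closed ?K'"
    using i by (auto intro!: compact_imp_closed strand_compact closed_UN)
  have disj: "?K \<inter> ?K' = {}" using strands_disjoint[OF i] by fastforce
  have "drawing D = ?K \<union> ?K'" using i by (auto simp: drawing_eq)
  then have sub: "arc_at i u \<subseteq> ?K \<union> ?K'" using connected_component_subset by metis
  have "plane D i u \<in> ?K \<inter> arc_at i u"
    using plane_in_drawing[OF i u] u by auto
  moreover have "?K \<inter> arc_at i u = {} \<or> ?K' \<inter> arc_at i u = {}"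
    using closed sub disj by (intro connected_closedD connected_connected_component) auto
  ultimately have "?K' \<inter> arc_at i u = {}" by blast
  with sub show ?thesis by blast
qed

lemma arc_at_connected_strand:
  assumes i: "i \<in> strands" and u: "u \<in> good i" and c: "connected (plane D i ` good i)"
  shows "arc_at i u = plane D i ` good i"
proof
  show "plane D i ` good i \<subseteq> arc_at i u"
    using i u c by (intro connected_component_maximal) (auto simp: drawing_eq)
qed (rule arc_at_subset[OF i u])

text \<open>Consecutive underpasses are more than twice the gap apart, so no arc degenerates to a point.\<close>

lemma good_nontrivial:
  assumes u: "u \<in> good i"
  obtains v where "v \<noteq> u" "closed_segment u v \<subseteq> good i"
proof -
  define g where "g = gap D"
  have g: "g > 0" using gap_pos by (simp add: g_def)
  have far: "s \<le> u - g \<or> u + g \<le> s" if "underpass D i s" for s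
    using u that unfolding good_def g_def by fastforce
  have sep: "2 * g < \<bar>s - s'\<bar>" if "underpass D i s" "underpass D i s'" "s \<noteq> s'" for s s'
    using underpass_separated[OF that] by (simp add: g_def)
  let ?right = "\<lambda>s. underpass D i s \<and> u < s \<and> s < u + 2 * g"
    and ?left = "\<lambda>s. underpass D i s \<and> u - 2 * g < s \<and> s < u"
  consider "\<nexists>s. ?right s" | "\<nexists>s. ?left s" | "\<exists>s. ?right s" "\<exists>s. ?left s"
    by auto
  then show ?thesis
  proof cases
    case 1
    have "w \<in> good i" if w: "u \<le> w" "w \<le> u + g" for w
    proof -
      have "g \<le> \<bar>w - s\<bar>" if s: "underpass D i s" for s
        using far[OF s] 1 s w g by force
      then show ?thesis by (simp add: good_def g_def)
    qed
    then show ?thesis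
      using g by (intro that[of "u + g"]) (auto simp: closed_segment_eq_real_ivl)
  next
    case 2
    have "w \<in> good i" if w: "u - g \<le> w" "w \<le> u" for w
    proof -
      have "g \<le> \<bar>w - s\<bar>" if s: "underpass D i s" for s
        using far[OF s] 2 s w g by force
      then show ?thesis by (simp add: good_def g_def)
    qed
    then show ?thesis
      using g by (intro that[of "u - g"]) (auto simp: closed_segment_eq_real_ivl)
  next
    case 3
    then obtain s1 s2 where 3: "underpass D i s1" "u < s1" "s1 < u + 2 * g"
      "underpass D i s2" "u - 2 * g < s2" "s2 < u" by auto
    have "u + g \<le> s1" "s2 \<le> u - g" using far[OF 3(1)] far[OF 3(4)] 3 g by auto
    moreover have "2 * g < s1 - s2" using sep[OF 3(1,4)] 3 by auto
    \<comment> \<open>If equality held on both sides, \<open>s1\<close> and \<open>s2\<close> would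
      be exactly \<open>2 * g\<close> apart, against the strict separation.\<close>
    ultimately consider "u + g < s1" | "s2 < u - g" by linarith
    then show ?thesis
    proof cases
      case 1
      have "w \<in> good i" if w: "u \<le> w" "w \<le> s1 - g" for w
      proof -
        have "g \<le> \<bar>w - s\<bar>" if s: "underpass D i s" for s
          using far[OF s] sep[OF s 3(1)] 3 w g by (cases "s = s1") auto
        then show ?thesis by (simp add: good_def g_def)
      qed
      then show ?thesis
        using 1 by (intro that[of "s1 - g"]) (auto simp: closed_segment_eq_real_ivl)
    next
      case 2
      have "w \<in> good i" if w: "s2 + g \<le> w" "w \<le> u" for w
      proof -
        have "g \<le> \<bar>w - s\<bar>" if s: "underpass D i s" for s
          using far[OF s] sep[OF s 3(4)] 3 w g by (cases "s = s2") auto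
        then show ?thesis by (simp add: good_def g_def)
      qed
      then show ?thesis
        using 2 by (intro that[of "s2 + g"]) (auto simp: closed_segment_eq_real_ivl)
    qed
  qed
qed

text \<open>Uniqueness is the point. An arc in the image of a second strand would consist of
  crossings, hence be finite and, being connected, a single point. A whole segment of parameters
  would then map to one crossing, which has just two preimages.\<close>

lemma strand_of_arc_at:
  assumes i: "i \<in> strands" and u: "u \<in> good i"
  shows "strand_of D (arc_at i u) = i"
  unfolding strand_of_def
proof (rule the_equality)
  show "i \<in> strands \<and> arc_at i u \<subseteq> range (plane D i)"
    using i arc_at_subset[OF i u] by auto
  fix j assume j: "j \<in> strands \<and> arc_at i u \<subseteq> range (plane D j)"
  show "j = i"
  proof (rule ccontr)
    assume "j \<noteq> i"
    have "arc_at i u \<subseteq> crossings D"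
    proof
      fix q assume q: "q \<in> arc_at i u"
      then obtain w v where wv: "q = plane D i w" "q = plane D j v"
        using arc_at_subset[OF i u] j by blast
      then have "underpass D i w \<or> underpass D j v"
        using i j \<open>j \<noteq> i\<close> by (intro meeting_strands_underpass) auto
      then show "q \<in> crossings D" using wv unfolding crossings_def by blast
    qed
    then have "finite (arc_at i u)"
      using regular by (auto simp: regular_diagram_def intro: finite_subset)
    moreover have "connected (arc_at i u)" by (rule connected_connected_component)
    ultimately have "arc_at i u = {} \<or> (\<exists>x. arc_at i u = {x})"
      by (simp add: connected_finite_iff_sing)
    moreover have mem: "plane D i u \<in> arc_at i u" using plane_in_drawing[OF i u] by simp
    ultimately have sing: "arc_at i u = {plane D i u}" by (metis empty_iff singletonD)
    have q: "plane D i u \<in> crossings D"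
      using \<open>arc_at i u \<subseteq> crossings D\<close> mem by blast
    obtain v where v: "v \<noteq> u" "closed_segment u v \<subseteq> good i" by (rule good_nontrivial[OF u])
    have "plane D i ` closed_segment u v \<subseteq> arc_at i u"
    proof (rule connected_component_maximal)
      show "connected (plane D i ` closed_segment u v)"
        by (intro connected_continuous_image plane_continuous i connected_segment)
      show "plane D i ` closed_segment u v \<subseteq> drawing D"
        using v(2) plane_in_drawing[OF i] by blast
    qed simp
    then have same: "plane D i w = plane D i u" if "w \<in> closed_segment u v" for w
      using sing \<open>plane D i ` closed_segment u v \<subseteq> arc_at i u\<close> that by blast
    \<comment> \<open>The radius 1/4 keeps the parameters less than a period apart, so distinct ones
      remain distinct under \<open>frac\<close>.\<close>
    define I where "I = closed_segment u v \<inter> {u - 1/4..u + 1/4}"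
    have "inj_on (\<lambda>w. (i, frac w)) I"
    proof (rule inj_onI)
      fix w w' assume w: "w \<in> I" "w' \<in> I" "(i, frac w) = (i, frac w')"
      then have "\<bar>w - w'\<bar> < 1" by (auto simp: I_def)
      moreover have "w - w' = of_int (\<lfloor>w\<rfloor> - \<lfloor>w'\<rfloor>)" using w(3) by (simp add: frac_def)
      ultimately have "\<bar>\<lfloor>w\<rfloor> - \<lfloor>w'\<rfloor>\<bar> < 1" by linarith
      then have fl: "\<lfloor>w\<rfloor> = \<lfloor>w'\<rfloor>" by linarith
      have "frac w = frac w'" using w(3) by (rule Pair_inject)
      then show "w = w'" unfolding frac_def fl by simp
    qed
    moreover have "(\<lambda>w. (i, frac w)) ` I \<subseteq> preimage (plane D i u)"
    proof (rule image_subsetI)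
      fix w assume "w \<in> I"
      then have "plane D i w = plane D i u" using same unfolding I_def by blast
      then show "(i, frac w) \<in> preimage (plane D i u)" using preimage_frac[OF i, of w] by metis
    qed
    moreover have "finite (preimage (plane D i u))"
      using preimage_card[OF q] by (auto intro: card_ge_0_finite)
    ultimately have "finite I" by (rule inj_on_finite)
    moreover have "infinite I"
    proof (cases "u < v")
      case True
      then have "{u..min v (u + 1/4)} \<subseteq> I" by (auto simp: I_def closed_segment_eq_real_ivl)
      moreover have "infinite {u..min v (u + 1/4)}" using True by (intro infinite_Icc) auto
      ultimately show ?thesis using finite_subset by blast
    next
      case False
      then have "{max v (u - 1/4)..u} \<subseteq> I" by (auto simp: I_def closed_segment_eq_real_ivl)
      moreover have "infinite {max v (u - 1/4)..u}" using False v(1) by (intro infinite_Icc) auto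
      ultimately show ?thesis using finite_subset by blast
    qed
    ultimately show False by blast
  qed
qed

lemma finite_arcs: "finite (arcs D)"
proof -
  let ?G = "\<lambda>i. good i \<inter> {0..1}"
  have "\<exists>\<C>. finite \<C> \<and> (\<forall>I\<in>\<C>. connected I) \<and> ?G i = \<Union>\<C>" for i
  proof -
    \<comment> \<open>Only underpasses in this window can remove a parameter from the unit
      interval.\<close>
    let ?U = "{s. underpass D i s} \<inter> {- gap D..1 + gap D}"
    have "finite ?U"
      using gap_pos underpass_separated by (intro finite_bounded_separated[of "2 * gap D"]) auto
    moreover have "?G i = {0..1} - (\<Union>s\<in>?U. ball s (gap D))"
    proof -
      have "u \<in> good i \<longleftrightarrow> u \<notin> (\<Union>s\<in>?U. ball s (gap D))" if "u \<in> {0..1}" for u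
        using that by (force simp: good_def dist_real_def not_less)
      then show ?thesis by blast
    qed
    ultimately show ?thesis using interval_minus_balls by metis
  qed
  then obtain \<C> where \<C>: "\<And>i. finite (\<C> i)" "\<And>i I. I \<in> \<C> i \<Longrightarrow> connected I"
    "\<And>i. ?G i = \<Union>(\<C> i)" by metis
  have flatten: "(\<Union>i\<in>A. \<Union>(B i)) = \<Union>(\<Union>i\<in>A. B i)" for A :: "nat set" and B :: "nat \<Rightarrow> (real \<times> real) set set"
    by blast
  have "drawing D = (\<Union>i\<in>strands. plane D i ` \<Union>(\<C> i))"
    unfolding drawing_eq \<C>(3)[symmetric] using good_unit_interval by simp
  then have "drawing D = \<Union>(\<Union>i\<in>strands. (`) (plane D i) ` \<C> i)"
    unfolding image_Union flatten .
  moreover have "connected J" if "J \<in> (\<Union>i\<in>strands. (`) (plane D i) ` \<C> i)" for J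
    using that \<C>(2) by (auto intro!: connected_continuous_image plane_continuous)
  ultimately show ?thesis
    unfolding arcs_def using \<C>(1) by (simp only:) (rule finite_components_Union, auto)
qed

text \<open>The two preimages of a crossing are determined as a set, and their heights tell which
  one is the underpass. Hence the unique description is meaningful.\<close>

lemma crossing_data_eq:
  assumes c: "c \<in> crossings D"
  obtains i s j u where "crossing_data D c = ((i, s), (j, u))" "s \<in> {0..<1}" "u \<in> {0..<1}"
    "passes_under D i s j u" "plane D i s = c"
proof -
  obtain i0 s0 j0 u0 where 0: "passes_under D i0 s0 j0 u0" "plane D i0 s0 = c"
    using c by (auto simp: crossings_def underpass_def)
  define i s j u where "i = i0" "s = frac s0" "j = j0" "u = frac u0"
  have su: "s \<in> {0..<1}" "u \<in> {0..<1}" "passes_under D i s j u" "plane D i s = c"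
    using passes_under_frac[OF 0(1)] 0(2) passes_underD(1)[OF 0(1)]
    by (auto simp: i_s_j_u_def frac_lt_1 plane_frac)
  let ?P = "\<lambda>((i, s), (j, u)). s \<in> {0..<1::real} \<and> u \<in> {0..<1::real} \<and>
    passes_under D i s j u \<and> plane D i s = c"
  have fin: "finite (preimage c)" and card: "card (preimage c) = 2"
    using preimage_card[OF c] by (auto intro: card_ge_0_finite)
  have P: "(i', s') \<noteq> (j', u') \<and> preimage c = {(i', s'), (j', u')} \<and> height D i' s' < height D j' u'"
    if "?P ((i', s'), (j', u'))" for i' s' j' u'
  proof -
    have *: "(i', s') \<noteq> (j', u')" "height D i' s' < height D j' u'"
      "{(i', s'), (j', u')} \<subseteq> preimage c"
      using that by (auto simp: passes_under_def preimage_def)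
    then have "{(i', s'), (j', u')} = preimage c"
      using card fin by (intro card_subset_eq) auto
    with * show ?thesis by auto
  qed
  have "(THE x. ?P x) = ((i, s), (j, u))"
  proof (rule the_equality)
    show "?P ((i, s), (j, u))" using su by simp
    fix x assume x: "?P x"
    obtain i' s' j' u' where x': "x = ((i', s'), (j', u'))" by (metis surj_pair)
    show "x = ((i, s), (j, u))"
      using P[of i s j u] P[of i' s' j' u'] su x unfolding x' by (auto simp: doubleton_eq_iff)
  qed
  then have "crossing_data D c = ((i, s), (j, u))"
    unfolding crossing_data_def .
  then show ?thesis using su by (intro that)
qed

text \<open>The sign of the crossing decides which of \<open>w\<close> and \<open>w'\<close> is
  \<open>s - gap D\<close> and which is \<open>s + gap D\<close>; in both cases the two arcs start
  at good parameters of the under strand \<open>i\<close>.\<close>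

lemma crossing_arcs_at:
  assumes c: "c \<in> crossings D"
  obtains i s j u w w' where "passes_under D i s j u" "plane D i s = c"
    "u \<in> good j" "w \<in> good i" "w' \<in> good i"
    "over_arc D c = arc_at j u" "right_arc D c = arc_at i w" "left_arc D c = arc_at i w'"
proof -
  obtain i s j u where d: "crossing_data D c = ((i, s), (j, u))" "s \<in> {0..<1}" "u \<in> {0..<1}"
    "passes_under D i s j u" "plane D i s = c"
    by (rule crossing_data_eq[OF c])
  have "over_arc D c = arc_at j u"
    using d(4,5) by (simp add: over_arc_def passes_under_def)
  then show ?thesis
    using d over_good[OF d(4)] beside_underpass_good[OF passes_underD(5)[OF d(4)]]
    by (intro that[of i s j u
          "if cross2 (velocity D j u) (velocity D i s) > 0 then s - gap D else s + gap D"
          "if cross2 (velocity D j u) (velocity D i s) > 0 then s + gap D else s - gap D"])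
      (auto simp: right_arc_def left_arc_def)
qed

sublocale arc_diagram D
proof
  show "finite (arcs D)" by (rule finite_arcs)
  show "strand_of D a \<in> {1..num_strands D}" if "a \<in> arcs D" for a
    using that by (metis arcsE strand_of_arc_at)
  fix c assume c: "c \<in> crossings D"
  obtain i s j u w w' where d: "passes_under D i s j u"
    "u \<in> good j" "w \<in> good i" "w' \<in> good i"
    "over_arc D c = arc_at j u" "right_arc D c = arc_at i w" "left_arc D c = arc_at i w'"
    by (rule crossing_arcs_at[OF c])
  note s = passes_underD(1,2)[OF d(1)]
  show "over_arc D c \<in> arcs D \<and> right_arc D c \<in> arcs D \<and> left_arc D c \<in> arcs D"
    using d s by (auto intro!: arc_at_in_arcs)
  show "strand_of D (right_arc D c) = strand_of D (left_arc D c)"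
    using d s by (simp add: strand_of_arc_at)
qed

end


section \<open>Smooth curves\<close>

text \<open>The derivatives are the restrictions of the complex ones to the real line.\<close>

lemma smooth_regular_on_analytic:
  fixes f :: "real \<Rightarrow> 'a::euclidean_space"
  assumes coord: "\<And>b. b \<in> Basis \<Longrightarrow> \<exists>g. g analytic_on \<real> \<and> (\<forall>t. f t \<bullet> b = Re (g (of_real t)))"
    and regular: "\<And>t. \<not> (f has_vector_derivative 0) (at t)"
  shows "smooth_regular_on f S"
proof -
  obtain G where G: "\<And>b. b \<in> Basis \<Longrightarrow> G b analytic_on \<real>"
    "\<And>b t. b \<in> Basis \<Longrightarrow> f t \<bullet> b = Re (G b (of_real t))"
    using coord by metis
  define D where "D n t = (\<Sum>b\<in>Basis. Re ((deriv ^^ n) (G b) (of_real t)) *\<^sub>R b)" for n t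
  have D0: "D 0 = f"
  proof
    fix t
    have "D 0 t = (\<Sum>b\<in>Basis. (f t \<bullet> b) *\<^sub>R b)"
      unfolding D_def by (intro sum.cong) (simp_all add: G(2))
    then show "D 0 t = f t" by (simp add: euclidean_representation)
  qed
  have D: "(D n has_vector_derivative D (Suc n) t) (at t)" for n t
    unfolding D_def[abs_def]
  proof (rule has_vector_derivative_sum)
    fix b :: 'a assume "b \<in> Basis"
    then have "(deriv ^^ n) (G b) analytic_on \<real>" by (intro analytic_higher_deriv G)
    then have "(deriv ^^ n) (G b) field_differentiable (at (of_real t))"
      by (rule analytic_on_imp_differentiable_at) simp
    then have "((deriv ^^ n) (G b) has_field_derivative (deriv ^^ Suc n) (G b) (of_real t)) (at (of_real t))"
      by (simp add: field_differentiable_derivI)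
    then have "((\<lambda>t. (deriv ^^ n) (G b) (of_real t)) has_vector_derivative
        (deriv ^^ Suc n) (G b) (of_real t)) (at t)"
      by (rule has_vector_derivative_real_field)
    moreover have "bounded_linear (\<lambda>z. Re z *\<^sub>R b)"
      by (intro bounded_linear_scaleR_left bounded_linear_compose[OF bounded_linear_scaleR_left] bounded_linear_Re)
    ultimately show "((\<lambda>t. Re ((deriv ^^ n) (G b) (of_real t)) *\<^sub>R b) has_vector_derivative
        Re ((deriv ^^ Suc n) (G b) (of_real t)) *\<^sub>R b) (at t)"
      by (rule bounded_linear.has_vector_derivative[rotated])
  qed
  have "D 1 t \<noteq> 0" for t
    using D[of 0 t] regular[of t] by (auto simp: D0)
  then show ?thesis
    unfolding smooth_regular_on_def using D0 D has_vector_derivative_at_within by blast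
qed

lemma piecewise_smooth_loopI:
  assumes "\<And>t. f (t + 1) = f t" "smooth_regular_on f {0..1}"
  shows "piecewise_smooth_loop f"
  unfolding piecewise_smooth_loop_def
  using assms by (intro conjI allI exI[of _ "1::nat"] exI[of _ real]) auto


section \<open>A Hopf link and a split unknot\<close>

text \<open>
  Curves 0 and 1 form a Hopf link, whose two crossings lie on the vertical line of abscissa 1/2;
  curve 2 is far away from them.  The space curves are lifted to the sphere by the inverse
  stereographic projection.
\<close>

definition center :: "nat \<Rightarrow> real" where
  "center g = (if g = 0 then 0 else if g = 1 then 1 else 5)"

text \<open>Tilting curve 0 puts it above curve 1 at the upper crossing and below it at the lower
  one, which links the two circles.\<close>

definition slope :: "nat \<Rightarrow> real" where
  "slope g = (if g = 0 then 1 else 0)"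

definition curve_plane :: "nat \<Rightarrow> real \<Rightarrow> real \<times> real" where
  "curve_plane g t = (center g + cos (2 * pi * t), sin (2 * pi * t))"

definition curve_height :: "nat \<Rightarrow> real \<Rightarrow> real" where
  "curve_height g t = slope g * sin (2 * pi * t)"

text \<open>One plus the squared norm of the point in space, the denominator of inverse
  stereographic projection.\<close>

definition curve_denom :: "nat \<Rightarrow> real \<Rightarrow> real" where
  "curve_denom g t =
     (center g + cos (2 * pi * t))\<^sup>2 + (sin (2 * pi * t))\<^sup>2 + (slope g * sin (2 * pi * t))\<^sup>2 + 1"

definition curve :: "nat \<Rightarrow> real \<Rightarrow> real^4" where
  "curve g t = (\<chi> i. (if i = 1 then 2 * (center g + cos (2 * pi * t))
     else if i = 2 then 2 * sin (2 * pi * t)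
     else if i = 3 then 2 * (slope g * sin (2 * pi * t)) else curve_denom g t - 2) / curve_denom g t)"

text \<open>\<open>\<tau> i\<close> is the curve that carries the index \<open>i\<close>, so
  different numberings share all geometry.\<close>

definition hopf_link :: "(nat \<Rightarrow> nat) \<Rightarrow> link" where
  "hopf_link \<tau> = \<lparr>num_comps = 3, knot = \<lambda>i. curve (\<tau> i)\<rparr>"

text \<open>On each linked circle the two crossing parameters are 1/3 apart modulo 1; the doubled
  gap 1/6 is smaller.\<close>

definition hopf_diagram :: "(nat \<Rightarrow> nat) \<Rightarrow> diagram" where
  "hopf_diagram \<tau> = \<lparr>num_strands = 3, plane = \<lambda>i. curve_plane (\<tau> i),
     height = \<lambda>i. curve_height (\<tau> i), gap = 1/12\<rparr>"

lemma hopf_link_simps [simp]: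
  "num_comps (hopf_link \<tau>) = 3" "knot (hopf_link \<tau>) i = curve (\<tau> i)"
  by (simp_all add: hopf_link_def)

lemma hopf_diagram_simps [simp]:
  "num_strands (hopf_diagram \<tau>) = 3" "plane (hopf_diagram \<tau>) i = curve_plane (\<tau> i)"
  "height (hopf_diagram \<tau>) i = curve_height (\<tau> i)" "gap (hopf_diagram \<tau>) = 1/12"
  by (simp_all add: hopf_diagram_def)

lemma curve_denom_pos: "curve_denom g t > 0"
  unfolding curve_denom_def by (intro add_nonneg_pos add_nonneg_nonneg) auto

lemma curve_nth:
  "curve g t $ 1 = 2 * (center g + cos (2 * pi * t)) / curve_denom g t"
  "curve g t $ 2 = 2 * sin (2 * pi * t) / curve_denom g t"
  "curve g t $ 3 = 2 * (slope g * sin (2 * pi * t)) / curve_denom g t"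
  "curve g t $ 4 = (curve_denom g t - 2) / curve_denom g t"
  by (simp_all add: curve_def)

lemma curve_minus: "1 - curve g t $ 4 = 2 / curve_denom g t"
  using curve_denom_pos[of g t] by (simp add: curve_nth field_simps)

lemma curve_pole: "curve g t $ 4 \<noteq> 1"
  using curve_minus[of g t] curve_denom_pos[of g t] by auto

lemma curve_stereo:
  "stereo_plane (curve g t) = curve_plane g t" "stereo_height (curve g t) = curve_height g t"
  using curve_denom_pos[of g t]
  by (simp_all add: stereo_plane_def stereo_height_def curve_minus curve_nth(1,2,3)
      curve_plane_def curve_height_def)

lemma curve_sphere: "curve g t \<in> sphere 0 1"
proof -
  define a b c where "a = center g + cos (2 * pi * t)" "b = sin (2 * pi * t)"
    "c = slope g * sin (2 * pi * t)"
  define q where "q = curve_denom g t"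
  have q: "q > 0" "q = a\<^sup>2 + b\<^sup>2 + c\<^sup>2 + 1"
    using curve_denom_pos[of g t] by (simp_all add: q_def curve_denom_def a_b_c_def)
  have "(2 * a)\<^sup>2 + (2 * b)\<^sup>2 + (2 * c)\<^sup>2 + (q - 2)\<^sup>2 = q\<^sup>2"
    unfolding q(2) by (simp add: power2_eq_square algebra_simps)
  then have "(2 * a / q)\<^sup>2 + (2 * b / q)\<^sup>2 + (2 * c / q)\<^sup>2 + ((q - 2) / q)\<^sup>2 = 1"
    using q(1) by (simp add: power_divide flip: add_divide_distrib)
  then show ?thesis
    unfolding real4_sphere_iff curve_nth a_b_c_def q_def .
qed

lemma trig_period: "cos (2 * pi * (t + 1)) = cos (2 * pi * t)" "sin (2 * pi * (t + 1)) = sin (2 * pi * t)"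
  using cos_periodic[of "2 * pi * t"] sin_periodic[of "2 * pi * t"] by (simp_all add: algebra_simps)

lemma curve_plane_has_vector_derivative:
  "(curve_plane g has_vector_derivative (- 2 * pi * sin (2 * pi * t), 2 * pi * cos (2 * pi * t))) (at t)"
  unfolding curve_plane_def[abs_def]
  by (auto intro!: derivative_eq_intros has_vector_derivative_Pair
      simp: has_real_derivative_iff_has_vector_derivative[symmetric])

lemma curve_plane_regular: "\<not> (curve_plane g has_vector_derivative 0) (at t)"
proof
  assume "(curve_plane g has_vector_derivative 0) (at t)"
  then have "(- 2 * pi * sin (2 * pi * t), 2 * pi * cos (2 * pi * t)) = 0"
    using curve_plane_has_vector_derivative vector_derivative_unique_at by blast
  then have "sin (2 * pi * t) = 0 \<and> cos (2 * pi * t) = 0" by (simp add: zero_prod_def)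
  then show False using sin_cos_squared_add[of "2 * pi * t"] by simp
qed

text \<open>A vanishing velocity on the sphere would survive stereographic projection, but the
  projected circle never stops. This spares differentiating the quotients that define
  \<open>curve\<close>.\<close>

lemma curve_regular: "\<not> (curve g has_vector_derivative 0) (at t)"
proof
  assume c: "(curve g has_vector_derivative 0) (at t)"
  have nth: "((\<lambda>t. curve g t $ i) has_real_derivative 0) (at t)" for i
    using bounded_linear.has_vector_derivative[OF bounded_linear_vec_nth c, of i]
    by (simp add: has_real_derivative_iff_has_vector_derivative)
  have "((\<lambda>t. curve g t $ i / (1 - curve g t $ 4)) has_real_derivative 0) (at t)" for i
    using curve_pole[of g t]
    by (auto intro!: derivative_eq_intros nth)
  then have "((\<lambda>t. stereo_plane (curve g t)) has_vector_derivative (0, 0)) (at t)"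
    unfolding stereo_plane_def
    by (intro has_vector_derivative_Pair) (simp_all add: has_real_derivative_iff_has_vector_derivative)
  then show False
    using curve_plane_regular[of g t] by (simp add: curve_stereo zero_prod_def)
qed

lemma curve_plane_loop: "piecewise_smooth_loop (curve_plane g)"
proof (rule piecewise_smooth_loopI)
  show "smooth_regular_on (curve_plane g) {0..1}"
  proof (rule smooth_regular_on_analytic)
    fix b :: "real \<times> real" assume "b \<in> Basis"
    then consider "b = (1, 0)" | "b = (0, 1)" by (auto simp: Basis_prod_def)
    then show "\<exists>h. h analytic_on \<real> \<and> (\<forall>t. curve_plane g t \<bullet> b = Re (h (of_real t)))"
    proof cases
      case 1
      have "(\<lambda>z. of_real (center g) + cos (2 * of_real pi * z)) analytic_on \<real>"
        by (intro analytic_intros)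
      moreover have "of_real (center g) + cos (2 * of_real pi * of_real t) =
          complex_of_real (center g + cos (2 * pi * t))" for t
        by (simp flip: cos_of_real)
      ultimately show ?thesis
        unfolding 1 by (intro exI[of _ "\<lambda>z. of_real (center g) + cos (2 * of_real pi * z)"])
          (simp add: curve_plane_def del: of_real_add)
    next
      case 2
      have "(\<lambda>z. sin (2 * of_real pi * z)) analytic_on \<real>"
        by (intro analytic_intros)
      moreover have "sin (2 * of_real pi * of_real t) = complex_of_real (sin (2 * pi * t))" for t
        by (simp flip: sin_of_real)
      ultimately show ?thesis
        unfolding 2 by (intro exI[of _ "\<lambda>z. sin (2 * of_real pi * z)"])
          (simp add: curve_plane_def)
    qed
  qed (rule curve_plane_regular)
qed (simp add: curve_plane_def trig_period)

lemma curve_loop: "piecewise_smooth_loop (curve g)"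
proof (rule piecewise_smooth_loopI)
  define x y z q :: "complex \<Rightarrow> complex" where
    "x = (\<lambda>w. of_real (center g) + cos (2 * of_real pi * w))" and
    "y = (\<lambda>w. sin (2 * of_real pi * w))" and
    "z = (\<lambda>w. of_real (slope g) * sin (2 * of_real pi * w))" and
    "q = (\<lambda>w. (x w)\<^sup>2 + (y w)\<^sup>2 + (z w)\<^sup>2 + 1)"
  have real: "x (of_real t) = of_real (center g + cos (2 * pi * t))"
    "y (of_real t) = of_real (sin (2 * pi * t))"
    "z (of_real t) = of_real (slope g * sin (2 * pi * t))" for t
    by (simp_all add: x_def y_def z_def flip: cos_of_real sin_of_real)
  have q: "q (of_real t) = of_real (curve_denom g t)" for t
    unfolding q_def real curve_denom_def by simp
  have an: "x analytic_on \<real>" "y analytic_on \<real>" "z analytic_on \<real>"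
    unfolding x_def y_def z_def by (intro analytic_intros)+
  then have anq: "q analytic_on \<real>" unfolding q_def by (intro analytic_intros)
  \<comment> \<open>The complex extension of the denominator may have zeros elsewhere; analyticity
    on the real line asks about real points only.\<close>
  have nz: "q w \<noteq> 0" if "w \<in> \<real>" for w
    using that q curve_denom_pos by (auto elim!: Reals_cases simp: less_le)
  have coord: "\<exists>h. h analytic_on \<real> \<and> (\<forall>t. curve g t \<bullet> axis k 1 = Re (h (of_real t)))"
    if "h analytic_on \<real>" "\<And>t. h (of_real t) = complex_of_real (curve g t $ k)" for h k
    using that by (intro exI[of _ h]) (simp add: inner_axis)
  show "smooth_regular_on (curve g) {0..1}"
  proof (rule smooth_regular_on_analytic)
    fix b :: "real^4" assume "b \<in> Basis"
    then obtain i where b: "b = axis i 1" by (auto simp: Basis_vec_def)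
    consider "i = 1" | "i = 2" | "i = 3" | "i = 4" using exhaust_4 by blast
    then show "\<exists>h. h analytic_on \<real> \<and> (\<forall>t. curve g t \<bullet> b = Re (h (of_real t)))"
    proof cases
      case 1
      show ?thesis
        unfolding b 1
        by (rule coord[of "\<lambda>w. 2 * x w / q w"]) (use an anq nz in \<open>auto intro!: analytic_intros simp: real q curve_nth\<close>)
    next
      case 2
      show ?thesis
        unfolding b 2
        by (rule coord[of "\<lambda>w. 2 * y w / q w"]) (use an anq nz in \<open>auto intro!: analytic_intros simp: real q curve_nth\<close>)
    next
      case 3
      show ?thesis
        unfolding b 3
        by (rule coord[of "\<lambda>w. 2 * z w / q w"]) (use an anq nz in \<open>auto intro!: analytic_intros simp: real q curve_nth\<close>)
    next
      case 4
      show ?thesis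
        unfolding b 4
        by (rule coord[of "\<lambda>w. (q w - 2) / q w"]) (use an anq nz in \<open>auto intro!: analytic_intros simp: real q curve_nth\<close>)
    qed
  qed (rule curve_regular)
qed (simp add: curve_def curve_denom_def trig_period vec_eq_iff)

section \<open>Where the plane curves meet\<close>

lemma trig_eq_iff:
  "cos (2 * pi * s) = cos (2 * pi * t) \<and> sin (2 * pi * s) = sin (2 * pi * t) \<longleftrightarrow>
     (\<exists>k::int. s = t + of_int k)"
proof -
  have "2 * pi * s = 2 * pi * t + 2 * pi * of_int k \<longleftrightarrow> s = t + of_int k" for k
    by (simp flip: distrib_left)
  then show ?thesis using sin_cos_eq_iff[of "2 * pi * s" "2 * pi * t"] by blast
qed

lemma trig_values:
  "cos (2 * pi * (1/6)) = 1/2" "sin (2 * pi * (1/6)) = sqrt 3 / 2"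
  "cos (2 * pi * (1/3)) = - 1/2" "sin (2 * pi * (1/3)) = sqrt 3 / 2"
  "cos (2 * pi * (2/3)) = - 1/2" "sin (2 * pi * (2/3)) = - sqrt 3 / 2"
  "cos (2 * pi * (5/6)) = 1/2" "sin (2 * pi * (5/6)) = - sqrt 3 / 2"
proof -
  have a: "2 * pi * (1/6) = pi/3" "2 * pi * (1/3) = 2 * pi/3"
    "2 * pi * (2/3) = - (2 * pi/3) + 2 * pi" "2 * pi * (5/6) = - (pi/3) + 2 * pi" by simp_all
  show "cos (2 * pi * (1/6)) = 1/2" "sin (2 * pi * (1/6)) = sqrt 3 / 2"
    "cos (2 * pi * (1/3)) = - 1/2" "sin (2 * pi * (1/3)) = sqrt 3 / 2"
    "cos (2 * pi * (2/3)) = - 1/2" "sin (2 * pi * (2/3)) = - sqrt 3 / 2"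
    "cos (2 * pi * (5/6)) = 1/2" "sin (2 * pi * (5/6)) = - sqrt 3 / 2"
    unfolding a cos_periodic sin_periodic cos_minus sin_minus
    by (simp_all only: cos_60 sin_60 cos_120 sin_120)
qed

lemma crossing_points:
  "curve_plane 0 (1/6) = (1/2, sqrt 3 / 2)" "curve_plane 0 (5/6) = (1/2, - sqrt 3 / 2)"
  "curve_plane 1 (1/3) = (1/2, sqrt 3 / 2)" "curve_plane 1 (2/3) = (1/2, - sqrt 3 / 2)"
  unfolding curve_plane_def trig_values by (simp_all add: center_def)

lemma sin_of_cos_half:
  assumes "cos x = 1/2 \<or> cos x = - 1/2"
  shows "sin x = sqrt 3 / 2 \<or> sin x = - sqrt 3 / 2"
proof -
  have "(cos x)\<^sup>2 = (1/2)\<^sup>2" by (subst power2_eq_iff) (use assms in simp)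
  then have "(sin x)\<^sup>2 = 1 - (1/2)\<^sup>2" using sin_cos_squared_add[of x] by linarith
  also have "\<dots> = (sqrt 3 / 2)\<^sup>2" by (simp add: power_divide)
  finally have "(sin x)\<^sup>2 = (sqrt 3 / 2)\<^sup>2" .
  then show ?thesis using power2_eq_iff[of "sin x" "sqrt 3 / 2"] by auto
qed

text \<open>Equal sines force equal or opposite cosines. Equal ones would make the centers agree,
  and opposite ones allow a distance of at most 2 between the centers; among 0, 1 and 5 this leaves
  only 0 and 1.\<close>

lemma curve_plane_meet:
  assumes eq: "curve_plane g s = curve_plane h u" and gh: "g \<noteq> h" "g \<in> {0,1,2}" "h \<in> {0,1,2}"
  shows "(g = 0 \<and> h = 1 \<and> cos (2 * pi * s) = 1/2 \<and> cos (2 * pi * u) = - 1/2) \<or>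
    (g = 1 \<and> h = 0 \<and> cos (2 * pi * s) = - 1/2 \<and> cos (2 * pi * u) = 1/2)"
proof -
  let ?c = "cos (2 * pi * s)" and ?d = "cos (2 * pi * u)"
  have c: "center g + ?c = center h + ?d" and sn: "sin (2 * pi * s) = sin (2 * pi * u)"
    using eq by (auto simp: curve_plane_def)
  have "?c\<^sup>2 = ?d\<^sup>2"
    using sin_cos_squared_add[of "2 * pi * s"] sin_cos_squared_add[of "2 * pi * u"]
    unfolding sn by linarith
  then have "?c = ?d \<or> ?c = - ?d" by (rule power2_eq_iff[THEN iffD1])
  moreover have "(g = 0 \<and> h = 1 \<and> x = 1/2 \<and> y = - 1/2) \<or> (g = 1 \<and> h = 0 \<and> x = - 1/2 \<and> y = 1/2)"
    if "center g + x = center h + y" "x = y \<or> x = - y" "- 1 \<le> x" "x \<le> 1" for x y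
    using that gh by (auto simp: center_def split: if_splits)
  ultimately show ?thesis using c cos_ge_minus_one cos_le_one by blast
qed

text \<open>The parameters of the underpasses of the curve \<^term>\<open>g\<close>.\<close>

definition curve_under :: "nat \<Rightarrow> real \<Rightarrow> bool" where
  "curve_under g s \<longleftrightarrow>
     g = 0 \<and> (\<exists>k::int. s = 5/6 + of_int k) \<or> g = 1 \<and> (\<exists>k::int. s = 1/3 + of_int k)"

lemma curve_under_trig:
  "curve_under g s \<longleftrightarrow>
     g = 0 \<and> cos (2 * pi * s) = 1/2 \<and> sin (2 * pi * s) = - sqrt 3 / 2 \<or>
     g = 1 \<and> cos (2 * pi * s) = - 1/2 \<and> sin (2 * pi * s) = sqrt 3 / 2"
  unfolding curve_under_def trig_eq_iff[symmetric] trig_values by auto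

lemma curve_under_plane:
  assumes "curve_under g s"
  shows "curve_plane g s \<in> {(1/2, sqrt 3 / 2), (1/2, - sqrt 3 / 2)}" "g \<in> {0, 1}"
  using assms unfolding curve_under_trig by (auto simp: curve_plane_def center_def)

lemma curve_through_crossing:
  assumes q: "curve_plane g s \<in> {(1/2, sqrt 3 / 2), (1/2, - sqrt 3 / 2)}"
  shows "g = 0 \<and> (\<exists>k::int. s = 1/6 + of_int k \<or> s = 5/6 + of_int k) \<or>
    g = 1 \<and> (\<exists>k::int. s = 1/3 + of_int k \<or> s = 2/3 + of_int k)"
proof -
  have c: "center g + cos (2 * pi * s) = 1/2"
    and sn: "sin (2 * pi * s) = sqrt 3 / 2 \<or> sin (2 * pi * s) = - sqrt 3 / 2"
    using q by (auto simp: curve_plane_def)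
  have "g = 0 \<and> x = 1/2 \<or> g = 1 \<and> x = - 1/2" if "center g + x = 1/2" "- 1 \<le> x" for x
    using that by (auto simp: center_def split: if_splits)
  from this[OF c cos_ge_minus_one]
  consider "g = 0" "cos (2 * pi * s) = 1/2" | "g = 1" "cos (2 * pi * s) = - 1/2"
    by blast
  then show ?thesis
    using sn trig_eq_iff[of s "1/6"] trig_eq_iff[of s "5/6"] trig_eq_iff[of s "1/3"]
      trig_eq_iff[of s "2/3"]
    unfolding trig_values by cases auto
qed

section \<open>The example with an arbitrary numbering\<close>

locale hopf =
  fixes \<tau> :: "nat \<Rightarrow> nat"
  assumes bij: "bij_betw \<tau> {1..3} {0, 1, 2}"
begin

lemma \<tau>_mem: "i \<in> {1..3} \<Longrightarrow> \<tau> i \<in> {0, 1, 2}"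
  by (rule bij_betw_apply[OF bij])

lemma \<tau>_inj: "i \<in> {1..3} \<Longrightarrow> j \<in> {1..3} \<Longrightarrow> \<tau> i = \<tau> j \<Longrightarrow> i = j"
  using bij_betw_imp_inj_on[OF bij] by (meson inj_onD)

lemma \<tau>_surj: "g \<in> {0, 1, 2} \<Longrightarrow> \<exists>i\<in>{1..3}. \<tau> i = g"
  using bij_betw_imp_surj_on[OF bij] by (metis imageE)

lemma passes_under_iff:
  "passes_under (hopf_diagram \<tau>) i s j u \<longleftrightarrow> i \<in> {1..3} \<and> j \<in> {1..3} \<and> curve_under (\<tau> i) s \<and>
     \<tau> j = 1 - \<tau> i \<and> curve_plane (\<tau> i) s = curve_plane (\<tau> j) u"
proof
  assume p: "passes_under (hopf_diagram \<tau>) i s j u"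
  then have ij: "i \<in> {1..3}" "j \<in> {1..3}" "curve_plane (\<tau> i) s = curve_plane (\<tau> j) u"
    and h: "curve_height (\<tau> i) s < curve_height (\<tau> j) u"
    by (auto simp: passes_under_def)
  have sn: "sin (2 * pi * s) = sin (2 * pi * u)" using ij(3) by (simp add: curve_plane_def)
  have "\<tau> i \<noteq> \<tau> j"
    using h sn by (auto simp: curve_height_def)
  then have "(\<tau> i = 0 \<and> \<tau> j = 1 \<and> cos (2 * pi * s) = 1/2) \<or>
    (\<tau> i = 1 \<and> \<tau> j = 0 \<and> cos (2 * pi * s) = - 1/2)"
    using curve_plane_meet[OF ij(3)] \<tau>_mem ij by blast
  moreover from this have "sin (2 * pi * s) = sqrt 3 / 2 \<or> sin (2 * pi * s) = - sqrt 3 / 2"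
    by (intro sin_of_cos_half) auto
  moreover have "0 < sqrt 3 / 2" "- sqrt 3 / 2 < 0" by simp_all
  ultimately have "curve_under (\<tau> i) s \<and> \<tau> j = 1 - \<tau> i"
    using h unfolding curve_under_trig curve_height_def slope_def sn
    by (elim disjE) (simp_all del: zero_less_divide_iff divide_less_0_iff real_sqrt_gt_0_iff)
  with ij show "i \<in> {1..3} \<and> j \<in> {1..3} \<and> curve_under (\<tau> i) s \<and>
     \<tau> j = 1 - \<tau> i \<and> curve_plane (\<tau> i) s = curve_plane (\<tau> j) u" by blast
next
  assume *: "i \<in> {1..3} \<and> j \<in> {1..3} \<and> curve_under (\<tau> i) s \<and>
     \<tau> j = 1 - \<tau> i \<and> curve_plane (\<tau> i) s = curve_plane (\<tau> j) u"
  then have cu: "curve_under (\<tau> i) s" "\<tau> j = 1 - \<tau> i" by auto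
  from * have sn: "sin (2 * pi * u) = sin (2 * pi * s)" by (simp add: curve_plane_def)
  from cu(1) have "curve_height (\<tau> i) s < curve_height (\<tau> j) u"
    unfolding curve_under_trig
  proof (elim disjE conjE)
    assume "\<tau> i = 0" "sin (2 * pi * s) = - sqrt 3 / 2"
    then show ?thesis using cu(2) by (simp add: curve_height_def slope_def)
  next
    assume \<tau>: "\<tau> i = 1" and s: "sin (2 * pi * s) = sqrt 3 / 2"
    have "0 < sin (2 * pi * u)" unfolding sn s by simp
    then show ?thesis using \<tau> cu(2) by (simp add: curve_height_def slope_def)
  qed
  with * show "passes_under (hopf_diagram \<tau>) i s j u" by (auto simp: passes_under_def)
qed

lemma underpass_iff: "underpass (hopf_diagram \<tau>) i s \<longleftrightarrow> i \<in> {1..3} \<and> curve_under (\<tau> i) s"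
proof
  assume *: "i \<in> {1..3} \<and> curve_under (\<tau> i) s"
  then have "\<tau> i \<in> {0, 1}" using curve_under_plane(2) by blast
  then obtain j where j: "j \<in> {1..3}" "\<tau> j = 1 - \<tau> i" using \<tau>_surj[of "1 - \<tau> i"] by auto
  have "\<exists>u. curve_plane (\<tau> i) s = curve_plane (\<tau> j) u"
  proof (cases "\<tau> i = 0")
    case True
    then have "curve_plane (\<tau> i) s = (1/2, - sqrt 3 / 2)"
      using * by (simp add: curve_under_trig curve_plane_def center_def)
    moreover have "\<tau> j = 1" using True j(2) by simp
    ultimately show ?thesis by (metis crossing_points(4))
  next
    case False
    then have "\<tau> i = 1" "\<tau> j = 0" using \<open>\<tau> i \<in> {0, 1}\<close> j(2) by auto
    moreover from this have "curve_plane (\<tau> i) s = (1/2, sqrt 3 / 2)"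
      using * by (simp add: curve_under_trig curve_plane_def center_def)
    ultimately show ?thesis by (metis crossing_points(1))
  qed
  then show "underpass (hopf_diagram \<tau>) i s"
    unfolding underpass_def passes_under_iff using * j by blast
qed (auto simp: underpass_def passes_under_iff)

lemma crossings_eq: "crossings (hopf_diagram \<tau>) = {curve_plane g s | g s. curve_under g s}"
proof
  show "crossings (hopf_diagram \<tau>) \<subseteq> {curve_plane g s | g s. curve_under g s}"
    unfolding crossings_def underpass_iff hopf_diagram_simps by blast
  show "{curve_plane g s | g s. curve_under g s} \<subseteq> crossings (hopf_diagram \<tau>)"
  proof
    fix q assume "q \<in> {curve_plane g s | g s. curve_under g s}"
    then obtain g s where gs: "q = curve_plane g s" "curve_under g s" by blast
    then have "g \<in> {0, 1, 2}" using curve_under_plane(2)[of g s] by blast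
    then obtain i where "i \<in> {1..3}" "\<tau> i = g" using \<tau>_surj by blast
    then have "underpass (hopf_diagram \<tau>) i s" "q = plane (hopf_diagram \<tau>) i s"
      using gs by (simp_all add: underpass_iff)
    then show "q \<in> crossings (hopf_diagram \<tau>)" unfolding crossings_def by blast
  qed
qed

lemma crossings_subset: "crossings (hopf_diagram \<tau>) \<subseteq> {(1/2, sqrt 3 / 2), (1/2, - sqrt 3 / 2)}"
  unfolding crossings_eq using curve_under_plane(1) by blast

lemma crossing_preimage:
  assumes q: "q \<in> crossings (hopf_diagram \<tau>)"
  shows "card {(i, s). i \<in> {1..3} \<and> s \<in> {0..<1} \<and> curve_plane (\<tau> i) s = q} = 2"
proof -
  obtain a where a: "a \<in> {1..3}" "\<tau> a = 0" using \<tau>_surj[of 0] by blast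
  obtain b where b: "b \<in> {1..3}" "\<tau> b = 1" using \<tau>_surj[of 1] by blast
  note ab = a b
  have "a \<noteq> b" using a(2) b(2) by auto
  let ?P = "{(i, s). i \<in> {1..3} \<and> s \<in> {0..<1} \<and> curve_plane (\<tau> i) s = q}"
  have par: "s = v" if "s \<in> {0..<1}" "v \<in> {0..<1}" "s = v + of_int k" for s v :: real and k :: int
  proof -
    have "k < 1" "k > - 1" using that by auto
    then show ?thesis using that by simp
  qed
  have P: "i = a \<and> (s = 1/6 \<or> s = 5/6) \<or> i = b \<and> (s = 1/3 \<or> s = 2/3)" if "(i, s) \<in> ?P" for i s
  proof -
    have *: "i \<in> {1..3}" "s \<in> {0..<1}" "curve_plane (\<tau> i) s \<in> {(1/2, sqrt 3 / 2), (1/2, - sqrt 3 / 2)}"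
      using that q crossings_subset by auto
    have ia: "\<tau> i = 0 \<Longrightarrow> i = a" and ib: "\<tau> i = 1 \<Longrightarrow> i = b"
      using \<tau>_inj[OF *(1)] ab by metis+
    have sv: "v \<in> {0..<1} \<Longrightarrow> s = v + of_int k \<Longrightarrow> s = v" for v k
      using par[OF *(2)] by blast
    have "1/6 \<in> {0..<1::real}" "5/6 \<in> {0..<1::real}" "1/3 \<in> {0..<1::real}" "2/3 \<in> {0..<1::real}"
      by simp_all
    with curve_through_crossing[OF *(3)] show ?thesis
      using ia ib sv by blast
  qed
  have vals: "curve_plane (\<tau> a) (1/6) = (1/2, sqrt 3 / 2)" "curve_plane (\<tau> a) (5/6) = (1/2, - sqrt 3 / 2)"
    "curve_plane (\<tau> b) (1/3) = (1/2, sqrt 3 / 2)" "curve_plane (\<tau> b) (2/3) = (1/2, - sqrt 3 / 2)"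
    unfolding ab by (rule crossing_points)+
  have ne: "sqrt 3 / 2 \<noteq> - sqrt 3 / 2" by simp
  consider "q = (1/2, sqrt 3 / 2)" | "q = (1/2, - sqrt 3 / 2)" using q crossings_subset by auto
  then show ?thesis
  proof cases
    case 1
    have eq: "?P = {(a, 1/6), (b, 1/3)}"
    proof (intro subset_antisym subsetI)
      fix p assume p: "p \<in> ?P"
      obtain i s where pe: "p = (i, s)" by (cases p)
      have "curve_plane (\<tau> i) s = q" using p pe by simp
      then have "\<not> (i = a \<and> s = 5/6)" "\<not> (i = b \<and> s = 2/3)"
        using vals(2,4) ne 1 by (metis Pair_inject)+
      then show "p \<in> {(a, 1/6), (b, 1/3)}"
        using P[of i s] p unfolding pe by blast
    qed (use ab vals 1 in auto)
    show ?thesis unfolding eq using \<open>a \<noteq> b\<close> by simp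
  next
    case 2
    have eq: "?P = {(a, 5/6), (b, 2/3)}"
    proof (intro subset_antisym subsetI)
      fix p assume p: "p \<in> ?P"
      obtain i s where pe: "p = (i, s)" by (cases p)
      have "curve_plane (\<tau> i) s = q" using p pe by simp
      then have "\<not> (i = a \<and> s = 1/6)" "\<not> (i = b \<and> s = 1/3)"
        using vals(1,3) ne 2 by (metis Pair_inject)+
      then show "p \<in> {(a, 5/6), (b, 2/3)}"
        using P[of i s] p unfolding pe by blast
    qed (use ab vals 2 in auto)
    show ?thesis unfolding eq using \<open>a \<noteq> b\<close> by simp
  qed
qed

text \<open>At a crossing the sines of the two parameters agree and the cosines are opposite, so the
  cross product is a nonzero multiple of sine times cosine, neither of which vanishes there.\<close>

lemma transverse:
  assumes p: "passes_under (hopf_diagram \<tau>) i s j u"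
  shows "cross2 (velocity (hopf_diagram \<tau>) j u) (velocity (hopf_diagram \<tau>) i s) \<noteq> 0"
proof -
  have p': "curve_under (\<tau> i) s" "\<tau> j = 1 - \<tau> i" "curve_plane (\<tau> i) s = curve_plane (\<tau> j) u"
    using p by (auto simp: passes_under_iff)
  have v: "velocity (hopf_diagram \<tau>) k t = (- 2 * pi * sin (2 * pi * t), 2 * pi * cos (2 * pi * t))" for k t
    unfolding hopf_diagram_simps by (rule vector_derivative_at) (rule curve_plane_has_vector_derivative)
  have e: "sin (2 * pi * u) = sin (2 * pi * s)" "cos (2 * pi * u) = - cos (2 * pi * s)"
    "cos (2 * pi * s) \<noteq> 0" "sin (2 * pi * s) \<noteq> 0"
    using p' unfolding curve_under_trig by (auto simp: curve_plane_def center_def)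
  have "cross2 (velocity (hopf_diagram \<tau>) j u) (velocity (hopf_diagram \<tau>) i s) =
      - 8 * pi\<^sup>2 * (sin (2 * pi * s) * cos (2 * pi * s))"
    unfolding v cross2_def e(1,2) by (simp add: power2_eq_square algebra_simps)
  then show ?thesis using e by simp
qed

lemma regular: "regular_diagram (hopf_diagram \<tau>)"
  unfolding regular_diagram_def
proof (intro conjI ballI allI impI)
  show "piecewise_smooth_loop (plane (hopf_diagram \<tau>) i)" for i
    by (simp add: curve_plane_loop)
  show "finite (crossings (hopf_diagram \<tau>))"
    using crossings_subset by (rule finite_subset) simp
  show "card {(i, s). i \<in> {1..num_strands (hopf_diagram \<tau>)} \<and> s \<in> {0..<1} \<and>
      plane (hopf_diagram \<tau>) i s = q} = 2" if "q \<in> crossings (hopf_diagram \<tau>)" for q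
    using crossing_preimage[OF that] by simp
  have d: "plane (hopf_diagram \<tau>) i differentiable (at s)" for i s
    unfolding hopf_diagram_simps using curve_plane_has_vector_derivative
    by (rule differentiableI_vector)
  show "plane (hopf_diagram \<tau>) i differentiable (at s)" "plane (hopf_diagram \<tau>) j differentiable (at u)"
    for i j s u by (rule d)+
qed (rule transverse)

lemma short_gap: "short_gap (hopf_diagram \<tau>)"
  unfolding short_gap_def hopf_diagram_simps
proof (intro conjI allI impI)
  fix i s u
  assume *: "underpass (hopf_diagram \<tau>) i s \<and> 0 < \<bar>u - s\<bar> \<and> \<bar>u - s\<bar> \<le> 2 * (1/12)"
  then have cu: "curve_under (\<tau> i) s" by (simp add: underpass_iff)
  \<comment> \<open>Relative to an underpass \<open>s\<close>, the crossing parameters of the same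
    circle are \<open>s\<close> and \<open>s + 1/3\<close> modulo 1, so none other than
    \<open>s\<close> itself lies within 1/6.\<close>
  have far: False if "u = s + of_int k \<or> u = s + 1/3 + of_int k" for k :: int
  proof -
    consider "k \<le> - 1" | "k = 0" | "k \<ge> 1" by linarith
    then show False
    proof cases
      case 1
      then have "real_of_int k \<le> - 1" by linarith
      then show False using that * by auto
    next
      case 3
      then have "real_of_int k \<ge> 1" by linarith
      then show False using that * by auto
    qed (use that * in auto)
  qed
  show "curve_plane (\<tau> i) u \<notin> crossings (hopf_diagram \<tau>)"
  proof
    assume "curve_plane (\<tau> i) u \<in> crossings (hopf_diagram \<tau>)"
    then have "curve_plane (\<tau> i) u \<in> {(1/2, sqrt 3 / 2), (1/2, - sqrt 3 / 2)}"
      using crossings_subset by blast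
    from curve_through_crossing[OF this] cu show False
      unfolding curve_under_def
    proof (elim disjE conjE exE)
      fix k l :: int
      assume "u = 1/6 + of_int k" "s = 5/6 + of_int l"
      \<comment> \<open>The shift by one comes from 1/6 = 5/6 + 1/3 - 1.\<close>
      then show False by (intro far[of "k - l - 1"]) simp
    next
      fix k l :: int
      assume "u = 5/6 + of_int k" "s = 5/6 + of_int l"
      then show False by (intro far[of "k - l"]) simp
    next
      fix k l :: int
      assume "u = 1/3 + of_int k" "s = 1/3 + of_int l"
      then show False by (intro far[of "k - l"]) simp
    next
      fix k l :: int
      assume "u = 2/3 + of_int k" "s = 1/3 + of_int l"
      then show False by (intro far[of "k - l"]) simp
    qed simp_all
  qed
qed simp

text \<open>Where two of the circles meet in the plane the sine is nonzero, and there the tilted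
  curve 0 and the horizontal curve 1 have different heights.\<close>

lemma curves_disjoint:
  assumes "g \<in> {0,1,2}" "h \<in> {0,1,2}" "g \<noteq> h"
  shows "curve g s \<noteq> curve h u"
proof
  assume "curve g s = curve h u"
  then have eq: "curve_plane g s = curve_plane h u" "curve_height g s = curve_height h u"
    by (metis curve_stereo)+
  have "cos (2 * pi * s) = 1/2 \<or> cos (2 * pi * s) = - 1/2" "g = 0 \<and> h = 1 \<or> g = 1 \<and> h = 0"
    using curve_plane_meet[OF eq(1)] assms by auto
  moreover from this have "sin (2 * pi * s) \<noteq> 0" using sin_of_cos_half by fastforce
  moreover have "sin (2 * pi * s) = sin (2 * pi * u)" using eq(1) by (simp add: curve_plane_def)
  ultimately show False using eq(2) by (auto simp: curve_height_def slope_def)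
qed

lemma is_link: "is_link (hopf_link \<tau>)"
  unfolding is_link_def hopf_link_simps
proof (intro conjI ballI impI)
  fix i
  show "inj_on (curve (\<tau> i)) {0..<1}"
  proof (rule inj_onI)
    fix s t :: real assume st: "s \<in> {0..<1}" "t \<in> {0..<1}" "curve (\<tau> i) s = curve (\<tau> i) t"
    have "curve_plane (\<tau> i) s = curve_plane (\<tau> i) t" using st(3) by (metis curve_stereo(1))
    then obtain k :: int where k: "s = t + of_int k"
      using trig_eq_iff[of s t] by (auto simp: curve_plane_def)
    then have "k < 1" "k > - 1" using st by auto
    then show "s = t" using k by simp
  qed
  show "range (curve (\<tau> i)) \<subseteq> sphere 0 1" using curve_sphere by blast
  show "range (curve (\<tau> i)) \<inter> range (curve (\<tau> j)) = {}"
    if "i \<in> {1..3}" "j \<in> {1..3}" "i \<noteq> j" for j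
    using that curves_disjoint[of "\<tau> i" "\<tau> j"] \<tau>_mem \<tau>_inj by blast
qed (simp_all add: curve_loop)

lemma diagram_of: "diagram_of (hopf_diagram \<tau>) (hopf_link \<tau>)"
  unfolding diagram_of_def
proof (intro conjI regular short_gap exI[of _ "mat 1"])
  show "rotation_matrix (mat 1 :: real^4^4)"
    by (simp add: rotation_matrix_def orthogonal_matrix_id det_I)
qed (auto simp: curve_pole curve_stereo)

sublocale link_diagram "hopf_diagram \<tau>" "hopf_link \<tau>"
  by unfold_locales (rule is_link diagram_of)+

end


section \<open>The Alexander modules of the example\<close>

text \<open>Stated per curve rather than per index, so that diagrams with different numberings have
  literally the same arcs.\<close>

definition curve_good :: "nat \<Rightarrow> real set" where
  "curve_good g = {u. \<forall>s. curve_under g s \<longrightarrow> 1/12 \<le> \<bar>u - s\<bar>}"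

definition curve_arc :: "nat \<Rightarrow> (real \<times> real) set" where
  "curve_arc g = curve_plane g ` curve_good g"

text \<open>With a single underpass per period, cutting leaves one interval: the period from
  \<open>s0 - 1\<close> to \<open>s0\<close>, shortened by 1/12 at both ends.\<close>

lemma curve_arc_from_underpass:
  fixes s0 :: real
  assumes under: "\<And>s. curve_under g s \<longleftrightarrow> (\<exists>k::int. s = s0 + of_int k)"
  shows "curve_arc g = curve_plane g ` {s0 - 11/12..s0 - 1/12}"
proof -
  have good: "u \<in> curve_good g \<longleftrightarrow> (\<forall>k::int. 1/12 \<le> \<bar>u - (s0 + of_int k)\<bar>)" for u
    unfolding curve_good_def under by blast
  have per: "curve_plane g (t + of_int k) = curve_plane g t" for t k
    by (rule periodic_of_int) (simp add: curve_plane_def trig_period)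
  show ?thesis
    unfolding curve_arc_def
  proof
    show "curve_plane g ` curve_good g \<subseteq> curve_plane g ` {s0 - 11/12..s0 - 1/12}"
    proof (rule image_subsetI)
      fix u assume u: "u \<in> curve_good g"
      \<comment> \<open>This shift moves \<open>u\<close> into the period between
        \<open>s0 - 1\<close> and \<open>s0\<close>.\<close>
      define k where "k = \<lfloor>u - s0\<rfloor> + 1"
      define v where "v = u + of_int (- k)"
      have v: "s0 - 1 \<le> v" "v < s0" unfolding v_def k_def by linarith+
      have "1/12 \<le> \<bar>u - (s0 + of_int k)\<bar>" "1/12 \<le> \<bar>u - (s0 + of_int (k - 1))\<bar>"
        using u unfolding good by blast+
      then have "1/12 \<le> \<bar>v - s0\<bar>" "1/12 \<le> \<bar>v - s0 + 1\<bar>"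
        by (simp_all add: v_def algebra_simps)
      with v have "v \<in> {s0 - 11/12..s0 - 1/12}" by auto
      moreover have "curve_plane g v = curve_plane g u" unfolding v_def by (rule per)
      ultimately show "curve_plane g u \<in> curve_plane g ` {s0 - 11/12..s0 - 1/12}" by (metis imageI)
    qed
    show "curve_plane g ` {s0 - 11/12..s0 - 1/12} \<subseteq> curve_plane g ` curve_good g"
    proof (rule image_mono, rule subsetI)
      fix u assume u: "u \<in> {s0 - 11/12..s0 - 1/12}"
      have "1/12 \<le> \<bar>u - (s0 + of_int k)\<bar>" for k :: int
      proof (cases "k \<le> - 1")
        case True
        then have "real_of_int k \<le> - 1" by linarith
        then show ?thesis using u by simp
      next
        case False
        then have "real_of_int k \<ge> 0" by linarith
        then show ?thesis using u by simp
      qed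
      then show "u \<in> curve_good g" unfolding good by blast
    qed
  qed
qed

lemma curve_arc_connected: "connected (curve_arc g)"
proof -
  have cont: "continuous_on S (curve_plane g)" for S
    using piecewise_smooth_loop_continuous[OF curve_plane_loop] continuous_on_subset by blast
  consider "g = 0" | "g = 1" | "g \<noteq> 0" "g \<noteq> 1" by blast
  then show ?thesis
  proof cases
    case 1
    then have "curve_arc g = curve_plane g ` {5/6 - 11/12..5/6 - 1/12}"
      by (intro curve_arc_from_underpass) (simp add: curve_under_def)
    then show ?thesis by (metis connected_continuous_image cont connected_Icc)
  next
    case 2
    then have "curve_arc g = curve_plane g ` {1/3 - 11/12..1/3 - 1/12}"
      by (intro curve_arc_from_underpass) (simp add: curve_under_def)
    then show ?thesis by (metis connected_continuous_image cont connected_Icc)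
  next
    case 3
    then have "curve_arc g = curve_plane g ` UNIV"
      by (simp add: curve_arc_def curve_good_def curve_under_def)
    then show ?thesis by (metis connected_continuous_image cont connected_UNIV)
  qed
qed

lemma curve_arc_nonempty: "curve_arc g \<noteq> {}"
proof -
  consider "g = 0" | "g = 1" | "g \<noteq> 0" "g \<noteq> 1" by blast
  then show ?thesis
  proof cases
    case 1
    then have "curve_arc g = curve_plane g ` {5/6 - 11/12..5/6 - 1/12}"
      by (intro curve_arc_from_underpass) (simp add: curve_under_def)
    then show ?thesis by simp
  next
    case 2
    then have "curve_arc g = curve_plane g ` {1/3 - 11/12..1/3 - 1/12}"
      by (intro curve_arc_from_underpass) (simp add: curve_under_def)
    then show ?thesis by simp
  next
    case 3
    then show ?thesis
      by (simp add: curve_arc_def curve_good_def curve_under_def)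
  qed
qed

text \<open>A positive second coordinate marks the upper crossing, where the tilted curve 0 is on
  top.\<close>

definition under_curve :: "real \<times> real \<Rightarrow> nat" where
  "under_curve c = (if snd c > 0 then 1 else 0)"

lemma under_curve_eq:
  assumes "curve_under g s"
  shows "under_curve (curve_plane g s) = g"
  using assms unfolding curve_under_trig
proof (elim disjE conjE)
  assume g: "g = 1" and s: "sin (2 * pi * s) = sqrt 3 / 2"
  have "0 < sin (2 * pi * s)" unfolding s by simp
  then show ?thesis by (simp add: g under_curve_def curve_plane_def)
qed (simp add: under_curve_def curve_plane_def)

section \<open>Arcs and crossings of the example\<close>

context hopf
begin

lemma strand_image:
  assumes "i \<in> {1..3}"
  shows "plane (hopf_diagram \<tau>) i ` good i = curve_arc (\<tau> i)"
proof -
  have "good i = curve_good (\<tau> i)"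
    using assms by (simp add: good_def curve_good_def underpass_iff)
  then show ?thesis by (simp add: curve_arc_def)
qed

lemma arc_at_eq:
  assumes "i \<in> {1..3}" "u \<in> good i"
  shows "arc_at i u = curve_arc (\<tau> i)"
  using arc_at_connected_strand[of i u] assms strand_image[OF assms(1)] curve_arc_connected
  by simp

lemma good_nonempty: "i \<in> {1..3} \<Longrightarrow> \<exists>u. u \<in> good i"
  using strand_image[of i] curve_arc_nonempty by fastforce

lemma arcs_eq: "arcs (hopf_diagram \<tau>) = curve_arc ` {0, 1, 2}"
proof
  show "arcs (hopf_diagram \<tau>) \<subseteq> curve_arc ` {0, 1, 2}"
  proof
    fix a assume "a \<in> arcs (hopf_diagram \<tau>)"
    then obtain i u where iu: "i \<in> {1..3}" "u \<in> good i" "a = arc_at i u"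
      by (metis arcsE hopf_diagram_simps(1))
    show "a \<in> curve_arc ` {0, 1, 2}"
      unfolding iu(3) arc_at_eq[OF iu(1,2)] by (intro imageI \<tau>_mem iu(1))
  qed
  show "curve_arc ` {0, 1, 2} \<subseteq> arcs (hopf_diagram \<tau>)"
  proof (rule image_subsetI)
    fix g :: nat assume "g \<in> {0, 1, 2}"
    then obtain i where i: "i \<in> {1..3}" "\<tau> i = g" using \<tau>_surj by blast
    obtain u where u: "u \<in> good i" using good_nonempty[OF i(1)] by blast
    then show "curve_arc g \<in> arcs (hopf_diagram \<tau>)"
      using arc_at_in_arcs[of i u] arc_at_eq[OF i(1) u] i by simp
  qed
qed

lemma strand_of_curve_arc:
  assumes i: "i \<in> {1..3}"
  shows "strand_of (hopf_diagram \<tau>) (curve_arc (\<tau> i)) = i"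
proof -
  obtain u where u: "u \<in> good i" using good_nonempty[OF i] by blast
  then show ?thesis using strand_of_arc_at[of i u] arc_at_eq[OF i u] i by simp
qed

text \<open>Each circle has at most one underpass per period, so it forms a single arc; in
  particular the right and left arcs of a crossing coincide.\<close>

lemma crossing_curve_arcs:
  assumes c: "c \<in> crossings (hopf_diagram \<tau>)"
  shows "over_arc (hopf_diagram \<tau>) c = curve_arc (1 - under_curve c)"
    "right_arc (hopf_diagram \<tau>) c = curve_arc (under_curve c)"
    "left_arc (hopf_diagram \<tau>) c = curve_arc (under_curve c)"
proof -
  obtain i s j u w w' where d: "passes_under (hopf_diagram \<tau>) i s j u"
    "plane (hopf_diagram \<tau>) i s = c" "u \<in> good j" "w \<in> good i" "w' \<in> good i"
    "over_arc (hopf_diagram \<tau>) c = arc_at j u" "right_arc (hopf_diagram \<tau>) c = arc_at i w"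
    "left_arc (hopf_diagram \<tau>) c = arc_at i w'"
    by (rule crossing_arcs_at[OF c])
  have p: "i \<in> {1..3}" "j \<in> {1..3}" "curve_under (\<tau> i) s" "\<tau> j = 1 - \<tau> i"
    using d(1) unfolding passes_under_iff by blast+
  have "under_curve c = \<tau> i" using under_curve_eq[OF p(3)] d(2) by simp
  then show "over_arc (hopf_diagram \<tau>) c = curve_arc (1 - under_curve c)"
    "right_arc (hopf_diagram \<tau>) c = curve_arc (under_curve c)"
    "left_arc (hopf_diagram \<tau>) c = curve_arc (under_curve c)"
    using d(3-8) p by (simp_all only: arc_at_eq)
qed

end

text \<open>The sequences are even equal: arcs and crossings are the same plane sets, and with a
  constant assignment of \<open>t\<close> the strand numbers disappear from the relators and from
  \<open>phi\<close>.\<close>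

lemma reduced_sequence_hopf:
  assumes "hopf \<tau>" "hopf \<tau>'"
  shows "reduced_link_module_sequence (hopf_diagram \<tau>) = reduced_link_module_sequence (hopf_diagram \<tau>')"
proof -
  interpret H: hopf \<tau> by fact
  interpret H': hopf \<tau>' by fact
  let ?R = "laurent_ring 1" and ?t = "\<lambda>i::nat. tvar 1"
  let ?D = "hopf_diagram \<tau>" and ?D' = "hopf_diagram \<tau>'"
  interpret R: cring ?R by (rule laurent_ring_cring)
  have t: "tvar 1 \<in> carrier ?R" by (rule tvar_closed) simp
  interpret A: alexander ?D ?R ?t by unfold_locales (rule t)
  interpret A': alexander ?D' ?R ?t by unfold_locales (rule t)
  have arcs: "arcs ?D = arcs ?D'" by (simp only: H.arcs_eq H'.arcs_eq)
  have cr: "crossings ?D = crossings ?D'" by (simp only: H.crossings_eq H'.crossings_eq)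
  have "crossing_relator ?R ?t ?D c = crossing_relator ?R ?t ?D' c" if "c \<in> crossings ?D" for c
    using that unfolding crossing_relator_def arcs
    by (simp only: H.crossing_curve_arcs H'.crossing_curve_arcs cr)
  then have "relations ?R (arcs ?D) (crossings ?D) (crossing_relator ?R ?t ?D) =
      relations ?R (arcs ?D) (crossings ?D) (crossing_relator ?R ?t ?D')"
    by (intro R.relations_cong A.relator_closed)
  then have "alexander_module ?R ?t ?D = alexander_module ?R ?t ?D'"
    unfolding A.alexander_module_eq A'.alexander_module_eq by (simp only: arcs cr)
  moreover have "phi ?R ?t ?D = phi ?R ?t ?D'"
    unfolding phi_def[abs_def] arcs ..
  ultimately show ?thesis unfolding reduced_link_module_sequence_def by simp
qed

lemma equivalent_sequences_refl: "equivalent_sequences R S S"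
  unfolding equivalent_sequences_def module_iso_def
  by (intro bexI[of _ id]) auto


text \<open>Evaluation at \<open>t\<^sub>3 = -1\<close> and \<open>t\<^sub>i = 1\<close> for all other \<open>i\<close>.\<close>

definition sign_eval :: "laurent \<Rightarrow> laurent" where
  "sign_eval = frag_extend (\<lambda>m. Poly_Mapping.single 0 (if even (Poly_Mapping.lookup m 3) then 1 else - 1))"

definition sign_value :: "nat \<Rightarrow> laurent" where
  "sign_value i = (if i = 3 then - 1 else 1)"

lemma sign_eval_tvar: "sign_eval (tvar i) = sign_value i"
proof -
  have "sign_eval (tvar i) = Poly_Mapping.single 0 (if i = 3 then - 1 else 1)"
    by (simp add: sign_eval_def tvar_def lookup_single when_def)
  then show ?thesis by (simp add: sign_value_def single_uminus)
qed

text \<open>Exponents of the third variable add up under multiplication, so their parity gives a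
  multiplicative sign. With no variables, \<open>laurent_ring 0\<close> is a copy of the
  integers.\<close>

lemma sign_eval_ring_hom: "sign_eval \<in> ring_hom (laurent_ring n) (laurent_ring 0)"
  unfolding sign_eval_def
  by (rule frag_extend_ring_hom)
    (simp_all add: mult_single lookup_add laurent_ring_carrier)

lemma sign_eval_surj: "sign_eval ` carrier (laurent_ring n) = carrier (laurent_ring 0)"
  unfolding sign_eval_def
proof (rule frag_extend_laurent_surj)
  fix m :: "nat \<Rightarrow>\<^sub>0 int" assume "Poly_Mapping.keys m \<subseteq> {1..0}"
  then have "m = 0" by simp
  then show "Poly_Mapping.single 0 (if even (Poly_Mapping.lookup m 3) then 1 else - 1) = frag_of m"
    by simp
qed (simp_all add: laurent_ring_carrier)

text \<open>The coefficients have no 2-torsion, hence neither has a free module over them.\<close>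

lemma double_eq_0:
  fixes x :: "'a \<Rightarrow>\<^sub>0 int"
  assumes "x + x = 0"
  shows "x = 0"
proof (rule poly_mapping_eqI)
  fix k
  have "Poly_Mapping.lookup (x + x) k = 0" using assms by simp
  then show "Poly_Mapping.lookup x k = Poly_Mapping.lookup 0 k" by (simp add: lookup_add)
qed

text \<open>The constant coefficient on the left is even. Thus 2 is not a unit, which keeps the
  torsion class of the linked case nonzero.\<close>

lemma double_neq_1: "(x :: laurent) + x \<noteq> 1"
proof
  assume "x + x = 1"
  then have "Poly_Mapping.lookup (x + x) 0 = Poly_Mapping.lookup (1 :: laurent) 0"
    by (rule arg_cong[where f = "\<lambda>p. Poly_Mapping.lookup p 0"])
  then have "2 * Poly_Mapping.lookup x 0 = 1" unfolding lookup_add by simp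
  then show False by presburger
qed

lemma laurent_closed [simp]:
  "0 \<in> carrier (laurent_ring n)" "1 \<in> carrier (laurent_ring n)" "- 1 \<in> carrier (laurent_ring n)"
  by (simp_all add: laurent_ring_carrier)

lemma two_closed: "1 + 1 \<in> carrier (laurent_ring n)"
  using cring.cring_simprules(1)[OF laurent_ring_cring, of 1 n 1] by simp

lemma sign_value_closed [simp]: "sign_value i \<in> carrier (laurent_ring n)"
  by (simp add: sign_value_def)

context hopf
begin

interpretation sign: alexander_base_change "hopf_diagram \<tau>" "laurent_ring 3" "laurent_ring 0"
  tvar sign_value sign_eval
proof -
  interpret R: cring "laurent_ring 3" by (rule laurent_ring_cring)
  interpret S: cring "laurent_ring 0" by (rule laurent_ring_cring)
  show "alexander_base_change (hopf_diagram \<tau>) (laurent_ring 3) (laurent_ring 0)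
      tvar sign_value sign_eval"
    by unfold_locales
      (use sign_eval_ring_hom sign_eval_surj sign_eval_tvar tvar_closed in auto)
qed

lemmas sign_base_change = sign.alexander_base_change_axioms

lemma crossing_strands:
  obtains i j where "i \<in> {1..3}" "j \<in> {1..3}" "i \<noteq> j"
    "\<tau> i = under_curve c" "\<tau> j = 1 - under_curve c"
proof -
  have mem: "under_curve c \<in> {0, 1, 2}" "1 - under_curve c \<in> {0, 1, 2}"
    by (simp_all add: under_curve_def)
  obtain i where i: "i \<in> {1..3}" "\<tau> i = under_curve c"
    using \<tau>_surj[OF mem(1)] by blast
  obtain j where j: "j \<in> {1..3}" "\<tau> j = 1 - under_curve c"
    using \<tau>_surj[OF mem(2)] by blast
  have "under_curve c \<noteq> 1 - under_curve c" by (simp add: under_curve_def)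
  then have "i \<noteq> j" using i(2) j(2) by auto
  with i j show ?thesis by (intro that)
qed

text \<open>
  Both underpassing arcs of a crossing lie on the same circle.  After the evaluation, the relator
  of a crossing is therefore zero if the third component is split off, and twice an arc of the
  other component of the Hopf link, up to sign, if the third component is part of the Hopf link.
\<close>

lemma sign_relator:
  assumes c: "c \<in> crossings (hopf_diagram \<tau>)" and a: "a \<in> arcs (hopf_diagram \<tau>)"
    and i: "i \<in> {1..3}" "\<tau> i = under_curve c" and j: "j \<in> {1..3}" "\<tau> j = 1 - under_curve c"
  shows "sign.B.r c a = (1 - sign_value i) * (if a = curve_arc (\<tau> j) then 1 else 0) +
    (sign_value j - 1) * (if a = curve_arc (\<tau> i) then 1 else 0)"
proof -
  note arcs = crossing_curve_arcs[OF c, folded i(2) j(2)]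
  have e: "basis_vec (laurent_ring 0) (arcs (hopf_diagram \<tau>)) b a = (if a = b then 1 else 0)" for b
    using a by (simp add: basis_vec_def)
  have e0: "(if P then 1 else 0) \<in> carrier (laurent_ring 0)" for P by simp
  show ?thesis
    unfolding sign.B.relator_apply[OF c a] arcs strand_of_curve_arc[OF i(1)]
      strand_of_curve_arc[OF j(1)] e laurent_ring_minus[OF e0] laurent_ring_minus[OF sign_value_closed]
      laurent_ring_simps by (simp add: left_diff_distrib)
qed

lemma sign_relator_closed: "c \<in> crossings (hopf_diagram \<tau>) \<Longrightarrow> sign.B.r c \<in> carrier sign.B.F"
  using sign.B.relator_closed by (rule funcset_mem)

text \<open>No crossing involves the third component here, so both values of \<open>t\<close> in
  every relator are 1.\<close>

lemma sign_relations_zero: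
  assumes \<tau>: "\<tau> 3 = 2" and x: "x \<in> sign.B.N"
  shows "x = \<zero>\<^bsub>sign.B.F\<^esub>"
  using sign.B.relator_closed x
proof (induction rule: sign.B.relations_induct)
  case (smult s c)
  have "sign.B.r c = \<zero>\<^bsub>sign.B.F\<^esub>"
  proof (rule free_module_eqI[OF sign_relator_closed[OF smult(2), unfolded free_module_simps]
        sign.B.F.M.zero_closed[unfolded free_module_simps(1)]])
    fix a assume a: "a \<in> arcs (hopf_diagram \<tau>)"
    obtain i j where ij: "i \<in> {1..3}" "j \<in> {1..3}" "\<tau> i = under_curve c" "\<tau> j = 1 - under_curve c"
      by (rule crossing_strands)
    have "i \<noteq> 3" "j \<noteq> 3" using ij(3,4) \<tau> by (auto simp: under_curve_def split: if_splits)
    then show "sign.B.r c a = \<zero>\<^bsub>sign.B.F\<^esub> a"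
      using sign_relator[OF smult(2) a ij(1,3) ij(2,4)] a by (simp add: sign_value_def)
  qed
  then show ?case
    using sign.B.F.smult_r_null[OF smult(1)] by simp
next
  case (add x y)
  then show ?case using sign.B.F.M.l_zero[OF sign.B.F.M.zero_closed] by (simp only:)
qed simp

text \<open>Curve 0 has value 1 and curve 1 has value -1. If curve 1 passes under, the over arc gets
  the factor 1 - (-1); if it passes over, the under arc gets -1 - 1. In both cases this is the arc
  of curve 0, and the other coefficient vanishes.\<close>

lemma sign_relator_third_linked:
  assumes \<tau>: "\<tau> 3 = 1" "\<tau> 1 = 0" and c: "c \<in> crossings (hopf_diagram \<tau>)"
    and a: "a \<in> arcs (hopf_diagram \<tau>)"
  shows "sign.B.r c a =
    (if under_curve c = 1 then 1 + 1 else - 1 - 1) * (if a = curve_arc 0 then 1 else 0)"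
proof -
  obtain i j where ij: "i \<in> {1..3}" "j \<in> {1..3}" "\<tau> i = under_curve c" "\<tau> j = 1 - under_curve c"
    by (rule crossing_strands)
  have mem: "1 \<in> {1..3::nat}" "3 \<in> {1..3::nat}" by simp_all
  show ?thesis
  proof (cases "under_curve c = 1")
    case True
    then have "i = 3" "j = 1"
      using \<tau>_inj[OF ij(1) mem(2)] \<tau>_inj[OF ij(2) mem(1)] ij(3,4) \<tau> by simp_all
    then show ?thesis
      using sign_relator[OF c a ij(1,3) ij(2,4)] True \<tau> by (simp add: sign_value_def)
  next
    case False
    then have u: "under_curve c = 0" by (simp add: under_curve_def split: if_splits)
    then have "i = 1" "j = 3"
      using \<tau>_inj[OF ij(1) mem(1)] \<tau>_inj[OF ij(2) mem(2)] ij(3,4) \<tau> by simp_all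
    then show ?thesis
      using sign_relator[OF c a ij(1,3) ij(2,4)] u \<tau> by (simp add: sign_value_def)
  qed
qed

lemma curve_arc_0_mem: "curve_arc 0 \<in> arcs (hopf_diagram \<tau>)"
  unfolding arcs_eq by simp

text \<open>Evenness of this coordinate separates relations from the basis vector of the arc, whose
  coordinate is 1.\<close>

lemma sign_relations_even:
  assumes \<tau>: "\<tau> 3 = 1" "\<tau> 1 = 0" and x: "x \<in> sign.B.N"
  shows "\<exists>w. x (curve_arc 0) = w + w"
  using sign.B.relator_closed x
proof (induction rule: sign.B.relations_induct)
  case zero
  show ?case using curve_arc_0_mem by (intro exI[of _ 0]) simp
next
  case (add x y)
  then obtain v w where "x (curve_arc 0) = v + v" "y (curve_arc 0) = w + w" by blast
  then have "(x \<oplus>\<^bsub>sign.B.F\<^esub> y) (curve_arc 0) = (v + w) + (v + w)"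
    using curve_arc_0_mem by simp
  then show ?case by blast
next
  case (smult s c)
  have "(s \<odot>\<^bsub>sign.B.F\<^esub> sign.B.r c) (curve_arc 0) = s * sign.B.r c (curve_arc 0)"
    using curve_arc_0_mem by simp
  also have "sign.B.r c (curve_arc 0) = (if under_curve c = 1 then 1 + 1 else - 1 - 1)"
    using sign_relator_third_linked[OF \<tau> smult(2) curve_arc_0_mem] by simp
  also have "s * \<dots> = (if under_curve c = 1 then s else - s) + (if under_curve c = 1 then s else - s)"
    by (simp add: distrib_left right_diff_distrib)
  finally show ?case by blast
qed

lemma double_basis_relation:
  assumes \<tau>: "\<tau> 3 = 1" "\<tau> 1 = 0"
  shows "(1 + 1) \<odot>\<^bsub>sign.B.F\<^esub> basis_vec (laurent_ring 0) (arcs (hopf_diagram \<tau>)) (curve_arc 0) \<in> sign.B.N"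
proof -
  let ?e = "basis_vec (laurent_ring 0) (arcs (hopf_diagram \<tau>)) (curve_arc 0)"
  \<comment> \<open>The upper crossing, where curve 1 passes under and the factor is +2.\<close>
  let ?c = "curve_plane 1 (1/3)"
  have under: "curve_under 1 (1/3)" unfolding curve_under_def by (auto intro: exI[of _ 0])
  then have c: "?c \<in> crossings (hopf_diagram \<tau>)" unfolding crossings_eq by blast
  have "sign.B.r ?c = (1 + 1) \<odot>\<^bsub>sign.B.F\<^esub> ?e"
  proof (rule free_module_eqI[OF sign_relator_closed[OF c, unfolded free_module_simps]
        sign.B.F.smult_closed[OF two_closed sign.B.basis_vec_closed', unfolded free_module_simps(1)]])
    fix a assume a: "a \<in> arcs (hopf_diagram \<tau>)"
    then show "sign.B.r ?c a = ((1 + 1) \<odot>\<^bsub>sign.B.F\<^esub> ?e) a"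
      using sign_relator_third_linked[OF \<tau> c a] under_curve_eq[OF under] by (simp add: basis_vec_def)
  qed
  moreover have "finite (crossings (hopf_diagram \<tau>))"
    using regular by (simp add: regular_diagram_def)
  ultimately show ?thesis
    using sign.B.relations_generator[OF sign.B.relator_closed _ c] by metis
qed

end

text \<open>Already the Alexander modules are not isomorphic. After evaluation, the class of an arc
  of the linked numbering is nonzero and killed by 2; its preimage \<open>Z\<close> would be such an
  element in a free module.\<close>

lemma not_equivalent_hopf:
  assumes hopf: "hopf \<tau>" "hopf \<tau>'"
    and \<tau>: "\<tau> 3 = 2" and \<tau>': "\<tau>' 3 = 1" "\<tau>' 1 = 0"
  shows "\<not> equivalent_sequences (laurent_ring 3)
    (link_module_sequence (hopf_diagram \<tau>)) (link_module_sequence (hopf_diagram \<tau>'))"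
proof
  let ?R = "laurent_ring 3" and ?S = "laurent_ring 0"
  let ?D = "hopf_diagram \<tau>" and ?D' = "hopf_diagram \<tau>'"
  assume "equivalent_sequences ?R (link_module_sequence ?D) (link_module_sequence ?D')"
  then obtain f where f: "f \<in> module_iso ?R (alexander_module ?R tvar ?D) (alexander_module ?R tvar ?D')"
    by (auto simp: equivalent_sequences_def link_module_sequence_def)
  interpret X: alexander_base_change ?D ?R ?S tvar sign_value sign_eval
    by (rule hopf.sign_base_change[OF hopf(1)])
  interpret Y: alexander_base_change ?D' ?R ?S tvar sign_value sign_eval
    by (rule hopf.sign_base_change[OF hopf(2)])
  interpret QX: module ?S X.B.NQ.Q by (rule X.B.NQ.quotient_module_module)
  interpret QY: module ?S Y.B.NQ.Q by (rule Y.B.NQ.quotient_module_module)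
  obtain g where "g \<in> module_iso ?S (alexander_module ?S sign_value ?D) (alexander_module ?S sign_value ?D')"
    by (rule base_change_module_iso[OF X.base_change Y.base_change f])
  then have g: "g \<in> module_iso ?S X.B.NQ.Q Y.B.NQ.Q"
    unfolding X.B.alexander_module_eq Y.B.alexander_module_eq .

  let ?two = "1 + 1 :: laurent" and ?e = "basis_vec ?S (arcs ?D') (curve_arc 0)"
  let ?E = "Y.B.N +>\<^bsub>Y.B.F\<^esub> ?e"
  have two: "?two \<in> carrier ?S" by (rule two_closed)
  have zero: "0 \<in> carrier ?S" by simp
  have E: "?E \<in> carrier Y.B.NQ.Q"
    unfolding Y.B.NQ.quotient_carrier using Y.B.basis_vec_closed' by (rule imageI)
  have EE: "?two \<odot>\<^bsub>Y.B.NQ.Q\<^esub> ?E = \<zero>\<^bsub>Y.B.NQ.Q\<^esub>"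
    unfolding Y.B.NQ.quotient_smult[OF two Y.B.basis_vec_closed'] Y.B.NQ.quotient_simps(2)
    by (rule Y.B.NQ.a_rcos_const) (rule hopf.double_basis_relation[OF hopf(2) \<tau>'])
  have E0: "0 \<odot>\<^bsub>Y.B.NQ.Q\<^esub> ?E = \<zero>\<^bsub>Y.B.NQ.Q\<^esub>"
    using QY.smult_l_null[OF E] by (simp only: laurent_ring_simps)
  have bij: "inj_on g (carrier X.B.NQ.Q)" "g ` carrier X.B.NQ.Q = carrier Y.B.NQ.Q"
    using g by (simp_all add: module_iso_def bij_betw_def)
  then have "?E \<in> g ` carrier X.B.NQ.Q" using E by simp
  then obtain Z where Z: "Z \<in> carrier X.B.NQ.Q" "g Z = ?E" by blast
  have Z0: "0 \<odot>\<^bsub>X.B.NQ.Q\<^esub> Z = \<zero>\<^bsub>X.B.NQ.Q\<^esub>"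
    using QX.smult_l_null[OF Z(1)] by (simp only: laurent_ring_simps)
  have "Z \<in> (\<lambda>z. X.B.N +>\<^bsub>X.B.F\<^esub> z) ` carrier X.B.F"
    using Z(1) unfolding X.B.NQ.quotient_carrier .
  then obtain z where z: "z \<in> carrier X.B.F" "Z = X.B.N +>\<^bsub>X.B.F\<^esub> z" by blast
  have g_smult: "g (s \<odot>\<^bsub>X.B.NQ.Q\<^esub> Z) = s \<odot>\<^bsub>Y.B.NQ.Q\<^esub> ?E" if "s \<in> carrier ?S" for s
    unfolding Z(2)[symmetric] using g Z(1) that by (simp add: module_iso_def)
  have "g (?two \<odot>\<^bsub>X.B.NQ.Q\<^esub> Z) = g (0 \<odot>\<^bsub>X.B.NQ.Q\<^esub> Z)"
    unfolding g_smult[OF two] g_smult[OF zero] EE E0 ..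
  then have "?two \<odot>\<^bsub>X.B.NQ.Q\<^esub> Z = 0 \<odot>\<^bsub>X.B.NQ.Q\<^esub> Z"
    using inj_onD[OF bij(1)] QX.smult_closed[OF two Z(1)] QX.smult_closed[OF zero Z(1)] by blast
  then have "X.B.N +>\<^bsub>X.B.F\<^esub> (?two \<odot>\<^bsub>X.B.F\<^esub> z) = X.B.N"
    unfolding Z0 unfolding z(2) X.B.NQ.quotient_smult[OF two z(1)] X.B.NQ.quotient_simps(2) .
  then have "?two \<odot>\<^bsub>X.B.F\<^esub> z \<in> X.B.N"
    using X.B.NQ.a_rcos_self[OF X.B.F.smult_closed[OF two z(1)]] by (simp only:)
  \<comment> \<open>The only relation on this side is zero, so an equation between cosets becomes
    one between coordinate vectors.\<close>
  then have zz: "?two \<odot>\<^bsub>X.B.F\<^esub> z = \<zero>\<^bsub>X.B.F\<^esub>"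
    by (rule hopf.sign_relations_zero[OF hopf(1) \<tau>])
  have "z a = 0" if a: "a \<in> arcs ?D" for a
  proof (rule double_eq_0)
    have "(?two \<odot>\<^bsub>X.B.F\<^esub> z) a = z a + z a" using a by (simp add: distrib_right)
    then show "z a + z a = 0" unfolding zz using a by simp
  qed
  then have "z = \<zero>\<^bsub>X.B.F\<^esub>"
    using z(1) by (intro free_module_eqI[OF _ X.B.F.M.zero_closed[unfolded free_module_simps(1)]]) simp_all
  then have "Z = 0 \<odot>\<^bsub>X.B.NQ.Q\<^esub> Z"
    unfolding Z0 unfolding z(2) X.B.NQ.quotient_simps(2) by (simp only: X.B.NQ.coset_zero)
  then have "?E = 0 \<odot>\<^bsub>Y.B.NQ.Q\<^esub> ?E"
    using g_smult[OF zero] Z(2) by (simp only:)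
  then have "?E = Y.B.N"
    unfolding E0 Y.B.NQ.quotient_simps(2) .
  then have "?e \<in> Y.B.N"
    using Y.B.NQ.a_rcos_self[OF Y.B.basis_vec_closed'] by blast
  then obtain w where "?e (curve_arc 0) = w + w"
    using hopf.sign_relations_even[OF hopf(2) \<tau>'] by blast
  then show False
    using hopf.curve_arc_0_mem[OF hopf(2)] double_neq_1[of w] by (simp add: basis_vec_def)
qed

theorem proposition5:
  shows
    "(\<forall>L L' D D'.
        is_link L \<and> is_link L' \<and> num_comps L = num_comps L' \<and>
        diagram_of D L \<and> diagram_of D' L' \<and>
        equivalent_sequences (laurent_ring (num_comps L))
          (link_module_sequence D) (link_module_sequence D') \<longrightarrow>
        equivalent_sequences (laurent_ring 1)
          (reduced_link_module_sequence D) (reduced_link_module_sequence D'))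
     \<and>
     (\<exists>L L' D D'.
        is_link L \<and> is_link L' \<and> num_comps L = num_comps L' \<and>
        diagram_of D L \<and> diagram_of D' L' \<and>
        equivalent_sequences (laurent_ring 1)
          (reduced_link_module_sequence D) (reduced_link_module_sequence D') \<and>
        \<not> equivalent_sequences (laurent_ring (num_comps L))
          (link_module_sequence D) (link_module_sequence D'))"
proof (intro conjI allI impI)
  fix L L' D D'
  assume *: "is_link L \<and> is_link L' \<and> num_comps L = num_comps L' \<and>
    diagram_of D L \<and> diagram_of D' L' \<and>
    equivalent_sequences (laurent_ring (num_comps L)) (link_module_sequence D) (link_module_sequence D')"
  interpret L: link_diagram D L using * by (intro link_diagram.intro) auto
  interpret L': link_diagram D' L' using * by (intro link_diagram.intro) auto
  show "equivalent_sequences (laurent_ring 1)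
      (reduced_link_module_sequence D) (reduced_link_module_sequence D')"
    using * L.num_strands L'.num_strands
    by (intro reduced_equivalent L.arc_diagram_axioms L'.arc_diagram_axioms) auto
next
  \<comment> \<open>The third component is the distant curve 2 under \<tau> and the linked curve 1
    under \<tau>'; curve 0 is the first component in both.\<close>
  define \<tau> \<tau>' :: "nat \<Rightarrow> nat" where
    "\<tau> i = (if i = 1 then 0 else if i = 2 then 1 else 2)" and
    "\<tau>' i = (if i = 1 then 0 else if i = 2 then 2 else 1)" for i
  have "{1..3} = {1, 2, 3 :: nat}" by auto
  then have hopf: "hopf \<tau>" "hopf \<tau>'"
    by (auto simp: hopf_def bij_betw_def inj_on_def \<tau>_def \<tau>'_def)
  have "\<not> equivalent_sequences (laurent_ring 3)
      (link_module_sequence (hopf_diagram \<tau>)) (link_module_sequence (hopf_diagram \<tau>'))"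
    by (rule not_equivalent_hopf[OF hopf]) (simp_all add: \<tau>_def \<tau>'_def)
  then show "\<exists>L L' D D'. is_link L \<and> is_link L' \<and> num_comps L = num_comps L' \<and>
      diagram_of D L \<and> diagram_of D' L' \<and>
      equivalent_sequences (laurent_ring 1)
        (reduced_link_module_sequence D) (reduced_link_module_sequence D') \<and>
      \<not> equivalent_sequences (laurent_ring (num_comps L))
        (link_module_sequence D) (link_module_sequence D')"
    using hopf[THEN hopf.is_link] hopf[THEN hopf.diagram_of]
    by (intro exI[of _ "hopf_link \<tau>"] exI[of _ "hopf_link \<tau>'"] exI[of _ "hopf_diagram \<tau>"]
        exI[of _ "hopf_diagram \<tau>'"])
      (simp add: reduced_sequence_hopf[OF hopf] equivalent_sequences_refl)
qed

end
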